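(* Let $k$ be a field, let $Q$ be a finite connected quiver, let $A=kQ/\langle Z\rangle$ be a finite-dimensional monomial algebra and let $\Lambda=TA$ be its trivial extension. The following assertions are equivalent: 1. There is a $k$-linear isomorphism $Z(A)\cong HH^1(\Lambda)$. 2. $\dim_k HH^1(\Lambda)=1$. 3. $HH^1(A)=0$. 4. $Q$ is a quiver without double arrows such that $\bar Q$ is a tree.
   Context: $Z$ is a set of paths of $Q$ of length at least two, minimal for the subpath order (no strict subpath of an element of $Z$ is in $Z$); $A=kQ/\langle Z\rangle$ where $\langle Z\rangle$ is the two-sided ideal of the path algebra $kQ$ generated by $Z$. $Z(A)$ denotes the center of $A$. $HH^1(\Lambda)=\mathrm{Ext}^1(\Lambda,\Lambda)$ over $\Lambda$-$\Lambda$-bimodules is the first Hochschild cohomology group. The trivial extension $TA$ is the vector space $A\oplus DA$, $DA=\mathrm{Hom}_k(A,k)$ with bimodule structure $(afb)(x)=f(bxa)$, with product $(a,f)(b,g)=(ab,ag+fb)$. $\bar Q$ is the graph obtained from $Q$ by forgetting the orientation of the arrows.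
   Formalization: The case where k has characteristic 2 and Q is a single vertex without arrows is excluded: there A = k, Λ = k[x]/(x²) and dim HH¹(Λ) = 2, so assertions 3 and 4 hold while 1 and 2 fail. *)

theory Defs
  imports
    "HOL-Library.Poly_Mapping"
    "HOL-Algebra.QuotRing"
    "Graph_Theory.Graph_Theory"
    "Jordan_Normal_Form.VS_Connect"
begin

hide_const (open) Multiset.mult Modules.module Polynomial.smult

section \<open>Vector spaces and algebras over a field\<close>

text \<open>
  The ground field is a type \<open>'k :: field\<close>, seen as a ring record by \<^abbrev>\<open>class_ring\<close>.
  Vector spaces and (non-commutative) algebras over \<open>'k\<close> are both \<^type>\<open>module\<close> records;
  for a mere vector space the fields \<^const>\<open>mult\<close> and \<^const>\<open>one\<close> carry no information.
\<close>

definition ground_space :: "('k::field, 'k) module" where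
  "ground_space =
    \<lparr>carrier = UNIV, mult = (*), one = 1, zero = 0, add = (+), smult = (*)\<rparr>"

definition free_space :: "'x set \<Rightarrow> ('k::field, 'x \<Rightarrow>\<^sub>0 'k) module" where
  "free_space X =
    \<lparr>carrier = {w. Poly_Mapping.keys w \<subseteq> X}, mult = undefined, one = undefined,
     zero = 0, add = (+), smult = (\<lambda>c. Poly_Mapping.map ((*) c))\<rparr>"

text \<open>
  The quotient of a vector space by a subspace, or of an algebra by a two-sided ideal.  The ring
  structure is that of \<^const>\<open>FactRing\<close>; the scalar \<open>c\<close> sends the coset of \<open>x\<close> to that of \<open>c x\<close>.
\<close>

definition quot_space ::
  "('k, 'm, 'z) module_scheme \<Rightarrow> 'm set \<Rightarrow> ('k::field, 'm set) module" where
  "quot_space V W = ring.extend (V Quot W)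
    (module.fields (\<lambda>c X. \<Union>x\<in>X. W +>\<^bsub>V\<^esub> (c \<odot>\<^bsub>V\<^esub> x)))"

text \<open>Linear maps are made extensional, so that each of them is represented exactly once.\<close>

definition hom_space ::
  "('k, 'm, 'y) module_scheme \<Rightarrow> ('k, 'n, 'z) module_scheme \<Rightarrow> ('k::field, 'm \<Rightarrow> 'n) module" where
  "hom_space V W =
    \<lparr>carrier = module_hom class_ring V W \<inter> extensional (carrier V),
     mult = undefined, one = undefined,
     zero = (\<lambda>x\<in>carrier V. \<zero>\<^bsub>W\<^esub>),
     add = (\<lambda>f g. \<lambda>x\<in>carrier V. f x \<oplus>\<^bsub>W\<^esub> g x),
     smult = (\<lambda>c f. \<lambda>x\<in>carrier V. c \<odot>\<^bsub>W\<^esub> f x)\<rparr>"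

definition center :: "('k, 'a, 'z) module_scheme \<Rightarrow> ('k::field, 'a, 'z) module_scheme" where
  "center A = A\<lparr>carrier := {a \<in> carrier A. \<forall>b\<in>carrier A. a \<otimes>\<^bsub>A\<^esub> b = b \<otimes>\<^bsub>A\<^esub> a}\<rparr>"


section \<open>Bimodules, the first Ext group and Hochschild cohomology\<close>

text \<open>The field \<open>'k\<close> acts centrally on bimodules, through \<^const>\<open>smult\<close>.\<close>

record ('k, 'm, 'a) bimodule = "('k, 'm) module" +
  lact :: "'a \<Rightarrow> 'm \<Rightarrow> 'm"
  ract :: "'m \<Rightarrow> 'a \<Rightarrow> 'm"

definition regular_bimodule ::
  "('k, 'a, 'z) module_scheme \<Rightarrow> ('k::field, 'a, 'a) bimodule" where
  "regular_bimodule A = module.extend (module.truncate A) (bimodule.fields (mult A) (mult A))"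

definition bimodule_hom_space ::
  "('k, 'a, 'w) module_scheme \<Rightarrow> ('k, 'm, 'a, 'y) bimodule_scheme \<Rightarrow>
   ('k, 'n, 'a, 'z) bimodule_scheme \<Rightarrow> ('k::field, 'm \<Rightarrow> 'n) module" where
  "bimodule_hom_space A M N = (hom_space M N)
    \<lparr>carrier := {f \<in> carrier (hom_space M N). \<forall>a\<in>carrier A. \<forall>x\<in>carrier M.
       f (lact M a x) = lact N a (f x) \<and> f (ract M x a) = ract N (f x) a}\<rparr>"

text \<open>
  The free \<open>A\<close>-bimodule on a set \<open>X\<close>, that is \<open>A \<otimes> kX \<otimes> A\<close>: the vector space with basis the
  triples \<open>(a, x, b)\<close>, modulo the relations that make such a triple bilinear in \<open>a\<close> and \<open>b\<close>.
\<close>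

definition free_bimodule_rels ::
  "('k, 'a, 'z) module_scheme \<Rightarrow> 'x set \<Rightarrow> (('a \<times> 'x \<times> 'a) \<Rightarrow>\<^sub>0 'k::field) set" where
  "free_bimodule_rels A X =
    module.span class_ring (free_space (carrier A \<times> X \<times> carrier A))
     ({Poly_Mapping.single (a \<oplus>\<^bsub>A\<^esub> a', x, b) 1
         - Poly_Mapping.single (a, x, b) 1 - Poly_Mapping.single (a', x, b) 1 | a a' x b.
         a \<in> carrier A \<and> a' \<in> carrier A \<and> x \<in> X \<and> b \<in> carrier A} \<union>
      {Poly_Mapping.single (a, x, b \<oplus>\<^bsub>A\<^esub> b') 1
         - Poly_Mapping.single (a, x, b) 1 - Poly_Mapping.single (a, x, b') 1 | a x b b'.
         a \<in> carrier A \<and> x \<in> X \<and> b \<in> carrier A \<and> b' \<in> carrier A} \<union>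
      {Poly_Mapping.single (c \<odot>\<^bsub>A\<^esub> a, x, b) 1 - Poly_Mapping.single (a, x, b) c | c a x b.
         a \<in> carrier A \<and> x \<in> X \<and> b \<in> carrier A} \<union>
      {Poly_Mapping.single (a, x, c \<odot>\<^bsub>A\<^esub> b) 1 - Poly_Mapping.single (a, x, b) c | c a x b.
         a \<in> carrier A \<and> x \<in> X \<and> b \<in> carrier A})"

definition free_bimodule ::
  "('k, 'a, 'z) module_scheme \<Rightarrow> 'x set \<Rightarrow>
   ('k::field, (('a \<times> 'x \<times> 'a) \<Rightarrow>\<^sub>0 'k) set, 'a) bimodule" where
  "free_bimodule A X =
    (let V = free_space (carrier A \<times> X \<times> carrier A); R = free_bimodule_rels A X
     in module.extend (quot_space V R) (bimodule.fields
      (\<lambda>d C. \<Union>w\<in>C. R +>\<^bsub>V\<^esub>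
         (\<Sum>(a, x, b)\<in>Poly_Mapping.keys w.
            Poly_Mapping.single (d \<otimes>\<^bsub>A\<^esub> a, x, b) (Poly_Mapping.lookup w (a, x, b))))
      (\<lambda>C d. \<Union>w\<in>C. R +>\<^bsub>V\<^esub>
         (\<Sum>(a, x, b)\<in>Poly_Mapping.keys w.
            Poly_Mapping.single (a, x, b \<otimes>\<^bsub>A\<^esub> d) (Poly_Mapping.lookup w (a, x, b))))))"

text \<open>
  Every bimodule \<open>M\<close> is the quotient of the free bimodule on its underlying set by the kernel of
  \<open>(a, m, b) \<mapsto> a m b\<close>.  The image of a coset \<open>C\<close> is the common value on the elements of \<open>C\<close>.
\<close>

definition free_presentation_map ::
  "('k, 'm, 'a, 'z) bimodule_scheme \<Rightarrow> (('a \<times> 'm \<times> 'a) \<Rightarrow>\<^sub>0 'k::field) set \<Rightarrow> 'm" where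
  "free_presentation_map M C = the_elem
    ((\<lambda>w. \<Oplus>\<^bsub>M\<^esub>t\<in>Poly_Mapping.keys w. Poly_Mapping.lookup w t \<odot>\<^bsub>M\<^esub>
       (case t of (a, m, b) \<Rightarrow> ract M (lact M a m) b)) ` C)"

definition first_syzygy ::
  "('k, 'a, 'y) module_scheme \<Rightarrow> ('k, 'm, 'a, 'z) bimodule_scheme \<Rightarrow>
   ('k::field, (('a \<times> 'm \<times> 'a) \<Rightarrow>\<^sub>0 'k) set, 'a) bimodule" where
  "first_syzygy A M = (free_bimodule A (carrier M))
    \<lparr>carrier := {C \<in> carrier (free_bimodule A (carrier M)).
       free_presentation_map M C = \<zero>\<^bsub>M\<^esub>}\<rparr>"

text \<open>
  \<open>Ext\<^sup>1(M, N)\<close> in the category of \<open>A\<close>-\<open>A\<close>-bimodules, from the free presentation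
  \<open>0 \<rightarrow> \<Omega> \<rightarrow> F \<rightarrow> M \<rightarrow> 0\<close>: the cokernel of the restriction map \<open>Hom(F, N) \<rightarrow> Hom(\<Omega>, N)\<close>.
\<close>

definition Ext1 ::
  "('k, 'a, 'x) module_scheme \<Rightarrow> ('k, 'm, 'a, 'y) bimodule_scheme \<Rightarrow>
   ('k, 'n, 'a, 'z) bimodule_scheme \<Rightarrow>
   ('k::field, ((('a \<times> 'm \<times> 'a) \<Rightarrow>\<^sub>0 'k) set \<Rightarrow> 'n) set) module" where
  "Ext1 A M N = quot_space (bimodule_hom_space A (first_syzygy A M) N)
    ((\<lambda>f. restrict f (carrier (first_syzygy A M))) `
      carrier (bimodule_hom_space A (free_bimodule A (carrier M)) N))"

definition HH1 ::
  "('k, 'a, 'z) module_scheme \<Rightarrow>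
   ('k::field, ((('a \<times> 'a \<times> 'a) \<Rightarrow>\<^sub>0 'k) set \<Rightarrow> 'a) set) module" where
  "HH1 A = Ext1 A (regular_bimodule A) (regular_bimodule A)"


section \<open>The trivial extension\<close>

text \<open>\<open>(a f b)(x) = f (b x a)\<close>, whence \<open>(a f)(x) = f (x a)\<close> and \<open>(f b)(x) = f (b x)\<close>.\<close>

definition dual_bimodule ::
  "('k, 'a, 'z) module_scheme \<Rightarrow> ('k::field, 'a \<Rightarrow> 'k, 'a) bimodule" where
  "dual_bimodule A = module.extend (hom_space A ground_space) (bimodule.fields
    (\<lambda>a f. \<lambda>x\<in>carrier A. f (x \<otimes>\<^bsub>A\<^esub> a))
    (\<lambda>f b. \<lambda>x\<in>carrier A. f (b \<otimes>\<^bsub>A\<^esub> x)))"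

definition trivial_extension ::
  "('k, 'a, 'z) module_scheme \<Rightarrow> ('k::field, 'a \<times> ('a \<Rightarrow> 'k)) module" where
  "trivial_extension A = (let D = dual_bimodule A in
    \<lparr>carrier = carrier A \<times> carrier D,
     mult = (\<lambda>(a, f) (b, g). (a \<otimes>\<^bsub>A\<^esub> b, lact D a g \<oplus>\<^bsub>D\<^esub> ract D f b)),
     one = (\<one>\<^bsub>A\<^esub>, \<zero>\<^bsub>D\<^esub>),
     zero = (\<zero>\<^bsub>A\<^esub>, \<zero>\<^bsub>D\<^esub>),
     add = (\<lambda>(a, f) (b, g). (a \<oplus>\<^bsub>A\<^esub> b, f \<oplus>\<^bsub>D\<^esub> g)),
     smult = (\<lambda>c (a, f). (c \<odot>\<^bsub>A\<^esub> a, c \<odot>\<^bsub>D\<^esub> f))\<rparr>)"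


section \<open>Quivers, path algebras and monomial algebras\<close>

text \<open>
  A finite quiver is a \<^locale>\<open>fin_digraph\<close> (loops and parallel arrows are allowed).  A path is a
  triple of source, list of arrows and target, so that each vertex \<open>v\<close> has its trivial path
  \<open>(v, [], v)\<close>.  Paths are composed from left to right.
\<close>

type_synonym ('v, 'e) qpath = "'v \<times> 'e list \<times> 'v"

definition qpaths :: "('v, 'e) pre_digraph \<Rightarrow> ('v, 'e) qpath set" where
  "qpaths Q = {(u, p, v). pre_digraph.awalk Q u p v}"

fun qsource :: "('v, 'e) qpath \<Rightarrow> 'v" where "qsource (u, p, v) = u"
fun qtarget :: "('v, 'e) qpath \<Rightarrow> 'v" where "qtarget (u, p, v) = v"
fun qlength :: "('v, 'e) qpath \<Rightarrow> nat" where "qlength (u, p, v) = length p"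

fun qcomp :: "('v, 'e) qpath \<Rightarrow> ('v, 'e) qpath \<Rightarrow> ('v, 'e) qpath" where
  "qcomp (u, p, v) (v', q, w) = (u, p @ q, w)"

definition subpath :: "('v, 'e) pre_digraph \<Rightarrow> ('v, 'e) qpath \<Rightarrow> ('v, 'e) qpath \<Rightarrow> bool" where
  "subpath Q p q \<longleftrightarrow> (\<exists>r\<in>qpaths Q. \<exists>s\<in>qpaths Q.
     qtarget r = qsource p \<and> qtarget p = qsource s \<and> q = qcomp (qcomp r p) s)"

definition path_algebra ::
  "('v, 'e) pre_digraph \<Rightarrow> ('k::field, ('v, 'e) qpath \<Rightarrow>\<^sub>0 'k) module" where
  "path_algebra Q = (free_space (qpaths Q))
    \<lparr>mult := (\<lambda>x y. \<Sum>p\<in>Poly_Mapping.keys x. \<Sum>q\<in>Poly_Mapping.keys y.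
        if qtarget p = qsource q
        then Poly_Mapping.single (qcomp p q) (Poly_Mapping.lookup x p * Poly_Mapping.lookup y q)
        else 0),
     one := (\<Sum>v\<in>verts Q. Poly_Mapping.single (v, [], v) 1)\<rparr>"

definition monomial_relations :: "('v, 'e) pre_digraph \<Rightarrow> ('v, 'e) qpath set \<Rightarrow> bool" where
  "monomial_relations Q Z \<longleftrightarrow> Z \<subseteq> qpaths Q \<and> (\<forall>p\<in>Z. 2 \<le> qlength p) \<and>
     (\<forall>q\<in>Z. \<forall>p. subpath Q p q \<and> p \<noteq> q \<longrightarrow> p \<notin> Z)"

definition monomial_algebra ::
  "('v, 'e) pre_digraph \<Rightarrow> ('v, 'e) qpath set \<Rightarrow>
   ('k::field, (('v, 'e) qpath \<Rightarrow>\<^sub>0 'k) set) module" where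
  "monomial_algebra Q Z = quot_space (path_algebra Q)
     (Idl\<^bsub>path_algebra Q\<^esub> ((\<lambda>p. Poly_Mapping.single p 1) ` Z))"

text \<open>
  The underlying multigraph of a quiver: each arrow becomes an edge, which can be traversed in both
  directions, so that \<open>(e, False)\<close> and \<open>(e, True)\<close> are the same edge.
\<close>

definition underlying_graph :: "('v, 'e) pre_digraph \<Rightarrow> ('v, 'e \<times> bool) pre_digraph" where
  "underlying_graph Q =
    \<lparr>verts = verts Q, arcs = arcs Q \<times> UNIV,
     tail = (\<lambda>(e, b). if b then head Q e else tail Q e),
     head = (\<lambda>(e, b). if b then tail Q e else head Q e)\<rparr>"

text \<open>
  A cycle of an undirected multigraph does not use an edge twice; in particular loops and pairs of
  parallel edges are cycles.  The predicate \<^const>\<open>Digraph_Component.tree\<close> is not suitable here,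
  as it forbids directed cycles, hence any edge traversed back and forth.
\<close>

definition underlying_tree :: "('v, 'e) pre_digraph \<Rightarrow> bool" where
  "underlying_tree Q \<longleftrightarrow> Digraph_Component.connected (underlying_graph Q) \<and>
     \<not> (\<exists>p. pre_digraph.cycle (underlying_graph Q) p \<and> distinct (map fst p))"

end

theory Submission
  imports Defs
begin

text \<open>
  \<open>HH\<^sup>1\<close> is the space of derivations modulo inner ones, and we show \<open>2 \<Rightarrow> 1 \<Rightarrow> 3 \<Rightarrow> 4 \<Rightarrow> 2\<close>.  A central
  element \<open>z\<close> gives the derivation \<open>(a, f) \<mapsto> (0, z f)\<close> of \<open>TA\<close>, which is inner only for \<open>z = 0\<close>, so that
  \<open>Z(A)\<close> embeds into \<open>HH\<^sup>1(TA)\<close>; as \<open>1 \<in> Z(A)\<close>, the embedding is bijective if \<open>dim HH\<^sup>1(TA) = 1\<close>.  A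
  derivation \<open>\<delta>\<close> of \<open>A\<close> lifts to \<open>(a, f) \<mapsto> (\<delta> a, - f \<circ> \<delta>)\<close>, whose class lies in the image of \<open>Z(A)\<close> only
  if \<open>\<delta>\<close> is inner; hence \<open>Z(A) \<cong> HH\<^sup>1(TA)\<close> forces \<open>HH\<^sup>1(A) = 0\<close>, as \<open>dim A\<close> is finite.  Each weight function on the arrows of
  \<open>Q\<close> gives a derivation of \<open>A\<close> that multiplies a path by its weight; if it is inner, then the
  weight function is the difference of a potential on the vertices, and all weight functions have
  this form only if \<open>Q\<close> is a tree.  If \<open>Q\<close> is a tree, there is at most one path between two
  vertices, and after subtracting an inner derivation, a derivation of \<open>TA\<close> is zero on the vertices,
  then (by the choice of a potential) on \<open>A\<close>; it then multiplies the dual basis of \<open>DA\<close> by a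
  function that is constant because \<open>Q\<close> is connected.
\<close>

no_notation vwalk_join (infixr \<open>\<oplus>\<close> 65)

section \<open>Vector spaces over the ground field\<close>

text \<open>The equivalence fails for one vertex without arrows in characteristic 2: there
  \<open>TA\<close> is the algebra of dual numbers k[x]/(x^2), on which x -> 1 is a derivation
  besides x -> x, so that \<open>HH1\<close> has dimension 2 although 3 and 4 hold. This is the
  origin of \<open>not_point_in_char_2\<close>. In \<open>1 \<Rightarrow> 3\<close> and
  \<open>3 \<Rightarrow> 4\<close> the characteristic does no harm: the weight functions that are
  tested are indicators of a single arrow, and a cycle without repeated edges meets that arrow at
  most once. For a tree, the corner \<open>e_i TA e_j\<close> with distinct vertices has dimension
  at most one, which makes every derivation that kills the vertices diagonal there. The corner at a
  single vertex contains both the vertex and its dual, and this is where characteristic 2 enters.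
  The passage from Ext to derivations is shaped by the free presentation: its generators are all
  elements of the algebra, taken as mere labels, so the syzygy is much larger than the kernel of the
  multiplication map, and an arbitrary function of the label has to be absorbed by a map that
  extends to the free bimodule.\<close>

locale kspace = VS?: vectorspace "class_ring :: 'k::field ring" V
  for V :: "('k::field, 'v, 'z) module_scheme" (structure)

text \<open>Negatives need no condition of their own: since \<open>0 \<odot> x = \<zero>\<close> is
  among the conditions, \<open>(-1) \<odot> x\<close> is inverse to \<open>x\<close>.\<close>

lemma kspaceI:
  fixes V :: "('k::field, 'v, 'z) module_scheme" (structure)
  assumes "\<zero> \<in> carrier V"
    and "\<And>x y. x \<in> carrier V \<Longrightarrow> y \<in> carrier V \<Longrightarrow> x \<oplus> y \<in> carrier V"
    and "\<And>c x. x \<in> carrier V \<Longrightarrow> c \<odot> x \<in> carrier V"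
    and "\<And>x y. x \<in> carrier V \<Longrightarrow> y \<in> carrier V \<Longrightarrow> x \<oplus> y = y \<oplus> x"
    and "\<And>x y z. x \<in> carrier V \<Longrightarrow> y \<in> carrier V \<Longrightarrow> z \<in> carrier V
           \<Longrightarrow> (x \<oplus> y) \<oplus> z = x \<oplus> (y \<oplus> z)"
    and "\<And>x. x \<in> carrier V \<Longrightarrow> x \<oplus> \<zero> = x"
    and "\<And>c d x. x \<in> carrier V \<Longrightarrow> (c * d) \<odot> x = c \<odot> (d \<odot> x)"
    and "\<And>x. x \<in> carrier V \<Longrightarrow> 1 \<odot> x = x"
    and "\<And>x. x \<in> carrier V \<Longrightarrow> 0 \<odot> x = \<zero>"
    and "\<And>c d x. x \<in> carrier V \<Longrightarrow> (c + d) \<odot> x = c \<odot> x \<oplus> d \<odot> x"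
    and "\<And>c x y. x \<in> carrier V \<Longrightarrow> y \<in> carrier V \<Longrightarrow> c \<odot> (x \<oplus> y) = c \<odot> x \<oplus> c \<odot> y"
  shows "kspace V"
proof -
  have neg: "\<exists>y\<in>carrier V. x \<oplus> y = \<zero>" if x: "x \<in> carrier V" for x
  proof (rule bexI[of _ "(-1) \<odot> x"])
    have "x \<oplus> (-1) \<odot> x = (1 + (-1)) \<odot> x"
      using assms(8)[OF x] assms(10)[OF x, of 1 "-1"] by simp
    then show "x \<oplus> (-1) \<odot> x = \<zero>" using assms(9)[OF x] by simp
  qed (use assms(3) x in blast)
  have "module class_ring V"
    by (rule module_criteria) (use assms neg in \<open>auto simp: class_cring.is_cring\<close>)
  then show ?thesis
    by (intro kspace.intro vectorspace.intro class_field)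
qed

text \<open>Bimodules and path algebras extend or override the record of a space that is already
  known to be a vector space; only the four linear fields matter for the transfer.\<close>

lemma kspace_cong:
  assumes V: "kspace V" and eq: "carrier W = carrier V" "\<zero>\<^bsub>W\<^esub> = \<zero>\<^bsub>V\<^esub>" "add W = add V" "smult W = smult V"
  shows "kspace W"
proof -
  interpret kspace V by fact
  show ?thesis
  proof (rule kspaceI)
    show "(c * d) \<odot>\<^bsub>W\<^esub> x = c \<odot>\<^bsub>W\<^esub> (d \<odot>\<^bsub>W\<^esub> x)" if "x \<in> carrier W" for c d x
      using that smult_assoc1[of c d x] unfolding eq by simp
    show "(c + d) \<odot>\<^bsub>W\<^esub> x = c \<odot>\<^bsub>W\<^esub> x \<oplus>\<^bsub>W\<^esub> d \<odot>\<^bsub>W\<^esub> x" if "x \<in> carrier W" for c d x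
      using that smult_l_distr[of c d x] unfolding eq by simp
    show "c \<odot>\<^bsub>W\<^esub> (x \<oplus>\<^bsub>W\<^esub> y) = c \<odot>\<^bsub>W\<^esub> x \<oplus>\<^bsub>W\<^esub> c \<odot>\<^bsub>W\<^esub> y" if "x \<in> carrier W" "y \<in> carrier W" for c x y
      using that smult_r_distr[of c x y] unfolding eq by simp
    show "1 \<odot>\<^bsub>W\<^esub> x = x" "0 \<odot>\<^bsub>W\<^esub> x = \<zero>\<^bsub>W\<^esub>" if "x \<in> carrier W" for x
      using that smult_one[of x] lmult_0[of x] unfolding eq by simp_all
  qed (use smult_closed in \<open>auto simp: eq a_ac\<close>)
qed

context kspace
begin

lemma is_module: "module class_ring V"
  by (rule module_axioms)

lemma scale_closed [simp, intro]: "x \<in> carrier V \<Longrightarrow> c \<odot> x \<in> carrier V"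
  by simp

lemma scale_left_distrib: "x \<in> carrier V \<Longrightarrow> (c + d) \<odot> x = c \<odot> x \<oplus> d \<odot> x"
  using smult_l_distr[of c d x] by simp

lemma scale_right_distrib:
  "x \<in> carrier V \<Longrightarrow> y \<in> carrier V \<Longrightarrow> c \<odot> (x \<oplus> y) = c \<odot> x \<oplus> c \<odot> y"
  using smult_r_distr[of c x y] by simp

lemma scale_scale: "x \<in> carrier V \<Longrightarrow> c \<odot> (d \<odot> x) = (c * d) \<odot> x"
  using smult_assoc1[of c d x] by simp

lemma scale_one: "x \<in> carrier V \<Longrightarrow> 1 \<odot> x = x"
  using smult_one[of x] by simp

lemma scale_zero_left: "x \<in> carrier V \<Longrightarrow> 0 \<odot> x = \<zero>"
  using lmult_0[of x] by simp

lemma scale_zero_right: "c \<odot> \<zero> = \<zero>"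
  using rmult_0[of c] by simp

lemma scale_minus_left: "x \<in> carrier V \<Longrightarrow> (- c) \<odot> x = \<ominus> (c \<odot> x)"
  using smult_l_minus[of c x] by (simp add: class_ring_simps)

lemma scale_minus_right: "x \<in> carrier V \<Longrightarrow> c \<odot> (\<ominus> x) = \<ominus> (c \<odot> x)"
  using smult_r_minus[of c x] by simp

lemma minus_one_scale: "x \<in> carrier V \<Longrightarrow> (- 1) \<odot> x = \<ominus> x"
  by (simp add: scale_minus_left scale_one)

lemma scale_diff_right:
  "x \<in> carrier V \<Longrightarrow> y \<in> carrier V \<Longrightarrow> c \<odot> (x \<ominus> y) = c \<odot> x \<ominus> c \<odot> y"
  by (simp add: a_minus_def scale_right_distrib scale_minus_right)

lemma scale_diff_left: "x \<in> carrier V \<Longrightarrow> (c - d) \<odot> x = c \<odot> x \<ominus> d \<odot> x"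
  using scale_left_distrib[of x c "- d"] by (simp add: a_minus_def scale_minus_left)

lemma eq_iff_minus_zero: "x \<in> carrier V \<Longrightarrow> y \<in> carrier V \<Longrightarrow> x = y \<longleftrightarrow> x \<ominus> y = \<zero>"
  by simp

lemma plus_minus_cancel: "x \<in> carrier V \<Longrightarrow> y \<in> carrier V \<Longrightarrow> x \<ominus> y \<oplus> y = x"
  by (simp add: a_minus_def a_assoc l_neg)

text \<open>The left-hand side is the shape of the additivity relations of the free
  bimodule.\<close>

lemma diff_eq_iff_add:
  assumes "x \<in> carrier V" "y \<in> carrier V" "z \<in> carrier V"
  shows "x \<ominus> y \<ominus> z = \<zero> \<longleftrightarrow> x = y \<oplus> z"
proof -
  have "x \<ominus> y \<ominus> z = x \<ominus> (y \<oplus> z)"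
    using assms by (simp add: a_minus_def minus_add a_assoc)
  then show ?thesis using assms by simp
qed

lemma add_diff_cancel_left: "x \<in> carrier V \<Longrightarrow> y \<in> carrier V \<Longrightarrow> x \<oplus> y \<ominus> x = y"
  by (simp add: a_minus_def a_comm[of x y] a_assoc r_neg)

lemma diff_add_diff:
  assumes "x \<in> carrier V" "y \<in> carrier V" "z \<in> carrier V"
  shows "(x \<ominus> y) \<oplus> (y \<ominus> z) = x \<ominus> z"
proof -
  have "(x \<ominus> y) \<oplus> (y \<ominus> z) = (x \<ominus> y \<oplus> y) \<ominus> z"
    using assms by (simp add: a_minus_def a_assoc)
  then show ?thesis
    using assms by (simp add: plus_minus_cancel)
qed

lemma scale_finsum:
  "f \<in> I \<rightarrow> carrier V \<Longrightarrow> c \<odot> (\<Oplus>i\<in>I. f i) = (\<Oplus>i\<in>I. c \<odot> f i)"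
  using finsum_smult[of c f I] by simp

lemma minus_zero_right [simp]: "x \<in> carrier V \<Longrightarrow> x \<ominus> \<zero> = x"
  by (simp add: a_minus_def)

lemma subspaceI:
  assumes "W \<subseteq> carrier V" "\<zero> \<in> W" "\<And>x y. x \<in> W \<Longrightarrow> y \<in> W \<Longrightarrow> x \<oplus> y \<in> W"
    and "\<And>c x. x \<in> W \<Longrightarrow> c \<odot> x \<in> W"
  shows "submodule class_ring W V"
  using assms by (intro submodule.intro is_module) auto

lemma kspace_subspace:
  assumes "submodule class_ring W V"
  shows "kspace (V\<lparr>carrier := W\<rparr>)"
  by (intro kspace.intro vectorspace.intro class_field submodule_is_module assms)

lemma a_inv_subspace:
  assumes "submodule class_ring W V" and "x \<in> W"
  shows "\<ominus> x \<in> W"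
proof -
  have "(-1) \<odot> x \<in> W"
    using assms by (intro submodule.smult_closed[OF assms(1)]) auto
  then show ?thesis
    using assms submodule.subset[OF assms(1)] minus_one_scale by (metis subsetD)
qed

end

lemma klinI:
  assumes "\<And>x. x \<in> carrier V \<Longrightarrow> f x \<in> carrier W"
    and "\<And>x y. x \<in> carrier V \<Longrightarrow> y \<in> carrier V \<Longrightarrow> f (x \<oplus>\<^bsub>V\<^esub> y) = f x \<oplus>\<^bsub>W\<^esub> f y"
    and "\<And>c x. x \<in> carrier V \<Longrightarrow> f (c \<odot>\<^bsub>V\<^esub> x) = c \<odot>\<^bsub>W\<^esub> f x"
  shows "f \<in> module_hom class_ring V W"
  using assms by (auto simp: module_hom_def)

lemma klin_closed: "f \<in> module_hom class_ring V W \<Longrightarrow> x \<in> carrier V \<Longrightarrow> f x \<in> carrier W"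
  by (auto simp: module_hom_def)

lemma klin_add:
  "f \<in> module_hom class_ring V W \<Longrightarrow> x \<in> carrier V \<Longrightarrow> y \<in> carrier V
     \<Longrightarrow> f (x \<oplus>\<^bsub>V\<^esub> y) = f x \<oplus>\<^bsub>W\<^esub> f y"
  by (auto simp: module_hom_def)

lemma klin_scale:
  "f \<in> module_hom class_ring V W \<Longrightarrow> x \<in> carrier V \<Longrightarrow> f (c \<odot>\<^bsub>V\<^esub> x) = c \<odot>\<^bsub>W\<^esub> f x"
  by (auto simp: module_hom_def)

lemma klin_linear_map:
  assumes "kspace V" "kspace W" "f \<in> module_hom class_ring V W"
  shows "linear_map class_ring V W f"
  using assms by (simp add: linear_map_def mod_hom_def mod_hom_axioms_def kspace_def vectorspace_def)

lemma klin_zero: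
  assumes "kspace V" "kspace W" "f \<in> module_hom class_ring V W"
  shows "f \<zero>\<^bsub>V\<^esub> = \<zero>\<^bsub>W\<^esub>"
proof -
  interpret linear_map class_ring V W f
    by (rule klin_linear_map[OF assms])
  show ?thesis by simp
qed

lemma klin_minus:
  assumes "kspace V" "kspace W" "f \<in> module_hom class_ring V W" "x \<in> carrier V" "y \<in> carrier V"
  shows "f (x \<ominus>\<^bsub>V\<^esub> y) = f x \<ominus>\<^bsub>W\<^esub> f y"
proof -
  interpret linear_map class_ring V W f
    by (rule klin_linear_map[OF assms(1-3)])
  show ?thesis using assms by simp
qed

lemma klin_finsum:
  assumes "kspace V" "kspace W" "f \<in> module_hom class_ring V W"
    and "g \<in> I \<rightarrow> carrier V"
  shows "f (\<Oplus>\<^bsub>V\<^esub>i\<in>I. g i) = (\<Oplus>\<^bsub>W\<^esub>i\<in>I. f (g i))"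
proof -
  interpret A: kspace V by fact
  interpret B: kspace W by fact
  show ?thesis
    using assms(4)
  proof (induction I rule: infinite_finite_induct)
    case (insert i I)
    have "f (finsum V g (insert i I)) = f (g i) \<oplus>\<^bsub>W\<^esub> f (finsum V g I)"
      using insert by (simp add: A.finsum_insert klin_add[OF assms(3)])
    also have "\<dots> = (\<Oplus>\<^bsub>W\<^esub>i\<in>insert i I. f (g i))"
      using insert by (subst B.finsum_insert) (auto simp: klin_closed[OF assms(3)] Pi_iff)
    finally show ?case .
  qed (use klin_zero[OF assms(1-3)] in auto)
qed

lemma klin_cong:
  assumes "kspace V" "f \<in> module_hom class_ring V W" "\<And>x. x \<in> carrier V \<Longrightarrow> g x = f x"
  shows "g \<in> module_hom class_ring V W"
proof -
  interpret V: kspace V by fact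
  show ?thesis
    using assms(2,3) by (intro klinI) (simp_all add: klin_closed klin_add klin_scale)
qed

lemma klin_plus:
  assumes "kspace V" "kspace W" "f \<in> module_hom class_ring V W" "g \<in> module_hom class_ring V W"
  shows "(\<lambda>x. f x \<oplus>\<^bsub>W\<^esub> g x) \<in> module_hom class_ring V W"
proof -
  interpret W: kspace W by fact
  show ?thesis
    using assms(3,4) by (intro klinI) (simp_all add: klin_closed klin_add klin_scale W.a_ac W.scale_right_distrib)
qed

lemma klin_smult:
  assumes "kspace V" "kspace W" "f \<in> module_hom class_ring V W"
  shows "(\<lambda>x. c \<odot>\<^bsub>W\<^esub> f x) \<in> module_hom class_ring V W"
proof -
  interpret W: kspace W by fact
  show ?thesis
    using assms(3) by (intro klinI)
      (simp_all add: klin_closed klin_add klin_scale W.scale_scale W.scale_right_distrib mult.commute)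
qed

lemma klin_diff:
  assumes "kspace V" "kspace W" "f \<in> module_hom class_ring V W" "g \<in> module_hom class_ring V W"
  shows "(\<lambda>x. f x \<ominus>\<^bsub>W\<^esub> g x) \<in> module_hom class_ring V W"
proof -
  interpret W: kspace W by fact
  have "(\<lambda>x. f x \<oplus>\<^bsub>W\<^esub> (- 1) \<odot>\<^bsub>W\<^esub> g x) \<in> module_hom class_ring V W"
    by (intro klin_plus klin_smult assms)
  then show ?thesis
    by (rule klin_cong[OF assms(1)])
      (use assms in \<open>simp add: a_minus_def W.minus_one_scale klin_closed\<close>)
qed

lemma klin_ident:
  fixes V :: "('k::field, 'v, 'z) module_scheme"
  shows "(\<lambda>x. x) \<in> module_hom class_ring V V"
  by (rule klinI) simp_all

lemma klin_compose:
  "f \<in> module_hom class_ring U V \<Longrightarrow> g \<in> module_hom class_ring V W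
     \<Longrightarrow> (\<lambda>x. g (f x)) \<in> module_hom class_ring U W"
  by (rule klinI) (auto simp: klin_closed klin_add klin_scale)


section \<open>Quotient spaces\<close>

lemma quot_space_simps:
  "carrier (quot_space V W) = carrier (V Quot W)"
  "mult (quot_space V W) = mult (V Quot W)"
  "one (quot_space V W) = one (V Quot W)"
  "zero (quot_space V W) = zero (V Quot W)"
  "add (quot_space V W) = add (V Quot W)"
  "smult (quot_space V W) = (\<lambda>c X. \<Union>x\<in>X. W +>\<^bsub>V\<^esub> (c \<odot>\<^bsub>V\<^esub> x))"
  unfolding quot_space_def ring.extend_def module.fields_def
  by simp_all

lemma carrier_FactRing: "carrier (V Quot W) = (\<lambda>x. W +>\<^bsub>V\<^esub> x) ` carrier V"
  unfolding FactRing_def A_RCOSETS_def RCOSETS_def a_r_coset_def ring.simps partial_object.simps monoid.simps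
  by blast

locale kquot = kspace V
  for V :: "('k::field, 'v, 'z) module_scheme" (structure) +
  fixes W
  assumes sub: "submodule class_ring W V"
begin

sublocale abelian_subgroup W V
proof (rule abelian_subgroupI3)
  show "additive_subgroup W V"
  proof (rule additive_subgroupI, rule group.subgroupI)
    show "group (add_monoid V)"
      by (rule a_group)
    show "inv\<^bsub>add_monoid V\<^esub> x \<in> W" if "x \<in> W" for x
      using a_inv_subspace[OF sub that] by (simp add: a_inv_def)
  qed (use submodule.subset[OF sub] submodule.zero_closed[OF sub] submodule.m_closed[OF sub] in auto)
qed (rule abelian_group_axioms)

lemma smult_mem: "x \<in> W \<Longrightarrow> c \<odot> x \<in> W"
  using submodule.smult_closed[OF sub, of c x] by simp

lemma mem_coset_iff:
  assumes "x \<in> carrier V" "y \<in> carrier V"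
  shows "y \<in> W +> x \<longleftrightarrow> y \<ominus> x \<in> W"
  using a_rcos_module[OF assms] by (simp add: a_minus_def)

lemma coset_eq_iff:
  assumes "x \<in> carrier V" "y \<in> carrier V"
  shows "W +> x = W +> y \<longleftrightarrow> x \<ominus> y \<in> W"
proof
  assume "W +> x = W +> y"
  then show "x \<ominus> y \<in> W"
    using mem_coset_iff[OF assms(2,1)] a_rcos_self[OF assms(1)] by simp
next
  assume "x \<ominus> y \<in> W"
  then show "W +> x = W +> y"
    using mem_coset_iff[OF assms(2,1)] a_repr_independence'[of x y] assms(2) by simp
qed

text \<open>Operations on quotients are defined as unions of cosets over all representatives. If
  \<open>g\<close> respects congruence modulo \<open>W\<close>, all members of the union are the
  same coset.\<close>

lemma UN_coset:
  assumes "\<And>y. y \<in> carrier V \<Longrightarrow> g y \<in> carrier V"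
    and "\<And>y z. y \<in> carrier V \<Longrightarrow> z \<in> carrier V \<Longrightarrow> y \<ominus> z \<in> W \<Longrightarrow> g y \<ominus> g z \<in> W"
    and x: "x \<in> carrier V"
  shows "(\<Union>y\<in>W +> x. W +> g y) = W +> g x"
proof -
  have "W +> g y = W +> g x" if "y \<in> W +> x" for y
  proof -
    have y: "y \<in> carrier V"
      using that x a_r_coset_subset_G[of W x] a_subset by auto
    moreover have "y \<ominus> x \<in> W"
      using that mem_coset_iff x y by simp
    ultimately show ?thesis
      using assms coset_eq_iff by simp
  qed
  moreover have "x \<in> W +> x"
    using x by (rule a_rcos_self)
  ultimately show ?thesis by blast
qed

text \<open>Maps out of a quotient are defined by \<open>the_elem\<close> of the image of a coset;
  that they are well defined means that this image is a singleton.\<close>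

lemma image_coset:
  assumes g: "\<And>y z. y \<in> carrier V \<Longrightarrow> z \<in> carrier V \<Longrightarrow> y \<ominus> z \<in> W \<Longrightarrow> g y = g z"
    and x: "x \<in> carrier V"
  shows "g ` (W +> x) = {g x}"
proof (intro equalityI subsetI)
  fix u assume "u \<in> g ` (W +> x)"
  then obtain y where y: "y \<in> W +> x" and u: "u = g y"
    by (rule imageE)
  have yV: "y \<in> carrier V"
    using y x a_r_coset_subset_G[of W x] a_subset by auto
  have "g y = g x"
    by (rule g[OF yV x]) (use y mem_coset_iff[OF x yV] in simp)
  with u show "u \<in> {g x}" by (simp only: singleton_iff)
next
  fix u assume "u \<in> {g x}"
  then show "u \<in> g ` (W +> x)"
    using imageI[OF a_rcos_self[OF x]] singletonD[of u "g x"] by metis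
qed

lemma carrier_quot: "carrier (quot_space V W) = (\<lambda>x. W +> x) ` carrier V"
  unfolding quot_space_simps by (rule carrier_FactRing)

lemma coset_in_quot [simp]: "x \<in> carrier V \<Longrightarrow> W +> x \<in> carrier (quot_space V W)"
  unfolding carrier_quot by (rule imageI)

lemma quotE:
  assumes "X \<in> carrier (quot_space V W)"
  obtains x where "x \<in> carrier V" "X = W +> x"
  using assms by (auto simp: carrier_quot)

lemma zero_quot: "\<zero>\<^bsub>quot_space V W\<^esub> = W"
  unfolding quot_space_simps by (simp add: FactRing_def)

lemma zero_quot': "\<zero>\<^bsub>quot_space V W\<^esub> = W +> \<zero>"
  using a_subset by (simp add: zero_quot)

lemma coset_eq_zero_iff: "x \<in> carrier V \<Longrightarrow> W +> x = \<zero>\<^bsub>quot_space V W\<^esub> \<longleftrightarrow> x \<in> W"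
  using coset_eq_iff[OF _ M.zero_closed, of x] minus_zero_right[of x] unfolding zero_quot' by metis

lemma add_quot:
  "x \<in> carrier V \<Longrightarrow> y \<in> carrier V \<Longrightarrow> (W +> x) \<oplus>\<^bsub>quot_space V W\<^esub> (W +> y) = W +> (x \<oplus> y)"
  unfolding quot_space_simps by (simp add: FactRing_def a_rcos_sum)

lemma smult_quot:
  assumes "x \<in> carrier V"
  shows "c \<odot>\<^bsub>quot_space V W\<^esub> (W +> x) = W +> (c \<odot> x)"
  using UN_coset[of "\<lambda>x. c \<odot> x", OF _ _ assms] smult_mem
  unfolding quot_space_simps by (simp flip: scale_diff_right)

lemma kspace_quot: "kspace (quot_space V W)"
  by (rule kspaceI)
    (auto elim!: quotE simp: add_quot smult_quot zero_quot' a_ac scale_scale scale_one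
      scale_zero_left scale_left_distrib scale_right_distrib)

lemma klin_coset: "(\<lambda>x. W +> x) \<in> module_hom class_ring V (quot_space V W)"
  by (rule klinI) (simp_all only: coset_in_quot add_quot smult_quot)

end


section \<open>Free spaces\<close>

lemma lookup_map_scale [simp]:
  "Poly_Mapping.lookup (Poly_Mapping.map ((*) (c::'k::field)) w) t = c * Poly_Mapping.lookup w t"
  by (simp add: Poly_Mapping.map.rep_eq when_def)

lemma keys_map_scale_subset:
  "Poly_Mapping.keys (Poly_Mapping.map ((*) (c::'k::field)) w) \<subseteq> Poly_Mapping.keys w"
  by (auto simp: in_keys_iff)

lemma map_scale_single [simp]:
  "Poly_Mapping.map ((*) (c::'k::field)) (Poly_Mapping.single t d) = Poly_Mapping.single t (c * d)"
  by (rule poly_mapping_eqI) (simp add: lookup_single when_def)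

lemma map_scale_sum:
  "Poly_Mapping.map ((*) (c::'k::field)) (sum f I) = (\<Sum>i\<in>I. Poly_Mapping.map ((*) c) (f i))"
  by (rule poly_mapping_eqI) (simp add: lookup_sum sum_distrib_left)

lemma map_scale_zero [simp]: "Poly_Mapping.map ((*) (c::'k::field)) 0 = 0"
  by (rule poly_mapping_eqI) simp

lemma free_space_simps [simp]:
  "carrier (free_space X) = {w. Poly_Mapping.keys w \<subseteq> X}"
  "\<zero>\<^bsub>free_space X\<^esub> = 0"
  "w \<oplus>\<^bsub>free_space X\<^esub> w' = w + w'"
  "c \<odot>\<^bsub>free_space X\<^esub> w = Poly_Mapping.map ((*) c) w"
  by (simp_all add: free_space_def)

lemma keys_add_subsetI:
  "Poly_Mapping.keys w \<subseteq> X \<Longrightarrow> Poly_Mapping.keys w' \<subseteq> X \<Longrightarrow> Poly_Mapping.keys (w + w') \<subseteq> X"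
  using keys_add[of w w'] by blast

lemma keys_scale_subsetI:
  "Poly_Mapping.keys w \<subseteq> X \<Longrightarrow> Poly_Mapping.keys (Poly_Mapping.map ((*) (c::'k::field)) w) \<subseteq> X"
  using keys_map_scale_subset[of c w] by blast

lemma keys_minus_subsetI:
  "Poly_Mapping.keys (w :: 'x \<Rightarrow>\<^sub>0 'k::field) \<subseteq> X \<Longrightarrow> Poly_Mapping.keys w' \<subseteq> X
     \<Longrightarrow> Poly_Mapping.keys (w - w') \<subseteq> X"
  unfolding subset_iff in_keys_iff lookup_minus by (metis diff_self)

lemma kspace_free_space: "kspace (free_space X :: ('k::field, 'x \<Rightarrow>\<^sub>0 'k) module)"
  by (rule kspaceI)
    (auto simp: keys_add_subsetI keys_scale_subsetI add_ac lookup_add algebra_simps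
      intro!: poly_mapping_eqI dest: subsetD[OF keys_add] subsetD[OF keys_map_scale_subset])

lemma minus_free_space:
  assumes "Poly_Mapping.keys w \<subseteq> X" "Poly_Mapping.keys w' \<subseteq> X"
  shows "w \<ominus>\<^bsub>free_space X\<^esub> w' = w - (w' :: 'x \<Rightarrow>\<^sub>0 'k::field)"
proof -
  interpret kspace "free_space X :: ('k, 'x \<Rightarrow>\<^sub>0 'k) module"
    by (rule kspace_free_space)
  have "\<ominus>\<^bsub>free_space X\<^esub> w' = - w'"
    by (rule minus_equality) (use assms in \<open>auto simp: in_keys_iff\<close>)
  then show ?thesis
    by (simp add: a_minus_def)
qed

lemma poly_mapping_eq_sum_single:
  "w = (\<Sum>t\<in>Poly_Mapping.keys w. Poly_Mapping.single t (Poly_Mapping.lookup w t))"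
  by (rule poly_mapping_eqI)
    (simp add: lookup_sum lookup_single when_def sum.delta in_keys_iff)

lemma free_space_induct [consumes 1, case_names zero single add]:
  fixes P :: "('x \<Rightarrow>\<^sub>0 'k::field) \<Rightarrow> bool"
  assumes w: "Poly_Mapping.keys w \<subseteq> X"
    and "P 0"
    and "\<And>t c. t \<in> X \<Longrightarrow> P (Poly_Mapping.single t c)"
    and "\<And>w w'. Poly_Mapping.keys w \<subseteq> X \<Longrightarrow> Poly_Mapping.keys w' \<subseteq> X \<Longrightarrow> P w \<Longrightarrow> P w'
           \<Longrightarrow> P (w + w')"
  shows "P w"
proof -
  have "Poly_Mapping.keys (\<Sum>t\<in>K. Poly_Mapping.single t (f t)) \<subseteq> X
      \<and> P (\<Sum>t\<in>K. Poly_Mapping.single t (f t))" if "finite K" "K \<subseteq> X" for K and f :: "'x \<Rightarrow> 'k"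
    using that
  proof (induction K)
    case (insert t K)
    have t: "Poly_Mapping.keys (Poly_Mapping.single t (f t)) \<subseteq> X"
      using insert by simp
    show ?case
      using insert keys_add_subsetI[OF t] assms(3)[of t "f t"] assms(4)[OF t] by simp
  qed (use assms(2) in auto)
  from this[of "Poly_Mapping.keys w" "Poly_Mapping.lookup w"] w show ?thesis
    by (simp flip: poly_mapping_eq_sum_single)
qed

text \<open>The sum has the form of the one in \<open>free_presentation_map\<close>, which thereby
  becomes an instance by mere unfolding.\<close>

definition lin_ext :: "('k, 'w, 'z) module_scheme \<Rightarrow> ('x \<Rightarrow> 'w) \<Rightarrow> ('x \<Rightarrow>\<^sub>0 'k::field) \<Rightarrow> 'w" where
  "lin_ext W \<phi> w = (\<Oplus>\<^bsub>W\<^esub>t\<in>Poly_Mapping.keys w. Poly_Mapping.lookup w t \<odot>\<^bsub>W\<^esub> \<phi> t)"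

context kspace
begin

text \<open>Over a common finite support, the additivity of \<open>lin_ext\<close> is a termwise
  identity.\<close>

lemma lin_ext_superset:
  assumes "finite K" "Poly_Mapping.keys w \<subseteq> K" "\<phi> \<in> K \<rightarrow> carrier V"
  shows "lin_ext V \<phi> w = (\<Oplus>t\<in>K. Poly_Mapping.lookup w t \<odot> \<phi> t)"
  unfolding lin_ext_def
  using assms
  by (intro add.finprod_mono_neutral_cong_left) (auto simp: in_keys_iff Pi_iff scale_zero_left)

lemma lin_ext_single [simp]:
  assumes "\<phi> t \<in> carrier V"
  shows "lin_ext V \<phi> (Poly_Mapping.single t c) = c \<odot> \<phi> t"
  using lin_ext_superset[of "{t}" "Poly_Mapping.single t c" \<phi>] assms by simp

lemma lin_ext_closed:
  assumes "\<phi> \<in> X \<rightarrow> carrier V" "Poly_Mapping.keys w \<subseteq> X"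
  shows "lin_ext V \<phi> w \<in> carrier V"
  unfolding lin_ext_def using assms by (intro finsum_closed) auto

lemma lin_ext_add:
  assumes "\<phi> \<in> X \<rightarrow> carrier V" "Poly_Mapping.keys w \<subseteq> X" "Poly_Mapping.keys w' \<subseteq> X"
  shows "lin_ext V \<phi> (w + w') = lin_ext V \<phi> w \<oplus> lin_ext V \<phi> w'"
proof -
  let ?K = "Poly_Mapping.keys w \<union> Poly_Mapping.keys w'"
  have \<phi>: "\<phi> \<in> ?K \<rightarrow> carrier V" and fin: "finite ?K"
    using assms by auto
  have "lin_ext V \<phi> (w + w') = (\<Oplus>t\<in>?K. Poly_Mapping.lookup (w + w') t \<odot> \<phi> t)"
    by (rule lin_ext_superset[OF fin keys_add \<phi>])
  also have "\<dots> = (\<Oplus>t\<in>?K. Poly_Mapping.lookup w t \<odot> \<phi> t \<oplus> Poly_Mapping.lookup w' t \<odot> \<phi> t)"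
    using \<phi> by (intro finsum_cong') (auto simp: lookup_add scale_left_distrib Pi_iff)
  also have "\<dots> = (\<Oplus>t\<in>?K. Poly_Mapping.lookup w t \<odot> \<phi> t)
      \<oplus> (\<Oplus>t\<in>?K. Poly_Mapping.lookup w' t \<odot> \<phi> t)"
    using \<phi> by (intro finsum_addf) auto
  also have "\<dots> = lin_ext V \<phi> w \<oplus> lin_ext V \<phi> w'"
    using lin_ext_superset[OF fin _ \<phi>, of w] lin_ext_superset[OF fin _ \<phi>, of w'] by simp
  finally show ?thesis .
qed

lemma lin_ext_scale:
  assumes "\<phi> \<in> X \<rightarrow> carrier V" "Poly_Mapping.keys w \<subseteq> X"
  shows "lin_ext V \<phi> (Poly_Mapping.map ((*) c) w) = c \<odot> lin_ext V \<phi> w"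
proof -
  have \<phi>: "\<phi> \<in> Poly_Mapping.keys w \<rightarrow> carrier V"
    using assms by auto
  have "lin_ext V \<phi> (Poly_Mapping.map ((*) c) w)
      = (\<Oplus>t\<in>Poly_Mapping.keys w. c \<odot> (Poly_Mapping.lookup w t \<odot> \<phi> t))"
    unfolding lin_ext_superset[OF finite_keys keys_map_scale_subset \<phi>]
    using \<phi> by (intro finsum_cong') (auto simp: scale_scale Pi_iff)
  also have "\<dots> = c \<odot> lin_ext V \<phi> w"
    unfolding lin_ext_def using \<phi> by (subst scale_finsum) auto
  finally show ?thesis .
qed

lemma klin_lin_ext:
  "\<phi> \<in> X \<rightarrow> carrier V \<Longrightarrow> lin_ext V \<phi> \<in> module_hom class_ring (free_space X) V"
  by (rule klinI) (simp_all add: lin_ext_closed lin_ext_add lin_ext_scale)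

lemma klin_free_eqI:
  assumes f: "f \<in> module_hom class_ring (free_space X) V"
    and g: "g \<in> module_hom class_ring (free_space X) V"
    and eq: "\<And>t. t \<in> X \<Longrightarrow> f (Poly_Mapping.single t 1) = g (Poly_Mapping.single t 1)"
    and w: "Poly_Mapping.keys w \<subseteq> X"
  shows "f w = g w"
  using w
proof (induction w rule: free_space_induct)
  case zero
  then show ?case
    using klin_zero[OF kspace_free_space kspace_axioms f] klin_zero[OF kspace_free_space kspace_axioms g]
    by simp
next
  case (single t c)
  then show ?case
    using klin_scale[OF f, of "Poly_Mapping.single t 1" c]
      klin_scale[OF g, of "Poly_Mapping.single t 1" c] eq[of t] by simp
next
  case (add w w')
  then show ?case
    using klin_add[OF f, of w w'] klin_add[OF g, of w w'] by simp
qed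

end


section \<open>Spaces of linear maps\<close>

lemma hom_space_simps [simp]:
  "carrier (hom_space V W) = module_hom class_ring V W \<inter> extensional (carrier V)"
  "\<zero>\<^bsub>hom_space V W\<^esub> = (\<lambda>x\<in>carrier V. \<zero>\<^bsub>W\<^esub>)"
  "f \<oplus>\<^bsub>hom_space V W\<^esub> g = (\<lambda>x\<in>carrier V. f x \<oplus>\<^bsub>W\<^esub> g x)"
  "c \<odot>\<^bsub>hom_space V W\<^esub> f = (\<lambda>x\<in>carrier V. c \<odot>\<^bsub>W\<^esub> f x)"
  by (simp_all add: hom_space_def)

lemma kspace_hom_space:
  assumes "kspace V" "kspace W"
  shows "kspace (hom_space V W)"
proof -
  interpret V: kspace V by fact
  interpret W: kspace W by fact
  have ext: "f = g" if "f \<in> extensional (carrier V)" "g \<in> extensional (carrier V)"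
    "\<And>x. x \<in> carrier V \<Longrightarrow> f x = g x" for f g
    using that by (rule extensionalityI)
  show ?thesis
    by (rule kspaceI)
      (auto intro!: klinI ext simp: klin_closed klin_add klin_scale W.a_ac W.scale_scale
        W.scale_left_distrib W.scale_right_distrib W.scale_one W.scale_zero_left
        W.scale_zero_right mult.commute)
qed

lemma kspace_ground: "kspace ground_space"
  by (rule kspaceI) (auto simp: ground_space_def algebra_simps)

lemma ground_space_simps [simp]:
  "carrier ground_space = UNIV" "\<zero>\<^bsub>ground_space\<^esub> = 0" "x \<oplus>\<^bsub>ground_space\<^esub> y = x + y"
  "c \<odot>\<^bsub>ground_space\<^esub> x = c * x"
  by (simp_all add: ground_space_def)


lemma finsum_ground_space: "finsum ground_space h I = (\<Sum>i\<in>I. h i :: 'k::field)"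
proof -
  interpret kspace "ground_space :: ('k, 'k) module" by (rule kspace_ground)
  show ?thesis
    by (induction I rule: infinite_finite_induct) (simp_all add: finsum_insert)
qed


section \<open>Dimension\<close>

context kspace
begin

text \<open>The number \<open>dim\<close> is meaningful only together with \<open>fin_dim\<close>,
  hence the conjunction. The right-hand side is the form that is used to exploit and to prove
  assertion 2.\<close>

lemma dim_one_iff:
  "fin_dim \<and> dim = 1 \<longleftrightarrow> (\<exists>b\<in>carrier V. b \<noteq> \<zero> \<and> (\<forall>x\<in>carrier V. \<exists>c. x = c \<odot> b))"
proof
  assume "fin_dim \<and> dim = 1"
  then obtain B where B: "finite B" "basis B" "card B = 1"
    using finite_basis_exists dim_basis by metis
  then obtain b where b: "B = {b}"
    by (meson card_1_singletonE)
  have "b \<in> carrier V" "span {b} = carrier V" "b \<noteq> \<zero>"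
    using B b vs_zero_lin_dep[of "{b}"] by (auto simp: basis_def)
  moreover have "\<exists>c. x = c \<odot> b" if "x \<in> carrier V" for x
    using that finite_in_span[of "{b}" x] calculation by (auto simp: lincomb_def)
  ultimately show "\<exists>b\<in>carrier V. b \<noteq> \<zero> \<and> (\<forall>x\<in>carrier V. \<exists>c. x = c \<odot> b)"
    by blast
next
  assume "\<exists>b\<in>carrier V. b \<noteq> \<zero> \<and> (\<forall>x\<in>carrier V. \<exists>c. x = c \<odot> b)"
  then obtain b where b: "b \<in> carrier V" "b \<noteq> \<zero>" "\<And>x. x \<in> carrier V \<Longrightarrow> \<exists>c. x = c \<odot> b"
    by blast
  have "carrier V \<subseteq> span {b}"
  proof
    fix x assume "x \<in> carrier V"
    then obtain c where "x = c \<odot> b" using b by blast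
    then have "x = lincomb (\<lambda>_. c) {b}"
      using b by (simp add: lincomb_def)
    then show "x \<in> span {b}"
      by (auto simp: span_def)
  qed
  then have gen: "span {b} = carrier V"
    using span_is_subset2[of "{b}"] b by blast
  then show "fin_dim \<and> dim = 1"
    using b dim1I by (auto simp: fin_dim_def)
qed

text \<open>The independent subsets of \<open>W\<close> have at most \<open>dim\<close> elements, so
  there is a maximal one, and a maximal independent subset generates \<open>W\<close>.\<close>

lemma fin_dim_subspace:
  assumes "fin_dim" and W: "submodule class_ring W V"
  shows "vectorspace.fin_dim class_ring (V\<lparr>carrier := W\<rparr>)"
proof -
  interpret W: kspace "V\<lparr>carrier := W\<rparr>"
    by (rule kspace_subspace[OF W])
  let ?P = "\<lambda>S. S \<subseteq> W \<and> \<not> lin_dep S"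
  have WV: "W \<subseteq> carrier V"
    by (rule submodule.subset[OF W])
  have "\<exists>S. finite S \<and> maximal S ?P"
  proof (rule maximal_exists[where N = dim])
    show "finite S \<and> card S \<le> dim" if "?P S" for S
      using li_le_dim[OF assms(1)] that WV by blast
    show "?P {}"
      by (auto simp: lin_dep_def)
  qed
  then obtain S where S: "finite S" "maximal S ?P" by blast
  \<comment> \<open>Linear independence of a subset of \<open>W\<close> does not depend on whether
    it is tested in \<open>V\<close> or in \<open>W\<close>.\<close>
  have "maximal S (\<lambda>S. S \<subseteq> carrier (V\<lparr>carrier := W\<rparr>) \<and> \<not> W.lin_dep S)"
    using S(2) span_li_not_depend(2)[OF _ W] by (auto simp: maximal_def)
  then have "W.span S = carrier (V\<lparr>carrier := W\<rparr>)"
    by (rule W.max_li_is_gen)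
  then show ?thesis
    using S unfolding W.fin_dim_def by (auto simp: maximal_def)
qed

text \<open>By rank-nullity the image has full dimension; a basis of it is an independent set of
  \<open>dim\<close> vectors of \<open>V\<close>, hence a basis of \<open>V\<close>.\<close>

lemma inj_endomorphism_surj:
  assumes fd: "fin_dim" and f: "f \<in> module_hom class_ring V V" and inj: "inj_on f (carrier V)"
  shows "f ` carrier V = carrier V"
proof -
  interpret F: linear_map class_ring V V f
    by (rule klin_linear_map) (use kspace_axioms f in auto)
  have im: "submodule class_ring F.im V"
    by (rule F.im_is_submodule)
  interpret I: kspace "V\<lparr>carrier := F.im\<rparr>"
    by (rule kspace_subspace[OF im])
  have "vectorspace.dim class_ring (V\<lparr>carrier := F.im\<rparr>) = dim"
    using F.rank_nullity[OF fd] F.inj_imp_dim_ker0[OF inj] by simp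
  moreover obtain C where C: "finite C" "I.basis C"
    using I.finite_basis_exists fin_dim_subspace[OF fd im] by blast
  ultimately have card: "card C = dim"
    using I.dim_basis by simp
  have CI: "C \<subseteq> F.im" and "\<not> I.lin_dep C"
    using C by (auto simp: I.basis_def)
  then have "\<not> lin_dep C"
    using span_li_not_depend(2)[OF CI im] by simp
  moreover have CV: "C \<subseteq> carrier V"
    using CI submodule.subset[OF im] by blast
  ultimately have "basis C"
    using dim_li_is_basis[OF fd] C card by simp
  then have "carrier V \<subseteq> F.im"
    using span_is_subset[OF CI im] by (simp add: basis_def)
  then show ?thesis
    using submodule.subset[OF im] by (auto simp: F.im_def)
qed

end


section \<open>Algebras and derivations\<close>

locale kalgebra = kspace A + ring A
  for A :: "('k::field, 'a, 'z) module_scheme" (structure) +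
  assumes scale_mult_left:
      "a \<in> carrier A \<Longrightarrow> b \<in> carrier A \<Longrightarrow> (c \<odot> a) \<otimes> b = c \<odot> (a \<otimes> b)"
    and scale_mult_right:
      "a \<in> carrier A \<Longrightarrow> b \<in> carrier A \<Longrightarrow> a \<otimes> (c \<odot> b) = c \<odot> (a \<otimes> b)"
begin

definition derivation :: "('a \<Rightarrow> 'a) \<Rightarrow> bool" where
  "derivation D \<longleftrightarrow> D \<in> module_hom class_ring A A \<and>
     (\<forall>a\<in>carrier A. \<forall>b\<in>carrier A. D (a \<otimes> b) = D a \<otimes> b \<oplus> a \<otimes> D b)"

text \<open>The sign is that of a bimodule map which sends \<open>1 \<otimes> 1 \<otimes> 1\<close>
  to \<open>x\<close>, evaluated at
  \<open>a \<otimes> 1 \<otimes> 1 - 1 \<otimes> 1 \<otimes> a\<close>.\<close>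

definition inner :: "('a \<Rightarrow> 'a) \<Rightarrow> bool" where
  "inner D \<longleftrightarrow> (\<exists>x\<in>carrier A. \<forall>a\<in>carrier A. D a = a \<otimes> x \<ominus> x \<otimes> a)"

lemma derivation_linear: "derivation D \<Longrightarrow> D \<in> module_hom class_ring A A"
  by (simp add: derivation_def)

lemma derivation_closed: "derivation D \<Longrightarrow> a \<in> carrier A \<Longrightarrow> D a \<in> carrier A"
  by (auto simp: derivation_def intro: klin_closed)

lemma derivation_mult:
  "derivation D \<Longrightarrow> a \<in> carrier A \<Longrightarrow> b \<in> carrier A \<Longrightarrow> D (a \<otimes> b) = D a \<otimes> b \<oplus> a \<otimes> D b"
  by (simp add: derivation_def)

lemma derivation_one: "derivation D \<Longrightarrow> D \<one> = \<zero>"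
  using derivation_mult[of D \<one> \<one>] derivation_closed[of D \<one>] by (simp add: add.l_cancel_one')

lemma mult_diff_right:
  "a \<in> carrier A \<Longrightarrow> b \<in> carrier A \<Longrightarrow> c \<in> carrier A \<Longrightarrow> a \<otimes> (b \<ominus> c) = a \<otimes> b \<ominus> a \<otimes> c"
  by (simp add: a_minus_def r_distr r_minus)

lemma mult_diff_left:
  "a \<in> carrier A \<Longrightarrow> b \<in> carrier A \<Longrightarrow> c \<in> carrier A \<Longrightarrow> (b \<ominus> c) \<otimes> a = b \<otimes> a \<ominus> c \<otimes> a"
  by (simp add: a_minus_def l_distr l_minus)

lemma diff_diff_eq_iff:
  "a \<in> carrier A \<Longrightarrow> b \<in> carrier A \<Longrightarrow> c \<in> carrier A \<Longrightarrow> d \<in> carrier A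
     \<Longrightarrow> (a \<oplus> b) \<ominus> (c \<oplus> d) = (a \<ominus> c) \<oplus> (b \<ominus> d)"
  by (simp add: a_minus_def minus_add a_ac)

lemma derivation_add:
  assumes "derivation D" "derivation E"
  shows "derivation (\<lambda>a. D a \<oplus> E a)"
  unfolding derivation_def
  using assms[THEN derivation_linear] assms[THEN derivation_closed] assms[THEN derivation_mult]
  by (auto intro!: klinI simp: klin_add klin_scale scale_right_distrib l_distr r_distr a_ac)

lemma derivation_scale:
  assumes "derivation D"
  shows "derivation (\<lambda>a. c \<odot> D a)"
  unfolding derivation_def
  using assms[THEN derivation_linear] assms[THEN derivation_closed] assms[THEN derivation_mult]
  by (auto intro!: klinI simp: klin_add klin_scale scale_right_distrib scale_scale mult.commute
      scale_mult_left scale_mult_right)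

lemma derivation_inner:
  assumes x: "x \<in> carrier A"
  shows "derivation (\<lambda>a. a \<otimes> x \<ominus> x \<otimes> a)"
  unfolding derivation_def
proof (intro conjI ballI klinI)
  fix a b assume ab: "a \<in> carrier A" "b \<in> carrier A"
  show "(a \<oplus> b) \<otimes> x \<ominus> x \<otimes> (a \<oplus> b) = a \<otimes> x \<ominus> x \<otimes> a \<oplus> (b \<otimes> x \<ominus> x \<otimes> b)"
    using ab x by (simp add: l_distr r_distr diff_diff_eq_iff)
  \<comment> \<open>The two occurrences of \<open>a \<otimes> x \<otimes> b\<close> cancel.\<close>
  have "(a \<otimes> x \<ominus> x \<otimes> a) \<otimes> b \<oplus> a \<otimes> (b \<otimes> x \<ominus> x \<otimes> b)
      = (a \<otimes> b \<otimes> x \<ominus> a \<otimes> x \<otimes> b) \<oplus> (a \<otimes> x \<otimes> b \<ominus> x \<otimes> a \<otimes> b)"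
    using ab x by (simp add: mult_diff_left mult_diff_right m_assoc a_ac)
  also have "\<dots> = a \<otimes> b \<otimes> x \<ominus> x \<otimes> a \<otimes> b"
    using ab x by (intro diff_add_diff) auto
  finally show "a \<otimes> b \<otimes> x \<ominus> x \<otimes> (a \<otimes> b) = (a \<otimes> x \<ominus> x \<otimes> a) \<otimes> b \<oplus> a \<otimes> (b \<otimes> x \<ominus> x \<otimes> b)"
    using ab x by (simp add: m_assoc)
qed (use x in \<open>auto simp: scale_mult_left scale_mult_right scale_diff_right\<close>)

lemma innerI: "x \<in> carrier A \<Longrightarrow> (\<And>a. a \<in> carrier A \<Longrightarrow> D a = a \<otimes> x \<ominus> x \<otimes> a) \<Longrightarrow> inner D"
  by (auto simp: inner_def)

end

section \<open>The free bimodule on an algebra\<close>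

lemma finsum_free_space:
  assumes "\<And>i. i \<in> I \<Longrightarrow> Poly_Mapping.keys (f i) \<subseteq> X"
  shows "finsum (free_space X) f I = (\<Sum>i\<in>I. f i :: 'x \<Rightarrow>\<^sub>0 'k::field)"
proof -
  interpret kspace "free_space X :: ('k, 'x \<Rightarrow>\<^sub>0 'k) module"
    by (rule kspace_free_space)
  show ?thesis
    using assms by (induction I rule: infinite_finite_induct) (auto simp: finsum_insert Pi_iff)
qed

text \<open>The two actions in \<open>free_bimodule\<close> are given by sums of this kind, with
  \<open>\<sigma>\<close> a substitution of basis triples; as linear extensions they are seen to be
  linear.\<close>

lemma lin_ext_free_space:
  fixes w :: "'x \<Rightarrow>\<^sub>0 'k::field"
  assumes "\<And>t. t \<in> Poly_Mapping.keys w \<Longrightarrow> \<sigma> t \<in> X"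
  shows "lin_ext (free_space X) (\<lambda>t. Poly_Mapping.single (\<sigma> t) 1) w
    = (\<Sum>t\<in>Poly_Mapping.keys w. Poly_Mapping.single (\<sigma> t) (Poly_Mapping.lookup w t))"
  unfolding lin_ext_def using assms by (subst finsum_free_space) (auto simp: split: if_splits)

lemma regular_bimodule_simps [simp]:
  "carrier (regular_bimodule A) = carrier A"
  "\<zero>\<^bsub>regular_bimodule A\<^esub> = \<zero>\<^bsub>A\<^esub>"
  "add (regular_bimodule A) = add A"
  "smult (regular_bimodule A) = smult A"
  "lact (regular_bimodule A) = mult A"
  "ract (regular_bimodule A) = mult A"
  by (simp_all add: regular_bimodule_def module.defs bimodule.defs)

lemma finsum_regular_bimodule: "finsum (regular_bimodule A) = finsum A"
  by (intro ext) (simp add: finsum_def finprod_def)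

context kalgebra
begin

lemma kspace_regular_bimodule: "kspace (regular_bimodule A)"
  by (rule kspace_cong[OF kspace_axioms]) simp_all

abbreviation triples :: "('a \<times> 'a \<times> 'a) set" where
  "triples \<equiv> carrier A \<times> carrier A \<times> carrier A"

abbreviation rels :: "(('a \<times> 'a \<times> 'a) \<Rightarrow>\<^sub>0 'k) set" where
  "rels \<equiv> free_bimodule_rels A (carrier A)"

abbreviation FB :: "('k, (('a \<times> 'a \<times> 'a) \<Rightarrow>\<^sub>0 'k) set, 'a) bimodule" where
  "FB \<equiv> free_bimodule A (carrier A)"

section \<open>The quotient by the bilinearity relations and its pure tensors\<close>

definition cls :: "(('a \<times> 'a \<times> 'a) \<Rightarrow>\<^sub>0 'k) \<Rightarrow> (('a \<times> 'a \<times> 'a) \<Rightarrow>\<^sub>0 'k) set" where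
  "cls w = rels +>\<^bsub>free_space triples\<^esub> w"

text \<open>The pure tensor \<open>a \<otimes> [m] \<otimes> b\<close>, where \<open>[m]\<close> is
  the free generator labelled by \<open>m\<close>. It is linear in \<open>a\<close> and
  \<open>b\<close>, but not in \<open>m\<close>.\<close>

definition tens :: "'a \<Rightarrow> 'a \<Rightarrow> 'a \<Rightarrow> (('a \<times> 'a \<times> 'a) \<Rightarrow>\<^sub>0 'k) set" where
  "tens a m b = cls (Poly_Mapping.single (a, m, b) 1)"

text \<open>The generators inside \<open>free_bimodule_rels\<close>, named so that linear maps can
  be tested on them.\<close>

definition rel_gens :: "(('a \<times> 'a \<times> 'a) \<Rightarrow>\<^sub>0 'k) set" where
  "rel_gens = {Poly_Mapping.single (a \<oplus> a', x, b) 1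
         - Poly_Mapping.single (a, x, b) 1 - Poly_Mapping.single (a', x, b) 1 | a a' x b.
         a \<in> carrier A \<and> a' \<in> carrier A \<and> x \<in> carrier A \<and> b \<in> carrier A} \<union>
      {Poly_Mapping.single (a, x, b \<oplus> b') 1
         - Poly_Mapping.single (a, x, b) 1 - Poly_Mapping.single (a, x, b') 1 | a x b b'.
         a \<in> carrier A \<and> x \<in> carrier A \<and> b \<in> carrier A \<and> b' \<in> carrier A} \<union>
      {Poly_Mapping.single (c \<odot> a, x, b) 1 - Poly_Mapping.single (a, x, b) c | c a x b.
         a \<in> carrier A \<and> x \<in> carrier A \<and> b \<in> carrier A} \<union>
      {Poly_Mapping.single (a, x, c \<odot> b) 1 - Poly_Mapping.single (a, x, b) c | c a x b.
         a \<in> carrier A \<and> x \<in> carrier A \<and> b \<in> carrier A}"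

lemma rels_eq: "rels = LinearCombinations.module.span class_ring (free_space triples) rel_gens"
  by (simp add: free_bimodule_rels_def rel_gens_def)

lemma rel_gens_carrier: "rel_gens \<subseteq> carrier (free_space triples)"
proof
  fix w assume "w \<in> rel_gens"
  then show "w \<in> carrier (free_space triples)"
    unfolding rel_gens_def
    by (elim UnE CollectE exE conjE) (simp_all add: keys_minus_subsetI)
qed

interpretation FV: kspace "free_space triples :: ('k, ('a \<times> 'a \<times> 'a) \<Rightarrow>\<^sub>0 'k) module"
  by (rule kspace_free_space)

lemma submodule_rels: "submodule class_ring rels (free_space triples)"
  unfolding rels_eq by (rule FV.span_is_submodule[OF rel_gens_carrier])

interpretation FQ: kquot "free_space triples :: ('k, ('a \<times> 'a \<times> 'a) \<Rightarrow>\<^sub>0 'k) module" rels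
  by (intro kquot.intro kquot_axioms.intro kspace_free_space submodule_rels)

lemma gen_mem_rels: "w \<in> rel_gens \<Longrightarrow> w \<in> rels"
  unfolding rels_eq using FV.in_own_span[OF rel_gens_carrier] by blast

text \<open>The kernel is a subspace, so it contains the span of the generators as soon as it
  contains them.\<close>

lemma linear_kills_rels:
  assumes V: "kspace V" and f: "f \<in> module_hom class_ring (free_space triples) V"
    and gens: "\<And>w. w \<in> rel_gens \<Longrightarrow> f w = \<zero>\<^bsub>V\<^esub>" and w: "w \<in> rels"
  shows "f w = \<zero>\<^bsub>V\<^esub>"
proof -
  interpret f: linear_map class_ring "free_space triples" V f
    by (rule klin_linear_map[OF kspace_free_space V f])
  have "rels \<subseteq> f.ker"
    unfolding rels_eq using gens rel_gens_carrier
    by (intro FV.span_is_subset f.ker_is_submodule) (auto simp: f.ker_def)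
  with w show ?thesis
    by (auto simp: f.ker_def)
qed

text \<open>Linearity is demanded in the outer arguments only; the middle one runs through a set of
  free generators, and values at different labels are unrelated.\<close>

definition balanced :: "('k, 'v, 'y) module_scheme \<Rightarrow> ('a \<Rightarrow> 'a \<Rightarrow> 'a \<Rightarrow> 'v) \<Rightarrow> bool" where
  "balanced V \<phi> \<longleftrightarrow> (\<forall>m\<in>carrier A. \<forall>b\<in>carrier A.
     (\<lambda>a. \<phi> a m b) \<in> module_hom class_ring A V \<and> (\<lambda>a. \<phi> b m a) \<in> module_hom class_ring A V)"

lemma balanced_closed:
  "balanced V \<phi> \<Longrightarrow> a \<in> carrier A \<Longrightarrow> m \<in> carrier A \<Longrightarrow> b \<in> carrier A \<Longrightarrow> \<phi> a m b \<in> carrier V"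
  by (auto simp: balanced_def intro: klin_closed)

lemma balanced_linear:
  assumes "balanced V \<phi>" "m \<in> carrier A" "b \<in> carrier A"
  shows "(\<lambda>a. \<phi> a m b) \<in> module_hom class_ring A V" "\<phi> b m \<in> module_hom class_ring A V"
  using assms by (auto simp: balanced_def)

text \<open>Each of the four families of generators expresses additivity or homogeneity in one of
  the outer arguments.\<close>

lemma balanced_kills_rels:
  assumes V: "kspace V" and \<phi>: "balanced V \<phi>" and w: "w \<in> rels"
  shows "lin_ext V (\<lambda>(a, m, b). \<phi> a m b) w = \<zero>\<^bsub>V\<^esub>"
proof (rule linear_kills_rels[OF V _ _ w])
  interpret V: kspace V by fact
  let ?\<phi> = "\<lambda>(a, m, b). \<phi> a m b" and ?X = "triples"
  have cl: "?\<phi> \<in> ?X \<rightarrow> carrier V"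
    using balanced_closed[OF \<phi>] by auto
  show lin: "lin_ext V ?\<phi> \<in> module_hom class_ring (free_space triples) V"
    by (rule V.klin_lin_ext[OF cl])
  have add: "\<phi> (a \<oplus> a') m b = \<phi> a m b \<oplus>\<^bsub>V\<^esub> \<phi> a' m b" "\<phi> b m (a \<oplus> a') = \<phi> b m a \<oplus>\<^bsub>V\<^esub> \<phi> b m a'"
    "\<phi> (c \<odot> a) m b = c \<odot>\<^bsub>V\<^esub> \<phi> a m b" "\<phi> b m (c \<odot> a) = c \<odot>\<^bsub>V\<^esub> \<phi> b m a"
    if "a \<in> carrier A" "a' \<in> carrier A" "m \<in> carrier A" "b \<in> carrier A" for a a' m b c
    using klin_add[OF balanced_linear(1)[OF \<phi>]] klin_add[OF balanced_linear(2)[OF \<phi>]]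
      klin_scale[OF balanced_linear(1)[OF \<phi>]] klin_scale[OF balanced_linear(2)[OF \<phi>]] that
    by auto
  have diff: "lin_ext V ?\<phi> (w - w') = lin_ext V ?\<phi> w \<ominus>\<^bsub>V\<^esub> lin_ext V ?\<phi> w'"
    if "Poly_Mapping.keys w \<subseteq> ?X" "Poly_Mapping.keys w' \<subseteq> ?X" for w w'
    using klin_minus[OF kspace_free_space V lin, of w w'] that minus_free_space[OF that] by simp
  have single: "lin_ext V ?\<phi> (Poly_Mapping.single (a, m, b) c) = c \<odot>\<^bsub>V\<^esub> \<phi> a m b"
    if "a \<in> carrier A" "m \<in> carrier A" "b \<in> carrier A" for a m b c
    using that balanced_closed[OF \<phi>] by simp
  show "lin_ext V ?\<phi> w = \<zero>\<^bsub>V\<^esub>" if "w \<in> rel_gens" for w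
    using that unfolding rel_gens_def
    by (auto simp: diff single keys_minus_subsetI add V.scale_one balanced_closed[OF \<phi>]
        V.add_diff_cancel_left)
qed

lemma FB_simps:
  "carrier FB = carrier (quot_space (free_space triples) rels)"
  "\<zero>\<^bsub>FB\<^esub> = \<zero>\<^bsub>quot_space (free_space triples) rels\<^esub>"
  "add FB = add (quot_space (free_space triples) rels)"
  "smult FB = smult (quot_space (free_space triples) rels)"
  by (simp_all add: free_bimodule_def Let_def module.defs bimodule.defs)

lemma cls_closed: "Poly_Mapping.keys w \<subseteq> triples \<Longrightarrow> cls w \<in> carrier FB"
  by (simp add: FB_simps cls_def)

lemma tens_closed [simp]:
  "a \<in> carrier A \<Longrightarrow> m \<in> carrier A \<Longrightarrow> b \<in> carrier A \<Longrightarrow> tens a m b \<in> carrier FB"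
  unfolding tens_def by (rule cls_closed) auto

lemma FBE:
  assumes "C \<in> carrier FB"
  obtains w where "Poly_Mapping.keys w \<subseteq> triples" "C = cls w"
  using assms by (auto simp: FB_simps cls_def FQ.carrier_quot)

interpretation FB: kspace FB
  by (rule kspace_cong[OF FQ.kspace_quot]) (simp_all only: FB_simps)

lemma klin_cls: "cls \<in> module_hom class_ring (free_space triples) FB"
  by (rule klinI) (simp_all add: FB_simps cls_def FQ.add_quot FQ.smult_quot)

lemma cls_eq_zero: "w \<in> rels \<Longrightarrow> cls w = \<zero>\<^bsub>FB\<^esub>"
  using FQ.coset_eq_zero_iff[of w] FQ.a_subset by (auto simp: FB_simps cls_def)

text \<open>Pure tensors span the free bimodule. Nearly all identities between maps on it are
  verified through this rule.\<close>

lemma klin_FB_eqI: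
  assumes V: "kspace V" and f: "f \<in> module_hom class_ring FB V" and g: "g \<in> module_hom class_ring FB V"
    and eq: "\<And>a m b. a \<in> carrier A \<Longrightarrow> m \<in> carrier A \<Longrightarrow> b \<in> carrier A
      \<Longrightarrow> f (tens a m b) = g (tens a m b)"
    and C: "C \<in> carrier FB"
  shows "f C = g C"
proof -
  interpret V: kspace V by fact
  obtain w where w: "Poly_Mapping.keys w \<subseteq> triples" and C: "C = cls w"
    using C by (rule FBE)
  have "f (cls w) = g (cls w)"
    by (rule V.klin_free_eqI[OF klin_compose[OF klin_cls f] klin_compose[OF klin_cls g] _ w])
      (use eq in \<open>auto simp: tens_def\<close>)
  then show ?thesis
    using C by simp
qed

lemma klin_minus_FV:
  assumes "kspace V" "f \<in> module_hom class_ring (free_space triples) V"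
    "Poly_Mapping.keys w \<subseteq> triples" "Poly_Mapping.keys w' \<subseteq> triples"
  shows "f (w - w') = f w \<ominus>\<^bsub>V\<^esub> f w'"
  using klin_minus[OF kspace_free_space assms(1,2), of w w'] assms(3-4) minus_free_space[OF assms(3,4)]
  by simp

lemma cls_single:
  assumes "a \<in> carrier A" "m \<in> carrier A" "b \<in> carrier A"
  shows "cls (Poly_Mapping.single (a, m, b) c) = c \<odot>\<^bsub>FB\<^esub> tens a m b"
  using klin_scale[OF klin_cls, of "Poly_Mapping.single (a, m, b) 1" c] assms
  by (simp add: tens_def)

lemma balanced_tens: "balanced FB tens"
proof -
  note minus = klin_minus_FV[OF FB.kspace_axioms klin_cls] and gen = cls_eq_zero[OF gen_mem_rels]
  have 1: "tens (a \<oplus> a') m b = tens a m b \<oplus>\<^bsub>FB\<^esub> tens a' m b"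
    and 2: "tens b m (a \<oplus> a') = tens b m a \<oplus>\<^bsub>FB\<^esub> tens b m a'"
    if "a \<in> carrier A" "a' \<in> carrier A" "m \<in> carrier A" "b \<in> carrier A" for a a' m b
  proof -
    have "cls (Poly_Mapping.single (a \<oplus> a', m, b) 1 - Poly_Mapping.single (a, m, b) 1
        - Poly_Mapping.single (a', m, b) 1) = \<zero>\<^bsub>FB\<^esub>"
      by (rule gen) (use that in \<open>unfold rel_gens_def, blast\<close>)
    then have "tens (a \<oplus> a') m b \<ominus>\<^bsub>FB\<^esub> tens a m b \<ominus>\<^bsub>FB\<^esub> tens a' m b = \<zero>\<^bsub>FB\<^esub>"
      using that by (simp add: minus keys_minus_subsetI flip: tens_def)
    then show "tens (a \<oplus> a') m b = tens a m b \<oplus>\<^bsub>FB\<^esub> tens a' m b"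
      using that FB.diff_eq_iff_add[of "tens (a \<oplus> a') m b" "tens a m b" "tens a' m b"] by simp
    have "cls (Poly_Mapping.single (b, m, a \<oplus> a') 1 - Poly_Mapping.single (b, m, a) 1
        - Poly_Mapping.single (b, m, a') 1) = \<zero>\<^bsub>FB\<^esub>"
      by (rule gen) (use that in \<open>unfold rel_gens_def, blast\<close>)
    then have "tens b m (a \<oplus> a') \<ominus>\<^bsub>FB\<^esub> tens b m a \<ominus>\<^bsub>FB\<^esub> tens b m a' = \<zero>\<^bsub>FB\<^esub>"
      using that by (simp add: minus keys_minus_subsetI flip: tens_def)
    then show "tens b m (a \<oplus> a') = tens b m a \<oplus>\<^bsub>FB\<^esub> tens b m a'"
      using that FB.diff_eq_iff_add[of "tens b m (a \<oplus> a')" "tens b m a" "tens b m a'"] by simp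
  qed
  have 3: "tens (c \<odot> a) m b = c \<odot>\<^bsub>FB\<^esub> tens a m b" and 4: "tens b m (c \<odot> a) = c \<odot>\<^bsub>FB\<^esub> tens b m a"
    if "a \<in> carrier A" "m \<in> carrier A" "b \<in> carrier A" for c a m b
  proof -
    have "cls (Poly_Mapping.single (c \<odot> a, m, b) 1 - Poly_Mapping.single (a, m, b) c) = \<zero>\<^bsub>FB\<^esub>"
      by (rule gen) (use that in \<open>unfold rel_gens_def, blast\<close>)
    then have "tens (c \<odot> a) m b \<ominus>\<^bsub>FB\<^esub> c \<odot>\<^bsub>FB\<^esub> tens a m b = \<zero>\<^bsub>FB\<^esub>"
      using that by (simp add: minus keys_minus_subsetI cls_single flip: tens_def)
    then show "tens (c \<odot> a) m b = c \<odot>\<^bsub>FB\<^esub> tens a m b"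
      using that by simp
    have "cls (Poly_Mapping.single (b, m, c \<odot> a) 1 - Poly_Mapping.single (b, m, a) c) = \<zero>\<^bsub>FB\<^esub>"
      by (rule gen) (use that in \<open>unfold rel_gens_def, blast\<close>)
    then have "tens b m (c \<odot> a) \<ominus>\<^bsub>FB\<^esub> c \<odot>\<^bsub>FB\<^esub> tens b m a = \<zero>\<^bsub>FB\<^esub>"
      using that by (simp add: minus keys_minus_subsetI cls_single flip: tens_def)
    then show "tens b m (c \<odot> a) = c \<odot>\<^bsub>FB\<^esub> tens b m a"
      using that by simp
  qed
  show ?thesis
    unfolding balanced_def by (auto intro!: klinI simp: 1 2 3 4)
qed

section \<open>The universal property of the free bimodule\<close>

definition FB_ext :: "('k, 'v, 'y) module_scheme \<Rightarrow> ('a \<Rightarrow> 'a \<Rightarrow> 'a \<Rightarrow> 'v) \<Rightarrow>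
    (('a \<times> 'a \<times> 'a) \<Rightarrow>\<^sub>0 'k) set \<Rightarrow> 'v" where
  "FB_ext V \<phi> C = the_elem (lin_ext V (\<lambda>(a, m, b). \<phi> a m b) ` C)"

text \<open>Representatives of one class differ by relations, on which the linear extension of a
  balanced map vanishes, so every representative gives the same value.\<close>

lemma FB_ext_cls:
  assumes V: "kspace V" and \<phi>: "balanced V \<phi>" and w: "Poly_Mapping.keys w \<subseteq> triples"
  shows "FB_ext V \<phi> (cls w) = lin_ext V (\<lambda>(a, m, b). \<phi> a m b) w"
proof -
  interpret V: kspace V by fact
  have cl: "(\<lambda>(a, m, b). \<phi> a m b) \<in> triples \<rightarrow> carrier V"
    using balanced_closed[OF \<phi>] by auto
  note lin = V.klin_lin_ext[OF cl]
  have "lin_ext V (\<lambda>(a, m, b). \<phi> a m b) ` cls w = {lin_ext V (\<lambda>(a, m, b). \<phi> a m b) w}"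
    unfolding cls_def
  proof (rule FQ.image_coset)
    fix y z
    assume yz: "y \<in> carrier (free_space triples)" "z \<in> carrier (free_space triples)"
      and "y \<ominus>\<^bsub>free_space triples\<^esub> z \<in> rels"
    then have "lin_ext V (\<lambda>(a, m, b). \<phi> a m b) (y \<ominus>\<^bsub>free_space triples\<^esub> z) = \<zero>\<^bsub>V\<^esub>"
      by (intro balanced_kills_rels[OF V \<phi>])
    then show "lin_ext V (\<lambda>(a, m, b). \<phi> a m b) y = lin_ext V (\<lambda>(a, m, b). \<phi> a m b) z"
      using klin_minus[OF kspace_free_space V lin yz] klin_closed[OF lin yz(1)] klin_closed[OF lin yz(2)]
      V.eq_iff_minus_zero by (metis (no_types, lifting))
  qed (use w in simp)
  then show ?thesis
    by (simp add: FB_ext_def)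
qed

lemma klin_FB_ext:
  assumes V: "kspace V" and \<phi>: "balanced V \<phi>"
  shows "FB_ext V \<phi> \<in> module_hom class_ring FB V"
proof -
  interpret V: kspace V by fact
  have cl: "(\<lambda>(a, m, b). \<phi> a m b) \<in> triples \<rightarrow> carrier V"
    using balanced_closed[OF \<phi>] by auto
  note lin = V.klin_lin_ext[OF cl] and ext = FB_ext_cls[OF V \<phi>]
  show ?thesis
  proof (rule klinI)
    fix C D assume "C \<in> carrier FB" "D \<in> carrier FB"
    then obtain w w' where w: "Poly_Mapping.keys w \<subseteq> triples" "C = cls w"
      and w': "Poly_Mapping.keys w' \<subseteq> triples" "D = cls w'"
      by (metis FBE)
    have "C \<oplus>\<^bsub>FB\<^esub> D = cls (w + w')"
      using klin_add[OF klin_cls, of w w'] w w' by simp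
    then show "FB_ext V \<phi> (C \<oplus>\<^bsub>FB\<^esub> D) = FB_ext V \<phi> C \<oplus>\<^bsub>V\<^esub> FB_ext V \<phi> D"
      using w w' klin_add[OF lin, of w w'] by (simp add: ext keys_add_subsetI)
  next
    fix c C assume "C \<in> carrier FB"
    then obtain w where w: "Poly_Mapping.keys w \<subseteq> triples" "C = cls w"
      by (metis FBE)
    have "c \<odot>\<^bsub>FB\<^esub> C = cls (Poly_Mapping.map ((*) c) w)"
      using klin_scale[OF klin_cls, of w c] w by simp
    then show "FB_ext V \<phi> (c \<odot>\<^bsub>FB\<^esub> C) = c \<odot>\<^bsub>V\<^esub> FB_ext V \<phi> C"
      using w klin_scale[OF lin, of w c] by (simp add: ext keys_scale_subsetI)
    show "FB_ext V \<phi> C \<in> carrier V"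
      using w klin_closed[OF lin, of w] by (simp add: ext)
  qed
qed

lemma FB_ext_tens:
  assumes V: "kspace V" and \<phi>: "balanced V \<phi>"
    and "a \<in> carrier A" "m \<in> carrier A" "b \<in> carrier A"
  shows "FB_ext V \<phi> (tens a m b) = \<phi> a m b"
proof -
  interpret V: kspace V by fact
  show ?thesis
    unfolding tens_def using assms balanced_closed[OF \<phi>]
    by (subst FB_ext_cls[OF V \<phi>]) (auto simp: V.scale_one)
qed

lemma balanced_tens_compose:
  assumes "f \<in> module_hom class_ring A A" "g \<in> module_hom class_ring A A"
  shows "balanced FB (\<lambda>a m b. tens (f a) m (g b))"
  unfolding balanced_def
proof (intro ballI conjI)
  fix m b assume "m \<in> carrier A" "b \<in> carrier A"
  then show "(\<lambda>a. tens (f a) m (g b)) \<in> module_hom class_ring A FB"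
    using klin_compose[OF assms(1) balanced_linear(1)[OF balanced_tens]] klin_closed[OF assms(2)] by blast
  show "(\<lambda>a. tens (f b) m (g a)) \<in> module_hom class_ring A FB"
    using klin_compose[OF assms(2) balanced_linear(2)[OF balanced_tens]] klin_closed[OF assms(1)]
      \<open>m \<in> carrier A\<close> \<open>b \<in> carrier A\<close> by blast
qed

text \<open>Both actions of \<open>free_bimodule\<close> have this form: one of \<open>f\<close> and
  \<open>g\<close> is a multiplication by a fixed element, the other is the identity.\<close>

lemma UN_triples:
  assumes f: "f \<in> module_hom class_ring A A" and g: "g \<in> module_hom class_ring A A"
    and C: "C \<in> carrier FB"
  shows "(\<Union>w\<in>C. rels +>\<^bsub>free_space triples\<^esub> (\<Sum>(a, x, b)\<in>Poly_Mapping.keys w.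
            Poly_Mapping.single (f a, x, g b) (Poly_Mapping.lookup w (a, x, b))))
    = FB_ext FB (\<lambda>a m b. tens (f a) m (g b)) C"
proof -
  let ?\<sigma> = "\<lambda>(a, x, b). (f a, x, g b)"
  define S where "S w = (\<Sum>t\<in>Poly_Mapping.keys w.
      Poly_Mapping.single (?\<sigma> t) (Poly_Mapping.lookup w t))" for w :: "('a \<times> 'a \<times> 'a) \<Rightarrow>\<^sub>0 'k"
  let ?\<phi> = "\<lambda>a m b. tens (f a) m (g b)"
  have \<sigma>: "?\<sigma> t \<in> triples" if "t \<in> triples" for t
    using that klin_closed[OF f] klin_closed[OF g] by auto
  have bal: "balanced FB ?\<phi>"
    by (rule balanced_tens_compose[OF f g])
  have S: "S w = lin_ext (free_space triples) (\<lambda>t. Poly_Mapping.single (?\<sigma> t) 1) w"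
    if "Poly_Mapping.keys w \<subseteq> triples" for w
    unfolding S_def using that \<sigma> by (subst lin_ext_free_space) auto
  have "(\<lambda>t. Poly_Mapping.single (?\<sigma> t) 1) \<in> triples \<rightarrow> carrier (free_space triples :: ('k, ('a \<times> 'a \<times> 'a) \<Rightarrow>\<^sub>0 'k) module)"
    using \<sigma> by auto
  from FV.klin_lin_ext[OF this]
  have linS: "S \<in> module_hom class_ring (free_space triples) (free_space triples)"
    by (rule klin_cong[OF kspace_free_space]) (simp add: S)
  \<comment> \<open>Both sides are linear in \<open>w\<close> and agree on the basis
    triples.\<close>
  have clsS: "cls (S w) = lin_ext FB (\<lambda>(a, m, b). ?\<phi> a m b) w" if "Poly_Mapping.keys w \<subseteq> triples" for w
  proof (rule FB.klin_free_eqI[OF klin_compose[OF linS klin_cls] FB.klin_lin_ext _ that])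
    show cl: "(\<lambda>(a, m, b). ?\<phi> a m b) \<in> triples \<rightarrow> carrier FB"
      using balanced_closed[OF bal] by auto
    fix t assume t: "t \<in> triples"
    then show "cls (S (Poly_Mapping.single t 1))
        = lin_ext FB (\<lambda>(a, m, b). ?\<phi> a m b) (Poly_Mapping.single t 1)"
      using cl balanced_closed[OF bal] by (auto simp: S_def tens_def FB.scale_one simp del: cl)
  qed
  \<comment> \<open>The substitution maps relations to relations, because its composition with
    \<open>cls\<close> is the linear extension of a balanced map.\<close>
  have S_rels: "S w \<in> rels" if w: "w \<in> rels" for w
  proof -
    have wk: "Poly_Mapping.keys w \<subseteq> triples"
      using w FQ.a_subset by auto
    have "cls (S w) = \<zero>\<^bsub>FB\<^esub>"
      using clsS[OF wk] balanced_kills_rels[OF FB.kspace_axioms bal w] by simp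
    then show ?thesis
      using FQ.coset_eq_zero_iff[OF klin_closed[OF linS, of w]] wk
      by (simp add: cls_def FB_simps)
  qed
  obtain w where w: "Poly_Mapping.keys w \<subseteq> triples" and Cw: "C = cls w"
    using C by (rule FBE)
  have "(\<Union>w\<in>C. rels +>\<^bsub>free_space triples\<^esub> S w) = rels +>\<^bsub>free_space triples\<^esub> S w"
    unfolding Cw cls_def
  proof (rule FQ.UN_coset)
    fix y z assume yz: "y \<in> carrier (free_space triples)" "z \<in> carrier (free_space triples)"
      and "y \<ominus>\<^bsub>free_space triples\<^esub> z \<in> rels"
    then show "S y \<ominus>\<^bsub>free_space triples\<^esub> S z \<in> rels"
      using S_rels klin_minus[OF kspace_free_space kspace_free_space linS yz] by metis
  qed (use klin_closed[OF linS] w in auto)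
  also have "\<dots> = lin_ext FB (\<lambda>(a, m, b). ?\<phi> a m b) w"
    using clsS[OF w] by (simp add: cls_def)
  also have "\<dots> = FB_ext FB ?\<phi> C"
    unfolding Cw by (rule FB_ext_cls[OF FB.kspace_axioms bal w, symmetric])
  finally show ?thesis
    by (simp add: S_def case_prod_unfold)
qed

section \<open>Bimodule actions, and maps on the free bimodule built from a derivation\<close>

lemma klin_id: "(\<lambda>a. a) \<in> module_hom class_ring A A"
  by (rule klin_ident)

lemma klin_lmult: "x \<in> carrier A \<Longrightarrow> (\<lambda>a. x \<otimes> a) \<in> module_hom class_ring A A"
  by (rule klinI) (simp_all add: r_distr scale_mult_right)

lemma klin_rmult: "x \<in> carrier A \<Longrightarrow> (\<lambda>a. a \<otimes> x) \<in> module_hom class_ring A A"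
  by (rule klinI) (simp_all add: l_distr scale_mult_left)

lemma lact_FB_unfold: "lact FB d C = (\<Union>w\<in>C. rels +>\<^bsub>free_space triples\<^esub>
    (\<Sum>(a, x, b)\<in>Poly_Mapping.keys w.
      Poly_Mapping.single (d \<otimes> a, x, b) (Poly_Mapping.lookup w (a, x, b))))"
  by (simp add: free_bimodule_def Let_def module.defs bimodule.defs)

lemma ract_FB_unfold: "ract FB C d = (\<Union>w\<in>C. rels +>\<^bsub>free_space triples\<^esub>
    (\<Sum>(a, x, b)\<in>Poly_Mapping.keys w.
      Poly_Mapping.single (a, x, b \<otimes> d) (Poly_Mapping.lookup w (a, x, b))))"
  by (simp add: free_bimodule_def Let_def module.defs bimodule.defs)

lemma lact_FB:
  assumes "C \<in> carrier FB" "d \<in> carrier A"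
  shows "lact FB d C = FB_ext FB (\<lambda>a m b. tens (d \<otimes> a) m b) C"
  unfolding lact_FB_unfold by (rule UN_triples[OF klin_lmult[OF assms(2)] klin_id assms(1)])

lemma ract_FB:
  assumes "C \<in> carrier FB" "d \<in> carrier A"
  shows "ract FB C d = FB_ext FB (\<lambda>a m b. tens a m (b \<otimes> d)) C"
  unfolding ract_FB_unfold by (rule UN_triples[OF klin_id klin_rmult[OF assms(2)] assms(1)])

lemma klin_lact: "d \<in> carrier A \<Longrightarrow> lact FB d \<in> module_hom class_ring FB FB"
  by (rule klin_cong[OF FB.kspace_axioms klin_FB_ext[OF FB.kspace_axioms
        balanced_tens_compose[OF klin_lmult klin_id]]]) (simp_all add: lact_FB)

lemma klin_ract: "d \<in> carrier A \<Longrightarrow> (\<lambda>C. ract FB C d) \<in> module_hom class_ring FB FB"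
  by (rule klin_cong[OF FB.kspace_axioms klin_FB_ext[OF FB.kspace_axioms
        balanced_tens_compose[OF klin_id klin_rmult]]]) (simp_all add: ract_FB)

lemma lact_tens:
  "d \<in> carrier A \<Longrightarrow> a \<in> carrier A \<Longrightarrow> m \<in> carrier A \<Longrightarrow> b \<in> carrier A
    \<Longrightarrow> lact FB d (tens a m b) = tens (d \<otimes> a) m b"
  using FB_ext_tens[OF FB.kspace_axioms balanced_tens_compose[OF klin_lmult klin_id], of d a m b]
  by (simp add: lact_FB)

lemma ract_tens:
  "d \<in> carrier A \<Longrightarrow> a \<in> carrier A \<Longrightarrow> m \<in> carrier A \<Longrightarrow> b \<in> carrier A
    \<Longrightarrow> ract FB (tens a m b) d = tens a m (b \<otimes> d)"
  using FB_ext_tens[OF FB.kspace_axioms balanced_tens_compose[OF klin_id klin_rmult], of d a m b]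
  by (simp add: ract_FB)

text \<open>The linear map \<open>a \<otimes> [m] \<otimes> b \<mapsto> D a \<otimes> h m \<otimes>
  b\<close>. If \<open>D\<close> is the identity, this is the bimodule map with values
  \<open>h\<close> on the free generators, where \<open>h\<close> is an arbitrary function; if also
  \<open>h\<close> is the identity, it is the free presentation. If \<open>D\<close> is a derivation
  and \<open>h\<close> the identity, it is the cocycle of \<open>D\<close>.\<close>

definition twist :: "('a \<Rightarrow> 'a) \<Rightarrow> ('a \<Rightarrow> 'a) \<Rightarrow> (('a \<times> 'a \<times> 'a) \<Rightarrow>\<^sub>0 'k) set \<Rightarrow> 'a" where
  "twist D h = FB_ext A (\<lambda>a m b. D a \<otimes> h m \<otimes> b)"

abbreviation pres :: "(('a \<times> 'a \<times> 'a) \<Rightarrow>\<^sub>0 'k) set \<Rightarrow> 'a" where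
  "pres \<equiv> twist (\<lambda>a. a) (\<lambda>m. m)"

lemma free_presentation_map_eq: "free_presentation_map (regular_bimodule A) = pres"
  by (intro ext) (simp add: free_presentation_map_def twist_def FB_ext_def lin_ext_def finsum_regular_bimodule)

lemma balanced_twist:
  assumes D: "D \<in> module_hom class_ring A A" and h: "h \<in> carrier A \<rightarrow> carrier A"
  shows "balanced A (\<lambda>a m b. D a \<otimes> h m \<otimes> b)"
  unfolding balanced_def
proof (intro ballI conjI)
  fix m b assume mb: "m \<in> carrier A" "b \<in> carrier A"
  then show "(\<lambda>a. D a \<otimes> h m \<otimes> b) \<in> module_hom class_ring A A"
    using h klin_compose[OF klin_compose[OF D klin_rmult] klin_rmult, of "h m" b] by auto
  show "(\<lambda>a. D b \<otimes> h m \<otimes> a) \<in> module_hom class_ring A A"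
    using mb h klin_closed[OF D] by (intro klin_lmult) auto
qed

lemma klin_twist:
  "D \<in> module_hom class_ring A A \<Longrightarrow> h \<in> carrier A \<rightarrow> carrier A
    \<Longrightarrow> twist D h \<in> module_hom class_ring FB A"
  unfolding twist_def by (intro klin_FB_ext kspace_axioms balanced_twist)

lemma twist_tens:
  "D \<in> module_hom class_ring A A \<Longrightarrow> h \<in> carrier A \<rightarrow> carrier A
    \<Longrightarrow> a \<in> carrier A \<Longrightarrow> m \<in> carrier A \<Longrightarrow> b \<in> carrier A
    \<Longrightarrow> twist D h (tens a m b) = D a \<otimes> h m \<otimes> b"
  unfolding twist_def by (intro FB_ext_tens[OF kspace_axioms balanced_twist])

text \<open>Right linearity holds for every linear \<open>D\<close>, since the right entry of a
  tensor is only multiplied from the right.\<close>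

lemma twist_ract:
  assumes D: "D \<in> module_hom class_ring A A" and h: "h \<in> carrier A \<rightarrow> carrier A"
    and "C \<in> carrier FB" "d \<in> carrier A"
  shows "twist D h (ract FB C d) = twist D h C \<otimes> d"
  by (rule klin_FB_eqI[OF kspace_axioms klin_compose[OF klin_ract klin_twist]
        klin_compose[OF klin_twist klin_rmult]])
    (use assms klin_closed[OF D] in \<open>auto simp: ract_tens twist_tens m_assoc Pi_iff\<close>)

lemma twist_lact:
  assumes h: "h \<in> carrier A \<rightarrow> carrier A"
    and "C \<in> carrier FB" "d \<in> carrier A"
  shows "twist (\<lambda>a. a) h (lact FB d C) = d \<otimes> twist (\<lambda>a. a) h C"
  by (rule klin_FB_eqI[OF kspace_axioms klin_compose[OF klin_lact klin_twist]
        klin_compose[OF klin_twist klin_lmult]])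
    (use assms klin_id in \<open>auto simp: lact_tens twist_tens m_assoc Pi_iff\<close>)

text \<open>The defect from left linearity is a multiple of \<open>pres C\<close>; it vanishes
  exactly where it should, on the syzygy.\<close>

lemma twist_derivation_lact:
  assumes D: "derivation D" and "C \<in> carrier FB" "d \<in> carrier A"
  shows "twist D (\<lambda>m. m) (lact FB d C) = D d \<otimes> pres C \<oplus> d \<otimes> twist D (\<lambda>m. m) C"
  by (rule klin_FB_eqI[OF kspace_axioms klin_compose[OF klin_lact klin_twist]
        klin_plus[OF FB.kspace_axioms kspace_axioms klin_compose[OF klin_twist klin_lmult]
          klin_compose[OF klin_twist klin_lmult]]])
    (use assms klin_id derivation_linear[OF D] derivation_closed[OF D] derivation_mult[OF D]
      in \<open>auto simp: lact_tens twist_tens m_assoc l_distr Pi_iff\<close>)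


section \<open>The first Hochschild cohomology is derivations modulo inner derivations\<close>

abbreviation Syz :: "('k, (('a \<times> 'a \<times> 'a) \<Rightarrow>\<^sub>0 'k) set, 'a) bimodule" where
  "Syz \<equiv> first_syzygy A (regular_bimodule A)"

lemma carrier_Syz: "carrier Syz = {C \<in> carrier FB. pres C = \<zero>}"
  by (simp add: first_syzygy_def free_presentation_map_eq)

lemma Syz_eq: "Syz = FB\<lparr>carrier := carrier Syz\<rparr>"
  by (simp add: first_syzygy_def)

lemma Syz_simps:
  "\<zero>\<^bsub>Syz\<^esub> = \<zero>\<^bsub>FB\<^esub>" "add Syz = add FB" "smult Syz = smult FB" "lact Syz = lact FB" "ract Syz = ract FB"
  by (simp_all add: first_syzygy_def)

lemma ident_funcset: "(\<lambda>m. m) \<in> carrier A \<rightarrow> carrier A"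
  by simp

lemmas klin_pres = klin_twist[OF klin_id ident_funcset]

lemma kspace_Syz: "kspace Syz"
proof -
  have "submodule class_ring (carrier Syz) FB"
    using klin_zero[OF FB.kspace_axioms kspace_axioms klin_pres]
    by (intro FB.subspaceI)
      (auto simp: carrier_Syz klin_add[OF klin_pres] klin_scale[OF klin_pres] scale_zero_right)
  from FB.kspace_subspace[OF this] show ?thesis
    using Syz_eq by simp
qed

lemma Syz_lact_closed: "C \<in> carrier Syz \<Longrightarrow> d \<in> carrier A \<Longrightarrow> lact FB d C \<in> carrier Syz"
  using twist_lact[OF ident_funcset] klin_closed[OF klin_lact] by (auto simp: carrier_Syz)

lemma Syz_ract_closed: "C \<in> carrier Syz \<Longrightarrow> d \<in> carrier A \<Longrightarrow> ract FB C d \<in> carrier Syz"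
  using twist_ract[OF klin_id ident_funcset] klin_closed[OF klin_ract] by (auto simp: carrier_Syz)

abbreviation BH :: "('k, 'm, 'a, 'y) bimodule_scheme \<Rightarrow> ('k, 'm \<Rightarrow> 'a) module" where
  "BH M \<equiv> bimodule_hom_space A M (regular_bimodule A)"

lemma carrier_BH: "f \<in> carrier (BH M) \<longleftrightarrow>
    f \<in> module_hom class_ring M A \<and> f \<in> extensional (carrier M) \<and>
    (\<forall>a\<in>carrier A. \<forall>x\<in>carrier M. f (lact M a x) = a \<otimes> f x \<and> f (ract M x a) = f x \<otimes> a)"
  by (auto simp: bimodule_hom_space_def module_hom_def)

lemma BH_simps:
  "\<zero>\<^bsub>BH M\<^esub> = (\<lambda>x\<in>carrier M. \<zero>)"
  "f \<oplus>\<^bsub>BH M\<^esub> g = (\<lambda>x\<in>carrier M. f x \<oplus> g x)"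
  "c \<odot>\<^bsub>BH M\<^esub> f = (\<lambda>x\<in>carrier M. c \<odot> f x)"
  by (simp_all add: bimodule_hom_space_def)

lemma kspace_BH:
  assumes M: "kspace M"
    and lact: "\<And>a x. a \<in> carrier A \<Longrightarrow> x \<in> carrier M \<Longrightarrow> lact M a x \<in> carrier M"
    and ract: "\<And>a x. a \<in> carrier A \<Longrightarrow> x \<in> carrier M \<Longrightarrow> ract M x a \<in> carrier M"
  shows "kspace (BH M)"
proof -
  interpret M: kspace M by fact
  interpret H: kspace "hom_space M (regular_bimodule A)"
    by (rule kspace_hom_space[OF M kspace_regular_bimodule])
  have sub: "submodule class_ring (carrier (BH M)) (hom_space M (regular_bimodule A))"
  proof (rule H.subspaceI)
    show "carrier (BH M) \<subseteq> carrier (hom_space M (regular_bimodule A))"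
      by (auto simp: bimodule_hom_space_def)
    show "\<zero>\<^bsub>hom_space M (regular_bimodule A)\<^esub> \<in> carrier (BH M)"
      by (auto simp: carrier_BH lact ract scale_zero_right intro!: klinI)
    show "f \<oplus>\<^bsub>hom_space M (regular_bimodule A)\<^esub> g \<in> carrier (BH M)"
      if "f \<in> carrier (BH M)" "g \<in> carrier (BH M)" for f g
      using that klin_closed[of f M A] klin_closed[of g M A]
      by (auto simp: carrier_BH lact ract klin_add klin_scale scale_right_distrib a_ac l_distr r_distr
          intro!: klinI)
    show "c \<odot>\<^bsub>hom_space M (regular_bimodule A)\<^esub> f \<in> carrier (BH M)" if "f \<in> carrier (BH M)" for c f
      using that klin_closed[of f M A]
      by (auto simp: carrier_BH lact ract klin_add klin_scale scale_right_distrib scale_scale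
          scale_mult_left scale_mult_right mult.commute intro!: klinI)
  qed
  have "BH M = (hom_space M (regular_bimodule A))\<lparr>carrier := carrier (BH M)\<rparr>"
    by (simp add: bimodule_hom_space_def)
  with H.kspace_subspace[OF sub] show ?thesis
    by simp
qed

lemma kspace_BH_Syz: "kspace (BH Syz)"
  by (rule kspace_BH[OF kspace_Syz]) (simp_all only: Syz_simps Syz_lact_closed Syz_ract_closed)

interpretation BS: kspace "BH Syz"
  by (rule kspace_BH_Syz)

text \<open>The coboundaries: those bimodule maps on the syzygy that extend to the free
  bimodule.\<close>

definition Bnd :: "((('a \<times> 'a \<times> 'a) \<Rightarrow>\<^sub>0 'k) set \<Rightarrow> 'a) set" where
  "Bnd = (\<lambda>f. restrict f (carrier Syz)) ` carrier (BH FB)"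

lemma HH1_eq: "HH1 A = quot_space (BH Syz) Bnd"
  by (simp add: HH1_def Ext1_def Bnd_def)

lemma Syz_subset: "C \<in> carrier Syz \<Longrightarrow> C \<in> carrier FB"
  by (simp add: carrier_Syz)

lemma klin_Syz: "f \<in> module_hom class_ring FB A \<Longrightarrow> f \<in> module_hom class_ring Syz A"
  by (rule klinI) (simp_all add: Syz_simps klin_add klin_scale klin_closed Syz_subset)

text \<open>The map of a derivation is in general left linear only on the syzygy, which is why
  equivariance is required for elements of the syzygy alone.\<close>

lemma restrict_Syz_BH:
  assumes "f \<in> module_hom class_ring FB A"
    and "\<And>a C. a \<in> carrier A \<Longrightarrow> C \<in> carrier Syz \<Longrightarrow> f (lact FB a C) = a \<otimes> f C"
    and "\<And>a C. a \<in> carrier A \<Longrightarrow> C \<in> carrier Syz \<Longrightarrow> f (ract FB C a) = f C \<otimes> a"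
  shows "restrict f (carrier Syz) \<in> carrier (BH Syz)"
proof -
  have "restrict f (carrier Syz) \<in> module_hom class_ring Syz A"
    by (rule klin_cong[OF kspace_Syz klin_Syz[OF assms(1)]]) simp
  then show ?thesis
    using assms(2,3) by (simp add: carrier_BH Syz_simps Syz_lact_closed Syz_ract_closed)
qed

lemma kspace_BH_FB: "kspace (BH FB)"
  by (rule kspace_BH[OF FB.kspace_axioms]) (auto intro: klin_closed[OF klin_lact] klin_closed[OF klin_ract])

interpretation BF: kspace "BH FB"
  by (rule kspace_BH_FB)

lemma submodule_Bnd: "submodule class_ring Bnd (BH Syz)"
proof (rule BS.subspaceI)
  show "Bnd \<subseteq> carrier (BH Syz)"
    unfolding Bnd_def by (auto simp: carrier_BH dest: Syz_subset intro!: restrict_Syz_BH)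
  have "\<zero>\<^bsub>BH Syz\<^esub> = restrict \<zero>\<^bsub>BH FB\<^esub> (carrier Syz)"
    by (rule ext) (simp add: BH_simps restrict_def Syz_subset)
  then show "\<zero>\<^bsub>BH Syz\<^esub> \<in> Bnd"
    unfolding Bnd_def by blast
  show "f \<oplus>\<^bsub>BH Syz\<^esub> g \<in> Bnd" if fg: "f \<in> Bnd" "g \<in> Bnd" for f g
  proof -
    obtain f' g' where f: "f = restrict f' (carrier Syz)" "f' \<in> carrier (BH FB)"
      and g: "g = restrict g' (carrier Syz)" "g' \<in> carrier (BH FB)"
      using fg unfolding Bnd_def by blast
    have "f \<oplus>\<^bsub>BH Syz\<^esub> g = restrict (f' \<oplus>\<^bsub>BH FB\<^esub> g') (carrier Syz)"
      unfolding f(1) g(1) by (rule ext) (simp add: BH_simps restrict_def Syz_subset)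
    moreover have "f' \<oplus>\<^bsub>BH FB\<^esub> g' \<in> carrier (BH FB)"
      using f g by blast
    ultimately show ?thesis
      unfolding Bnd_def by blast
  qed
  show "c \<odot>\<^bsub>BH Syz\<^esub> f \<in> Bnd" if f: "f \<in> Bnd" for c f
  proof -
    obtain f' where f: "f = restrict f' (carrier Syz)" "f' \<in> carrier (BH FB)"
      using f unfolding Bnd_def by blast
    have "c \<odot>\<^bsub>BH Syz\<^esub> f = restrict (c \<odot>\<^bsub>BH FB\<^esub> f') (carrier Syz)"
      unfolding f(1) by (rule ext) (simp add: BH_simps restrict_def Syz_subset)
    moreover have "c \<odot>\<^bsub>BH FB\<^esub> f' \<in> carrier (BH FB)"
      using f by blast
    ultimately show ?thesis
      unfolding Bnd_def by blast
  qed
qed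

interpretation Q: kquot "BH Syz" Bnd
  by (intro kquot.intro kquot_axioms.intro kspace_BH_Syz submodule_Bnd)

lemma kspace_HH1: "kspace (HH1 A)"
  unfolding HH1_eq by (rule Q.kspace_quot)

section \<open>The cohomology class of a derivation\<close>

definition dmap :: "('a \<Rightarrow> 'a) \<Rightarrow> (('a \<times> 'a \<times> 'a) \<Rightarrow>\<^sub>0 'k) set \<Rightarrow> 'a" where
  "dmap D = restrict (twist D (\<lambda>m. m)) (carrier Syz)"

definition dclass :: "('a \<Rightarrow> 'a) \<Rightarrow> ((('a \<times> 'a \<times> 'a) \<Rightarrow>\<^sub>0 'k) set \<Rightarrow> 'a) set" where
  "dclass D = Bnd +>\<^bsub>BH Syz\<^esub> dmap D"

lemma dmap_closed:
  assumes D: "derivation D"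
  shows "dmap D \<in> carrier (BH Syz)"
  unfolding dmap_def
proof (rule restrict_Syz_BH)
  show "twist D (\<lambda>m. m) \<in> module_hom class_ring FB A"
    by (rule klin_twist[OF derivation_linear[OF D] ident_funcset])
  fix a C assume a: "a \<in> carrier A" and C: "C \<in> carrier Syz"
  show "twist D (\<lambda>m. m) (lact FB a C) = a \<otimes> twist D (\<lambda>m. m) C"
    using twist_derivation_lact[OF D Syz_subset[OF C] a] derivation_closed[OF D a] C a
      klin_closed[OF klin_twist[OF derivation_linear[OF D] ident_funcset] Syz_subset[OF C]]
    by (simp add: carrier_Syz)
  show "twist D (\<lambda>m. m) (ract FB C a) = twist D (\<lambda>m. m) C \<otimes> a"
    using twist_ract[OF derivation_linear[OF D] ident_funcset Syz_subset[OF C] a] .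
qed

lemma dclass_closed: "derivation D \<Longrightarrow> dclass D \<in> carrier (HH1 A)"
  unfolding HH1_eq dclass_def by (intro Q.coset_in_quot dmap_closed)

lemma twist_cong:
  assumes D: "D \<in> module_hom class_ring A A" and E: "E \<in> module_hom class_ring A A"
    and eq: "\<And>a. a \<in> carrier A \<Longrightarrow> D a = E a" and C: "C \<in> carrier FB"
  shows "twist D (\<lambda>m. m) C = twist E (\<lambda>m. m) C"
  by (rule klin_FB_eqI[OF kspace_axioms klin_twist klin_twist])
    (use assms in \<open>auto simp: twist_tens\<close>)

lemma dclass_cong:
  assumes "derivation D" "derivation E" "\<And>a. a \<in> carrier A \<Longrightarrow> D a = E a"
  shows "dclass D = dclass E"
proof -
  have "dmap D = dmap E"
    unfolding dmap_def using assms
    by (intro restrict_ext twist_cong derivation_linear Syz_subset)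
  then show ?thesis
    by (simp add: dclass_def)
qed

lemma dclass_add:
  assumes D: "derivation D" and E: "derivation E"
  shows "dclass (\<lambda>a. D a \<oplus> E a) = dclass D \<oplus>\<^bsub>HH1 A\<^esub> dclass E"
proof -
  have "twist (\<lambda>a. D a \<oplus> E a) (\<lambda>m. m) C = twist D (\<lambda>m. m) C \<oplus> twist E (\<lambda>m. m) C"
    if "C \<in> carrier FB" for C
    by (rule klin_FB_eqI[OF kspace_axioms klin_twist klin_plus[OF FB.kspace_axioms kspace_axioms
            klin_twist klin_twist]])
      (use that D E derivation_add[OF D E] derivation_closed[OF D] derivation_closed[OF E]
        in \<open>auto simp: twist_tens derivation_linear l_distr\<close>)
  then have "dmap (\<lambda>a. D a \<oplus> E a) = dmap D \<oplus>\<^bsub>BH Syz\<^esub> dmap E"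
    by (intro ext) (simp add: dmap_def BH_simps restrict_def Syz_subset)
  then show ?thesis
    unfolding HH1_eq dclass_def using D E by (simp add: Q.add_quot dmap_closed)
qed

lemma dclass_scale:
  assumes D: "derivation D"
  shows "dclass (\<lambda>a. c \<odot> D a) = c \<odot>\<^bsub>HH1 A\<^esub> dclass D"
proof -
  have "twist (\<lambda>a. c \<odot> D a) (\<lambda>m. m) C = c \<odot> twist D (\<lambda>m. m) C"
    if "C \<in> carrier FB" for C
    by (rule klin_FB_eqI[OF kspace_axioms klin_twist klin_smult[OF FB.kspace_axioms kspace_axioms
            klin_twist]])
      (use that D derivation_scale[OF D] derivation_closed[OF D]
        in \<open>auto simp: twist_tens derivation_linear scale_mult_left\<close>)
  then have "dmap (\<lambda>a. c \<odot> D a) = c \<odot>\<^bsub>BH Syz\<^esub> dmap D"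
    by (intro ext) (simp add: dmap_def BH_simps restrict_def Syz_subset)
  then show ?thesis
    unfolding HH1_eq dclass_def using D by (simp add: Q.smult_quot dmap_closed)
qed

text \<open>The universal derivation into the syzygy, carried by the free generator labelled by the
  unit. Composing it with a bimodule map on the syzygy gives a derivation of
  \<open>A\<close>.\<close>

definition univ :: "'a \<Rightarrow> (('a \<times> 'a \<times> 'a) \<Rightarrow>\<^sub>0 'k) set" where
  "univ a = tens a \<one> \<one> \<ominus>\<^bsub>FB\<^esub> tens \<one> \<one> a"

lemma twist_minus:
  assumes "D \<in> module_hom class_ring A A" "h \<in> carrier A \<rightarrow> carrier A" "X \<in> carrier FB" "Y \<in> carrier FB"
  shows "twist D h (X \<ominus>\<^bsub>FB\<^esub> Y) = twist D h X \<ominus> twist D h Y"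
  by (rule klin_minus[OF FB.kspace_axioms kspace_axioms klin_twist]) (use assms in auto)

lemma univ_closed: "a \<in> carrier A \<Longrightarrow> univ a \<in> carrier Syz"
  using klin_id ident_funcset by (simp add: univ_def carrier_Syz twist_minus twist_tens)

text \<open>An extension \<open>f\<close> of the cocycle to the free bimodule yields the element
  \<open>f (tens \<one> \<one> \<one>)\<close> that makes \<open>D\<close> inner. Conversely, if
  \<open>x\<close> makes \<open>D\<close> inner, then the extension sends the generator
  \<open>[m]\<close> to \<open>x \<otimes> m\<close>.\<close>

lemma dclass_eq_zero_iff:
  assumes D: "derivation D"
  shows "dclass D = \<zero>\<^bsub>HH1 A\<^esub> \<longleftrightarrow> inner D"
proof -
  have "dclass D = \<zero>\<^bsub>HH1 A\<^esub> \<longleftrightarrow> dmap D \<in> Bnd"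
    unfolding HH1_eq dclass_def by (rule Q.coset_eq_zero_iff[OF dmap_closed[OF D]])
  also have "\<dots> \<longleftrightarrow> inner D"
  proof
    assume "dmap D \<in> Bnd"
    then obtain f where f: "f \<in> carrier (BH FB)" and Df: "dmap D = restrict f (carrier Syz)"
      unfolding Bnd_def by blast
    have lin: "f \<in> module_hom class_ring FB A"
      and l: "\<And>a C. a \<in> carrier A \<Longrightarrow> C \<in> carrier FB \<Longrightarrow> f (lact FB a C) = a \<otimes> f C"
      and r: "\<And>a C. a \<in> carrier A \<Longrightarrow> C \<in> carrier FB \<Longrightarrow> f (ract FB C a) = f C \<otimes> a"
      using f by (auto simp: carrier_BH)
    have "D a = a \<otimes> f (tens \<one> \<one> \<one>) \<ominus> f (tens \<one> \<one> \<one>) \<otimes> a" if a: "a \<in> carrier A" for a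
    proof -
      \<comment> \<open>The second tensor of \<open>univ a\<close> contributes
        \<open>D \<one>\<close>, which is zero.\<close>
      have "D a = dmap D (univ a)"
        using a D derivation_closed[OF D] univ_closed[OF a] ident_funcset derivation_one[OF D]
        unfolding dmap_def by (simp add: univ_def twist_minus twist_tens derivation_linear)
      also have "\<dots> = f (univ a)"
        using Df univ_closed[OF a] by simp
      also have "\<dots> = f (tens a \<one> \<one>) \<ominus> f (tens \<one> \<one> a)"
        unfolding univ_def using a by (intro klin_minus[OF FB.kspace_axioms kspace_axioms lin]) auto
      also have "\<dots> = a \<otimes> f (tens \<one> \<one> \<one>) \<ominus> f (tens \<one> \<one> \<one>) \<otimes> a"
        using a l[of a "tens \<one> \<one> \<one>"] r[of a "tens \<one> \<one> \<one>"] by (simp add: lact_tens ract_tens)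
      finally show ?thesis .
    qed
    then show "inner D"
      using klin_closed[OF lin] by (intro innerI[of "f (tens \<one> \<one> \<one>)"]) auto
  next
    assume "inner D"
    then obtain x where x: "x \<in> carrier A" and Dx: "\<And>a. a \<in> carrier A \<Longrightarrow> D a = a \<otimes> x \<ominus> x \<otimes> a"
      by (auto simp: inner_def)
    define h where "h m = x \<otimes> m" for m
    have h: "h \<in> carrier A \<rightarrow> carrier A"
      using x by (auto simp: h_def)
    \<comment> \<open>From \<open>D a \<otimes> m \<otimes> b = a \<otimes> x \<otimes> m \<otimes>
      b \<ominus> x \<otimes> a \<otimes> m \<otimes> b\<close>: the first term is a bimodule map,
      the second vanishes on the syzygy.\<close>
    have eq: "twist D (\<lambda>m. m) C = twist (\<lambda>a. a) h C \<ominus> x \<otimes> pres C" if "C \<in> carrier FB" for C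
    proof (rule klin_FB_eqI[OF kspace_axioms klin_twist[OF derivation_linear[OF D] ident_funcset]
          klin_diff[OF FB.kspace_axioms kspace_axioms klin_twist[OF klin_id h]
            klin_compose[OF klin_pres klin_lmult[OF x]]] _ that])
      fix a m b assume "a \<in> carrier A" "m \<in> carrier A" "b \<in> carrier A"
      then show "twist D (\<lambda>m. m) (tens a m b) = twist (\<lambda>a. a) h (tens a m b) \<ominus> x \<otimes> pres (tens a m b)"
        using x h D Dx klin_id ident_funcset
        by (simp add: twist_tens derivation_linear h_def mult_diff_left m_assoc)
    qed
    have "restrict (twist (\<lambda>a. a) h) (carrier FB) \<in> carrier (BH FB)"
      using klin_cong[OF FB.kspace_axioms klin_twist[OF klin_id h]] h
        klin_closed[OF klin_lact] klin_closed[OF klin_ract]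
      by (auto simp: carrier_BH twist_lact twist_ract klin_id)
    moreover have "dmap D = restrict (restrict (twist (\<lambda>a. a) h) (carrier FB)) (carrier Syz)"
      unfolding dmap_def
    proof (rule restrict_ext)
      fix C assume C: "C \<in> carrier Syz"
      then show "twist D (\<lambda>m. m) C = restrict (twist (\<lambda>a. a) h) (carrier FB) C"
        using eq[OF Syz_subset[OF C]] x klin_closed[OF klin_twist[OF klin_id h] Syz_subset[OF C]]
        by (simp add: carrier_Syz)
    qed
    ultimately show "dmap D \<in> Bnd"
      unfolding Bnd_def by blast
  qed
  finally show ?thesis .
qed

lemma klin_univ: "univ \<in> module_hom class_ring A FB"
proof -
  have "(\<lambda>a. tens a \<one> \<one> \<ominus>\<^bsub>FB\<^esub> tens \<one> \<one> a) \<in> module_hom class_ring A FB"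
    using balanced_linear[OF balanced_tens, of \<one> \<one>]
    by (intro klin_diff kspace_axioms FB.kspace_axioms) auto
  then show ?thesis
    by (simp add: univ_def[abs_def])
qed

lemma klin_into_Syz:
  "f \<in> module_hom class_ring V FB \<Longrightarrow> (\<And>x. x \<in> carrier V \<Longrightarrow> f x \<in> carrier Syz)
    \<Longrightarrow> f \<in> module_hom class_ring V Syz"
  by (rule klinI) (simp_all add: Syz_simps klin_add klin_scale)

text \<open>The Leibniz rule of the universal derivation; the tensor
  \<open>a \<otimes> [1] \<otimes> b\<close> cancels.\<close>

lemma univ_mult:
  assumes "a \<in> carrier A" "b \<in> carrier A"
  shows "univ (a \<otimes> b) = lact FB a (univ b) \<oplus>\<^bsub>FB\<^esub> ract FB (univ a) b"
proof -
  have "lact FB a (univ b) = tens (a \<otimes> b) \<one> \<one> \<ominus>\<^bsub>FB\<^esub> tens a \<one> b"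
    unfolding univ_def using assms
    by (simp add: klin_minus[OF FB.kspace_axioms FB.kspace_axioms klin_lact] lact_tens)
  moreover have "ract FB (univ a) b = tens a \<one> b \<ominus>\<^bsub>FB\<^esub> tens \<one> \<one> (a \<otimes> b)"
    unfolding univ_def using assms
    by (simp add: klin_minus[OF FB.kspace_axioms FB.kspace_axioms klin_ract] ract_tens)
  ultimately show ?thesis
    unfolding univ_def using assms by (simp add: FB.diff_add_diff)
qed

text \<open>Elements of the syzygy that compare the generator \<open>[m]\<close> with
  \<open>[1]\<close>. They are present because the free bimodule has one generator for every element
  of \<open>A\<close>.\<close>

definition swap :: "'a \<Rightarrow> (('a \<times> 'a \<times> 'a) \<Rightarrow>\<^sub>0 'k) set" where
  "swap m = tens \<one> m \<one> \<ominus>\<^bsub>FB\<^esub> tens m \<one> \<one>"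

lemma swap_closed: "m \<in> carrier A \<Longrightarrow> swap m \<in> carrier Syz"
  using klin_id ident_funcset by (simp add: swap_def carrier_Syz twist_minus twist_tens)

text \<open>A linear retraction of the free bimodule onto the syzygy: the subtracted tensor has the
  same image in \<open>A\<close>. It turns an identity on the syzygy into one on the free bimodule,
  where pure tensors are available for testing.\<close>

definition to_Syz :: "(('a \<times> 'a \<times> 'a) \<Rightarrow>\<^sub>0 'k) set \<Rightarrow> (('a \<times> 'a \<times> 'a) \<Rightarrow>\<^sub>0 'k) set" where
  "to_Syz C = C \<ominus>\<^bsub>FB\<^esub> tens \<one> \<one> (pres C)"

lemma pres_closed: "C \<in> carrier FB \<Longrightarrow> pres C \<in> carrier A"
  by (rule klin_closed[OF klin_pres])

lemma klin_to_Syz: "to_Syz \<in> module_hom class_ring FB Syz"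
proof (rule klin_into_Syz)
  have "(\<lambda>C. C \<ominus>\<^bsub>FB\<^esub> tens \<one> \<one> (pres C)) \<in> module_hom class_ring FB FB"
    using klin_compose[OF klin_pres balanced_linear(2)[OF balanced_tens, of \<one> \<one>]]
    by (intro klin_diff FB.kspace_axioms klin_ident) auto
  then show "to_Syz \<in> module_hom class_ring FB FB"
    by (simp add: to_Syz_def[abs_def])
  show "to_Syz C \<in> carrier Syz" if "C \<in> carrier FB" for C
    using that klin_id ident_funcset pres_closed[OF that]
    by (simp add: to_Syz_def carrier_Syz twist_minus twist_tens)
qed

lemma to_Syz_Syz: "C \<in> carrier Syz \<Longrightarrow> to_Syz C = C"
  using klin_zero[OF kspace_axioms FB.kspace_axioms balanced_linear(2)[OF balanced_tens, of \<one> \<one>]]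
  by (simp add: to_Syz_def carrier_Syz)

text \<open>Inserting the tensor \<open>(a \<otimes> m) \<otimes> [1] \<otimes> b\<close> splits the
  difference into two. So the syzygy is generated as a bimodule by the elements
  \<open>swap m\<close> and \<open>univ a\<close>.\<close>

lemma to_Syz_tens:
  assumes "a \<in> carrier A" "m \<in> carrier A" "b \<in> carrier A"
  shows "to_Syz (tens a m b) = lact FB a (ract FB (swap m) b) \<oplus>\<^bsub>FB\<^esub> ract FB (univ (a \<otimes> m)) b"
proof -
  have "ract FB (swap m) b = tens \<one> m b \<ominus>\<^bsub>FB\<^esub> tens m \<one> b"
    unfolding swap_def using assms
    by (simp add: klin_minus[OF FB.kspace_axioms FB.kspace_axioms klin_ract] ract_tens)
  then have "lact FB a (ract FB (swap m) b) = tens a m b \<ominus>\<^bsub>FB\<^esub> tens (a \<otimes> m) \<one> b"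
    using assms by (simp add: klin_minus[OF FB.kspace_axioms FB.kspace_axioms klin_lact] lact_tens)
  moreover have "ract FB (univ (a \<otimes> m)) b = tens (a \<otimes> m) \<one> b \<ominus>\<^bsub>FB\<^esub> tens \<one> \<one> (a \<otimes> m \<otimes> b)"
    unfolding univ_def using assms
    by (simp add: klin_minus[OF FB.kspace_axioms FB.kspace_axioms klin_ract] ract_tens)
  ultimately show ?thesis
    unfolding to_Syz_def using assms klin_id ident_funcset by (simp add: FB.diff_add_diff twist_tens)
qed

text \<open>
  A bimodule map \<open>g\<close> on the syzygy restricts to a derivation \<open>\<delta> a = g (a \<otimes> 1 \<otimes> 1 - 1 \<otimes> 1 \<otimes> a)\<close>, and
  \<open>g\<close> minus the map of \<open>\<delta>\<close> extends to the free bimodule.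
\<close>

lemma HH1_dclass:
  assumes "X \<in> carrier (HH1 A)"
  obtains D where "derivation D" "X = dclass D"
proof -
  obtain g where g: "g \<in> carrier (BH Syz)" and X: "X = Bnd +>\<^bsub>BH Syz\<^esub> g"
    using assms unfolding HH1_eq by (rule Q.quotE)
  have lin: "g \<in> module_hom class_ring Syz A" and ext: "g \<in> extensional (carrier Syz)"
    and l: "\<And>a C. a \<in> carrier A \<Longrightarrow> C \<in> carrier Syz \<Longrightarrow> g (lact FB a C) = a \<otimes> g C"
    and r: "\<And>a C. a \<in> carrier A \<Longrightarrow> C \<in> carrier Syz \<Longrightarrow> g (ract FB C a) = g C \<otimes> a"
    using g by (auto simp: carrier_BH Syz_simps)
  have add: "g (C \<oplus>\<^bsub>FB\<^esub> C') = g C \<oplus> g C'" if "C \<in> carrier Syz" "C' \<in> carrier Syz" for C C'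
    using klin_add[OF lin that] by (simp add: Syz_simps)
  note cl = klin_closed[OF lin]
  define D where "D a = g (univ a)" for a
  have D: "derivation D"
    unfolding derivation_def
  proof (intro conjI ballI)
    show "D \<in> module_hom class_ring A A"
      unfolding D_def[abs_def]
      by (rule klin_compose[OF klin_into_Syz[OF klin_univ univ_closed] lin])
    show "D (a \<otimes> b) = D a \<otimes> b \<oplus> a \<otimes> D b" if "a \<in> carrier A" "b \<in> carrier A" for a b
      using that cl[OF univ_closed]
      by (simp add: D_def univ_mult add Syz_lact_closed Syz_ract_closed univ_closed l r a_comm)
  qed
  note Dcl = derivation_closed[OF D] and Dlin = derivation_linear[OF D]
  \<comment> \<open>By \<open>to_Syz_tens\<close> the value at
    \<open>a \<otimes> [m] \<otimes> b\<close> is \<open>a \<otimes> g (swap m) \<otimes> b \<oplus>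
    D (a \<otimes> m) \<otimes> b\<close>. By the Leibniz rule this equals
    \<open>D a \<otimes> m \<otimes> b\<close> plus a term
    \<open>a \<otimes> h m \<otimes> b\<close> with this \<open>h\<close>.\<close>
  define h where "h m = g (swap m) \<oplus> D m" for m
  have h: "h \<in> carrier A \<rightarrow> carrier A"
    using cl[OF swap_closed] Dcl by (auto simp: h_def)
  have eq: "g (to_Syz C) = twist D (\<lambda>m. m) C \<oplus> twist (\<lambda>a. a) h C" if "C \<in> carrier FB" for C
  proof (rule klin_FB_eqI[OF kspace_axioms klin_compose[OF klin_to_Syz lin]
        klin_plus[OF FB.kspace_axioms kspace_axioms klin_twist[OF Dlin ident_funcset]
          klin_twist[OF klin_id h]] _ that])
    fix a m b assume abm: "a \<in> carrier A" "m \<in> carrier A" "b \<in> carrier A"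
    have "g (to_Syz (tens a m b)) = a \<otimes> (g (swap m) \<otimes> b) \<oplus> D (a \<otimes> m) \<otimes> b"
      using abm by (simp add: to_Syz_tens add Syz_lact_closed Syz_ract_closed univ_closed swap_closed l r D_def)
    also have "\<dots> = D a \<otimes> m \<otimes> b \<oplus> a \<otimes> h m \<otimes> b"
      using abm cl[OF swap_closed] Dcl
      by (simp add: h_def derivation_mult[OF D] l_distr r_distr m_assoc a_ac)
    also have "\<dots> = twist D (\<lambda>m. m) (tens a m b) \<oplus> twist (\<lambda>a. a) h (tens a m b)"
      using abm h Dlin klin_id ident_funcset by (simp add: twist_tens)
    finally show "g (to_Syz (tens a m b)) = twist D (\<lambda>m. m) (tens a m b) \<oplus> twist (\<lambda>a. a) h (tens a m b)" .
  qed
  have f: "restrict (twist (\<lambda>a. a) h) (carrier FB) \<in> carrier (BH FB)"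
    using klin_cong[OF FB.kspace_axioms klin_twist[OF klin_id h]] h
      klin_closed[OF klin_lact] klin_closed[OF klin_ract]
    by (auto simp: carrier_BH twist_lact twist_ract klin_id)
  have B: "restrict (restrict (twist (\<lambda>a. a) h) (carrier FB)) (carrier Syz) \<in> Bnd"
    unfolding Bnd_def using f by blast
  have "g = dmap D \<oplus>\<^bsub>BH Syz\<^esub> restrict (restrict (twist (\<lambda>a. a) h) (carrier FB)) (carrier Syz)"
  proof (rule extensionalityI[OF ext])
    fix C assume C: "C \<in> carrier Syz"
    then show "g C = (dmap D \<oplus>\<^bsub>BH Syz\<^esub> restrict (restrict (twist (\<lambda>a. a) h) (carrier FB)) (carrier Syz)) C"
      using eq[OF Syz_subset[OF C]] by (simp add: to_Syz_Syz BH_simps dmap_def Syz_subset)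
  qed (simp add: BH_simps)
  then have "g \<ominus>\<^bsub>BH Syz\<^esub> dmap D \<in> Bnd"
    using B Q.a_subset BS.add_diff_cancel_left[OF dmap_closed[OF D]] by auto
  then have "X = dclass D"
    unfolding X dclass_def using Q.coset_eq_iff[OF g dmap_closed[OF D]] by simp
  with D show ?thesis by (rule that)
qed

end


section \<open>The trivial extension\<close>

lemma dual_bimodule_simps [simp]:
  "carrier (dual_bimodule A) = carrier (hom_space A ground_space)"
  "\<zero>\<^bsub>dual_bimodule A\<^esub> = (\<lambda>x\<in>carrier A. 0)"
  "f \<oplus>\<^bsub>dual_bimodule A\<^esub> g = (\<lambda>x\<in>carrier A. f x + g x)"
  "c \<odot>\<^bsub>dual_bimodule A\<^esub> f = (\<lambda>x\<in>carrier A. c * f x)"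
  "lact (dual_bimodule A) a f = (\<lambda>x\<in>carrier A. f (x \<otimes>\<^bsub>A\<^esub> a))"
  "ract (dual_bimodule A) f a = (\<lambda>x\<in>carrier A. f (a \<otimes>\<^bsub>A\<^esub> x))"
  by (simp_all add: dual_bimodule_def module.defs bimodule.defs)

context kalgebra
begin

abbreviation Dual :: "('a \<Rightarrow> 'k) set" where
  "Dual \<equiv> module_hom class_ring A ground_space \<inter> extensional (carrier A)"

abbreviation TE :: "('k, 'a \<times> ('a \<Rightarrow> 'k)) module" where
  "TE \<equiv> trivial_extension A"

lemma TE_simps:
  "carrier TE = carrier A \<times> Dual"
  "\<zero>\<^bsub>TE\<^esub> = (\<zero>, \<lambda>x\<in>carrier A. 0)"
  "\<one>\<^bsub>TE\<^esub> = (\<one>, \<lambda>x\<in>carrier A. 0)"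
  "(a, f) \<oplus>\<^bsub>TE\<^esub> (b, g) = (a \<oplus> b, \<lambda>x\<in>carrier A. f x + g x)"
  "c \<odot>\<^bsub>TE\<^esub> (a, f) = (c \<odot> a, \<lambda>x\<in>carrier A. c * f x)"
  by (simp_all add: trivial_extension_def Let_def)

lemma Dual_add: "f \<in> Dual \<Longrightarrow> x \<in> carrier A \<Longrightarrow> y \<in> carrier A \<Longrightarrow> f (x \<oplus> y) = f x + f y"
  using klin_add[of f A ground_space x y] by simp

lemma Dual_scale: "f \<in> Dual \<Longrightarrow> x \<in> carrier A \<Longrightarrow> f (c \<odot> x) = c * f x"
  using klin_scale[of f A ground_space x c] by simp

lemma Dual_zero: "f \<in> Dual \<Longrightarrow> f \<zero> = 0"
  using klin_zero[OF kspace_axioms kspace_ground, of f] by simp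

lemma Dual_ext: "f \<in> Dual \<Longrightarrow> g \<in> Dual \<Longrightarrow> (\<And>x. x \<in> carrier A \<Longrightarrow> f x = g x) \<Longrightarrow> f = g"
  by (rule extensionalityI[of f "carrier A"]) auto

lemma DualI:
  assumes "\<And>x y. x \<in> carrier A \<Longrightarrow> y \<in> carrier A \<Longrightarrow> f (x \<oplus> y) = f x + f y"
    and "\<And>c x. x \<in> carrier A \<Longrightarrow> f (c \<odot> x) = c * f x"
  shows "(\<lambda>x\<in>carrier A. f x) \<in> Dual"
  using assms by (auto intro!: klinI)

lemma Dual_zero_fun: "(\<lambda>x\<in>carrier A. 0) \<in> Dual"
  by (rule DualI) auto

lemma Dual_plus: "f \<in> Dual \<Longrightarrow> g \<in> Dual \<Longrightarrow> (\<lambda>x\<in>carrier A. f x + g x) \<in> Dual"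
  by (rule DualI) (simp_all add: Dual_add Dual_scale algebra_simps del: Int_iff)

lemma Dual_smult: "f \<in> Dual \<Longrightarrow> (\<lambda>x\<in>carrier A. c * f x) \<in> Dual"
  by (rule DualI) (simp_all add: Dual_add Dual_scale algebra_simps del: Int_iff)

lemma Dual_compose:
  assumes f: "f \<in> Dual" and g: "g \<in> module_hom class_ring A A"
  shows "(\<lambda>x\<in>carrier A. f (g x)) \<in> Dual"
  by (rule DualI)
    (simp_all add: klin_add[OF g] klin_scale[OF g] klin_closed[OF g] Dual_add[OF f] Dual_scale[OF f])

lemma Dual_mult: "f \<in> Dual \<Longrightarrow> g \<in> Dual \<Longrightarrow> a \<in> carrier A \<Longrightarrow> b \<in> carrier A
    \<Longrightarrow> (\<lambda>x\<in>carrier A. g (x \<otimes> a) + f (b \<otimes> x)) \<in> Dual"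
  by (rule DualI)
    (simp_all add: l_distr r_distr scale_mult_left scale_mult_right Dual_add Dual_scale algebra_simps
      del: Int_iff)

lemma TE_mult:
  assumes "a \<in> carrier A" "b \<in> carrier A" "f \<in> Dual" "g \<in> Dual"
  shows "(a, f) \<otimes>\<^bsub>TE\<^esub> (b, g) = (a \<otimes> b, \<lambda>x\<in>carrier A. g (x \<otimes> a) + f (b \<otimes> x))"
  using assms by (auto simp: trivial_extension_def Let_def intro!: restrict_ext)

lemma TE_E:
  assumes "y \<in> carrier TE"
  obtains a f where "a \<in> carrier A" "f \<in> Dual" "y = (a, f)"
  using assms by (auto simp: TE_simps)

lemma kspace_TE: "kspace TE"
proof (rule kspaceI)
  have ext: "(\<lambda>x\<in>carrier A. f x + 0) = f" "(\<lambda>x\<in>carrier A. f x) = f" if "f \<in> Dual" for f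
    using that by (auto intro!: extensionalityI[of _ "carrier A"])
  show "x \<oplus>\<^bsub>TE\<^esub> \<zero>\<^bsub>TE\<^esub> = x" "1 \<odot>\<^bsub>TE\<^esub> x = x" if x: "x \<in> carrier TE" for x
    using x by (rule TE_E, simp add: TE_simps scale_one ext del: Int_iff cong: restrict_cong)+
  show "0 \<odot>\<^bsub>TE\<^esub> x = \<zero>\<^bsub>TE\<^esub>" if x: "x \<in> carrier TE" for x
    using x by (rule TE_E) (simp add: TE_simps scale_zero_left)
  show "\<zero>\<^bsub>TE\<^esub> \<in> carrier TE"
    using Dual_zero_fun by (simp add: TE_simps del: Int_iff)
  show "x \<oplus>\<^bsub>TE\<^esub> y \<in> carrier TE" if x: "x \<in> carrier TE" and y: "y \<in> carrier TE" for x y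
    by (rule TE_E[OF x], rule TE_E[OF y]) (simp add: TE_simps Dual_plus del: Int_iff)
  show "c \<odot>\<^bsub>TE\<^esub> x \<in> carrier TE" if x: "x \<in> carrier TE" for c x
    by (rule TE_E[OF x]) (simp add: TE_simps Dual_smult del: Int_iff)
  show "x \<oplus>\<^bsub>TE\<^esub> y = y \<oplus>\<^bsub>TE\<^esub> x" if x: "x \<in> carrier TE" and y: "y \<in> carrier TE" for x y
    by (rule TE_E[OF x], rule TE_E[OF y]) (simp add: TE_simps a_ac add.commute del: Int_iff)
  show "x \<oplus>\<^bsub>TE\<^esub> y \<oplus>\<^bsub>TE\<^esub> z = x \<oplus>\<^bsub>TE\<^esub> (y \<oplus>\<^bsub>TE\<^esub> z)"
    if x: "x \<in> carrier TE" and y: "y \<in> carrier TE" and z: "z \<in> carrier TE" for x y z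
    by (rule TE_E[OF x], rule TE_E[OF y], rule TE_E[OF z])
      (simp add: TE_simps a_assoc add.assoc del: Int_iff cong: restrict_cong)
  show "(c * d) \<odot>\<^bsub>TE\<^esub> x = c \<odot>\<^bsub>TE\<^esub> (d \<odot>\<^bsub>TE\<^esub> x)" if x: "x \<in> carrier TE" for c d x
    by (rule TE_E[OF x]) (simp add: TE_simps scale_scale mult.assoc del: Int_iff cong: restrict_cong)
  show "(c + d) \<odot>\<^bsub>TE\<^esub> x = c \<odot>\<^bsub>TE\<^esub> x \<oplus>\<^bsub>TE\<^esub> d \<odot>\<^bsub>TE\<^esub> x" if x: "x \<in> carrier TE" for c d x
    by (rule TE_E[OF x]) (simp add: TE_simps scale_left_distrib distrib_right del: Int_iff cong: restrict_cong)
  show "c \<odot>\<^bsub>TE\<^esub> (x \<oplus>\<^bsub>TE\<^esub> y) = c \<odot>\<^bsub>TE\<^esub> x \<oplus>\<^bsub>TE\<^esub> c \<odot>\<^bsub>TE\<^esub> y"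
    if x: "x \<in> carrier TE" and y: "y \<in> carrier TE" for c x y
    by (rule TE_E[OF x], rule TE_E[OF y])
      (simp add: TE_simps scale_right_distrib distrib_left del: Int_iff cong: restrict_cong)
qed

lemma kalgebra_TE: "kalgebra TE"
proof -
  interpret T: kspace TE by (rule kspace_TE)
  note del = Int_iff
  have one: "\<one>\<^bsub>TE\<^esub> \<in> carrier TE"
    using Dual_zero_fun by (simp add: TE_simps del: Int_iff)
  have cl: "x \<otimes>\<^bsub>TE\<^esub> y \<in> carrier TE" if x: "x \<in> carrier TE" and y: "y \<in> carrier TE" for x y
    by (rule TE_E[OF x], rule TE_E[OF y]) (simp add: TE_mult TE_simps(1) Dual_mult del: Int_iff)
  have ext: "(\<lambda>x\<in>carrier A. f x) = f" if "f \<in> Dual" for f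
    using that by (auto intro!: extensionalityI[of _ "carrier A"])
  have "ring TE"
  proof (rule ringI)
    show "abelian_group TE"
      by (rule T.abelian_group_axioms)
    show "Group.monoid TE"
    proof (rule monoidI)
      show "x \<otimes>\<^bsub>TE\<^esub> y \<otimes>\<^bsub>TE\<^esub> z = x \<otimes>\<^bsub>TE\<^esub> (y \<otimes>\<^bsub>TE\<^esub> z)"
        if x: "x \<in> carrier TE" and y: "y \<in> carrier TE" and z: "z \<in> carrier TE" for x y z
        by (rule TE_E[OF x], rule TE_E[OF y], rule TE_E[OF z])
          (simp add: TE_mult Dual_mult m_assoc add.assoc del: Int_iff cong: restrict_cong)
      show "\<one>\<^bsub>TE\<^esub> \<otimes>\<^bsub>TE\<^esub> x = x" if x: "x \<in> carrier TE" for x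
        by (rule TE_E[OF x])
          (simp add: TE_mult TE_simps(3) Dual_zero_fun ext del: Int_iff cong: restrict_cong)
      show "x \<otimes>\<^bsub>TE\<^esub> \<one>\<^bsub>TE\<^esub> = x" if x: "x \<in> carrier TE" for x
        by (rule TE_E[OF x])
          (simp add: TE_mult TE_simps(3) Dual_zero_fun ext del: Int_iff cong: restrict_cong)
    qed (use one cl in auto)
    show "(x \<oplus>\<^bsub>TE\<^esub> y) \<otimes>\<^bsub>TE\<^esub> z = x \<otimes>\<^bsub>TE\<^esub> z \<oplus>\<^bsub>TE\<^esub> y \<otimes>\<^bsub>TE\<^esub> z"
      if x: "x \<in> carrier TE" and y: "y \<in> carrier TE" and z: "z \<in> carrier TE" for x y z
      by (rule TE_E[OF x], rule TE_E[OF y], rule TE_E[OF z])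
        (simp add: TE_mult TE_simps(4) Dual_mult Dual_plus Dual_add l_distr r_distr algebra_simps
          del: Int_iff cong: restrict_cong)
    show "z \<otimes>\<^bsub>TE\<^esub> (x \<oplus>\<^bsub>TE\<^esub> y) = z \<otimes>\<^bsub>TE\<^esub> x \<oplus>\<^bsub>TE\<^esub> z \<otimes>\<^bsub>TE\<^esub> y"
      if x: "x \<in> carrier TE" and y: "y \<in> carrier TE" and z: "z \<in> carrier TE" for x y z
      by (rule TE_E[OF x], rule TE_E[OF y], rule TE_E[OF z])
        (simp add: TE_mult TE_simps(4) Dual_mult Dual_plus Dual_add l_distr r_distr algebra_simps
          del: Int_iff cong: restrict_cong)
  qed
  moreover have "kalgebra_axioms TE"
  proof
    fix x y c assume x: "x \<in> carrier TE" and y: "y \<in> carrier TE"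
    show "c \<odot>\<^bsub>TE\<^esub> x \<otimes>\<^bsub>TE\<^esub> y = c \<odot>\<^bsub>TE\<^esub> (x \<otimes>\<^bsub>TE\<^esub> y)"
      by (rule TE_E[OF x], rule TE_E[OF y])
        (simp add: TE_mult TE_simps(5) Dual_mult Dual_smult Dual_scale scale_mult_left scale_mult_right
          algebra_simps del: Int_iff cong: restrict_cong)
    show "x \<otimes>\<^bsub>TE\<^esub> (c \<odot>\<^bsub>TE\<^esub> y) = c \<odot>\<^bsub>TE\<^esub> (x \<otimes>\<^bsub>TE\<^esub> y)"
      by (rule TE_E[OF x], rule TE_E[OF y])
        (simp add: TE_mult TE_simps(5) Dual_mult Dual_smult Dual_scale scale_mult_left scale_mult_right
          algebra_simps del: Int_iff cong: restrict_cong)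
  qed
  ultimately show ?thesis
    by (intro kalgebra.intro kspace_TE)
qed

interpretation T: kalgebra TE
  by (rule kalgebra_TE)

lemma TE_minus:
  assumes "a \<in> carrier A" "b \<in> carrier A" "f \<in> Dual" "g \<in> Dual"
  shows "(a, f) \<ominus>\<^bsub>TE\<^esub> (b, g) = (a \<ominus> b, \<lambda>x\<in>carrier A. f x - g x)"
proof -
  have "\<ominus>\<^bsub>TE\<^esub> (b, g) = (- 1) \<odot>\<^bsub>TE\<^esub> (b, g)"
    using assms by (intro T.minus_one_scale[symmetric]) (auto simp: TE_simps)
  also have "\<dots> = (\<ominus> b, \<lambda>x\<in>carrier A. - g x)"
    using assms by (simp add: TE_simps minus_one_scale)
  finally show ?thesis
    using assms by (simp add: a_minus_def TE_simps cong: restrict_cong)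
qed

lemma TE_minus_components:
  assumes u: "u \<in> carrier TE" and v: "v \<in> carrier TE"
  shows "fst (u \<ominus>\<^bsub>TE\<^esub> v) = fst u \<ominus> fst v"
    and "x \<in> carrier A \<Longrightarrow> snd (u \<ominus>\<^bsub>TE\<^esub> v) x = snd u x - snd v x"
  by (rule TE_E[OF u], rule TE_E[OF v], simp add: TE_minus del: Int_iff)+

section \<open>Two families of derivations of the trivial extension\<close>

definition central_shift :: "'a \<Rightarrow> 'a \<times> ('a \<Rightarrow> 'k) \<Rightarrow> 'a \<times> ('a \<Rightarrow> 'k)" where
  "central_shift z = (\<lambda>(a, f). (\<zero>, \<lambda>x\<in>carrier A. f (x \<otimes> z)))"

text \<open>The minus sign is that of the contragredient action on the dual: in
  \<open>f (x \<otimes> D a) - f (D (x \<otimes> a))\<close> the term with \<open>D a\<close>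
  cancels and \<open>- f (D x \<otimes> a)\<close> remains.\<close>

definition derivation_lift :: "('a \<Rightarrow> 'a) \<Rightarrow> 'a \<times> ('a \<Rightarrow> 'k) \<Rightarrow> 'a \<times> ('a \<Rightarrow> 'k)" where
  "derivation_lift D = (\<lambda>(a, f). (D a, \<lambda>x\<in>carrier A. - f (D x)))"

lemma center_iff: "z \<in> carrier (center A) \<longleftrightarrow> z \<in> carrier A \<and> (\<forall>b\<in>carrier A. z \<otimes> b = b \<otimes> z)"
  by (simp add: center_def)

lemma kspace_center: "kspace (center A)"
proof -
  have "submodule class_ring (carrier (center A)) A"
    by (rule subspaceI) (auto simp: center_iff l_distr r_distr scale_mult_left scale_mult_right)
  from kspace_subspace[OF this] show ?thesis
    by (simp add: center_def)
qed

text \<open>Multiplication by a central element is a bimodule endomorphism of \<open>DA\<close>, and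
  any such endomorphism, extended by zero on \<open>A\<close>, satisfies the Leibniz rule because
  \<open>DA\<close> has square zero.\<close>

lemma derivation_central_shift:
  assumes z: "z \<in> carrier (center A)"
  shows "T.derivation (central_shift z)"
proof -
  have zA: "z \<in> carrier A" and comm: "\<And>b. b \<in> carrier A \<Longrightarrow> z \<otimes> b = b \<otimes> z"
    using z by (auto simp: center_iff)
  note comp = Dual_compose[OF _ klin_rmult[OF zA]]
  show ?thesis
    unfolding T.derivation_def
  proof (intro conjI klinI ballI)
    fix x y c assume x: "x \<in> carrier TE"
    show "central_shift z x \<in> carrier TE"
      by (rule TE_E[OF x]) (simp add: central_shift_def TE_simps(1) comp del: Int_iff)
    show "central_shift z (c \<odot>\<^bsub>TE\<^esub> x) = c \<odot>\<^bsub>TE\<^esub> central_shift z x"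
      by (rule TE_E[OF x])
        (simp add: central_shift_def TE_simps zA scale_zero_right del: Int_iff cong: restrict_cong)
    assume y: "y \<in> carrier TE"
    show "central_shift z (x \<oplus>\<^bsub>TE\<^esub> y) = central_shift z x \<oplus>\<^bsub>TE\<^esub> central_shift z y"
      by (rule TE_E[OF x], rule TE_E[OF y])
        (simp add: central_shift_def TE_simps zA del: Int_iff cong: restrict_cong)
    show "central_shift z (x \<otimes>\<^bsub>TE\<^esub> y)
        = central_shift z x \<otimes>\<^bsub>TE\<^esub> y \<oplus>\<^bsub>TE\<^esub> x \<otimes>\<^bsub>TE\<^esub> central_shift z y"
      by (rule TE_E[OF x], rule TE_E[OF y])
        (simp add: central_shift_def TE_simps TE_mult comp zA m_assoc comm Dual_zero add.commute
          del: Int_iff cong: restrict_cong)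
  qed
qed

lemma derivation_derivation_lift:
  assumes D: "derivation D"
  shows "T.derivation (derivation_lift D)"
proof -
  note lin = derivation_linear[OF D] and cl = derivation_closed[OF D]
  have comp: "(\<lambda>x\<in>carrier A. - f (D x)) \<in> Dual" if "f \<in> Dual" for f
    by (rule DualI) (simp_all add: klin_add[OF lin] klin_scale[OF lin] cl Dual_add[OF that] Dual_scale[OF that])
  show ?thesis
    unfolding T.derivation_def
  proof (intro conjI klinI ballI)
    fix x y c assume x: "x \<in> carrier TE"
    show "derivation_lift D x \<in> carrier TE"
      by (rule TE_E[OF x]) (simp add: derivation_lift_def TE_simps(1) cl comp del: Int_iff)
    show "derivation_lift D (c \<odot>\<^bsub>TE\<^esub> x) = c \<odot>\<^bsub>TE\<^esub> derivation_lift D x"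
      by (rule TE_E[OF x])
        (simp add: derivation_lift_def TE_simps klin_scale[OF lin] cl del: Int_iff cong: restrict_cong)
    assume y: "y \<in> carrier TE"
    show "derivation_lift D (x \<oplus>\<^bsub>TE\<^esub> y) = derivation_lift D x \<oplus>\<^bsub>TE\<^esub> derivation_lift D y"
      by (rule TE_E[OF x], rule TE_E[OF y])
        (simp add: derivation_lift_def TE_simps klin_add[OF lin] cl del: Int_iff cong: restrict_cong)
    show "derivation_lift D (x \<otimes>\<^bsub>TE\<^esub> y)
        = derivation_lift D x \<otimes>\<^bsub>TE\<^esub> y \<oplus>\<^bsub>TE\<^esub> x \<otimes>\<^bsub>TE\<^esub> derivation_lift D y"
      by (rule TE_E[OF x], rule TE_E[OF y])
        (simp add: derivation_lift_def TE_simps TE_mult comp cl derivation_mult[OF D] Dual_add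
          del: Int_iff cong: restrict_cong)
  qed
qed

text \<open>The components recorded here, from \<open>A\<close> to \<open>A\<close> and from
  \<open>DA\<close> to \<open>DA\<close>, depend only on the part in \<open>A\<close> of the element
  that makes \<open>E\<close> inner.\<close>

lemma inner_TE:
  assumes "T.inner E"
  obtains y where "y \<in> carrier A"
    and "\<And>a. a \<in> carrier A \<Longrightarrow> fst (E (a, \<lambda>x\<in>carrier A. 0)) = a \<otimes> y \<ominus> y \<otimes> a"
    and "\<And>f x. f \<in> Dual \<Longrightarrow> x \<in> carrier A \<Longrightarrow> snd (E (\<zero>, f)) x = f (y \<otimes> x) - f (x \<otimes> y)"
proof -
  obtain u where uc: "u \<in> carrier TE" and E: "\<And>v. v \<in> carrier TE \<Longrightarrow> E v = v \<otimes>\<^bsub>TE\<^esub> u \<ominus>\<^bsub>TE\<^esub> u \<otimes>\<^bsub>TE\<^esub> v"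
    using assms by (auto simp: T.inner_def)
  obtain y h where y: "y \<in> carrier A" and h: "h \<in> Dual" and u: "u = (y, h)"
    using uc by (rule TE_E)
  show ?thesis
  proof (rule that[OF y])
    show "fst (E (a, \<lambda>x\<in>carrier A. 0)) = a \<otimes> y \<ominus> y \<otimes> a" if a: "a \<in> carrier A" for a
    proof -
      have v: "(a, \<lambda>x\<in>carrier A. 0) \<in> carrier TE"
        using a Dual_zero_fun by (simp add: TE_simps(1) del: Int_iff)
      show ?thesis
        using E[OF v] TE_minus_components(1)[OF T.m_closed[OF v uc] T.m_closed[OF uc v]] a y h
        by (simp add: u TE_mult Dual_zero_fun del: Int_iff)
    qed
    show "snd (E (\<zero>, f)) x = f (y \<otimes> x) - f (x \<otimes> y)" if f: "f \<in> Dual" and x: "x \<in> carrier A" for f x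
    proof -
      have v: "(\<zero>, f) \<in> carrier TE"
        using f by (simp add: TE_simps(1) del: Int_iff)
      show ?thesis
        using E[OF v] TE_minus_components(2)[OF T.m_closed[OF v uc] T.m_closed[OF uc v] x] f x y h
        by (simp add: u TE_mult Dual_zero del: Int_iff)
    qed
  qed
qed

section \<open>The center inside the cohomology of the trivial extension\<close>

definition shift_class where
  "shift_class z = T.dclass (central_shift z)"

lemma klin_shift_class: "shift_class \<in> module_hom class_ring (center A) (HH1 TE)"
proof (rule klinI)
  interpret Z: kspace "center A" by (rule kspace_center)
  have simps: "add (center A) = add A" "smult (center A) = smult A"
    by (simp_all add: center_def)
  fix z w c assume z: "z \<in> carrier (center A)"
  then have zA: "z \<in> carrier A" by (simp add: center_iff)
  note dz = derivation_central_shift[OF z]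
  show "shift_class z \<in> carrier (HH1 TE)"
    unfolding shift_class_def by (rule T.dclass_closed[OF dz])
  have "shift_class (c \<odot>\<^bsub>center A\<^esub> z) = T.dclass (\<lambda>v. c \<odot>\<^bsub>TE\<^esub> central_shift z v)"
    unfolding shift_class_def
  proof (rule T.dclass_cong)
    fix v assume v: "v \<in> carrier TE"
    show "central_shift (c \<odot>\<^bsub>center A\<^esub> z) v = c \<odot>\<^bsub>TE\<^esub> central_shift z v"
      by (rule TE_E[OF v]) (simp add: simps central_shift_def TE_simps zA scale_mult_right Dual_scale
          scale_zero_right del: Int_iff cong: restrict_cong)
  qed (use z dz in \<open>auto intro: derivation_central_shift T.derivation_scale\<close>)
  then show "shift_class (c \<odot>\<^bsub>center A\<^esub> z) = c \<odot>\<^bsub>HH1 TE\<^esub> shift_class z"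
    by (simp add: shift_class_def T.dclass_scale[OF dz])
  assume w: "w \<in> carrier (center A)"
  then have wA: "w \<in> carrier A" by (simp add: center_iff)
  note dw = derivation_central_shift[OF w]
  have "shift_class (z \<oplus>\<^bsub>center A\<^esub> w) = T.dclass (\<lambda>v. central_shift z v \<oplus>\<^bsub>TE\<^esub> central_shift w v)"
    unfolding shift_class_def
  proof (rule T.dclass_cong)
    fix v assume v: "v \<in> carrier TE"
    show "central_shift (z \<oplus>\<^bsub>center A\<^esub> w) v = central_shift z v \<oplus>\<^bsub>TE\<^esub> central_shift w v"
      by (rule TE_E[OF v]) (simp add: simps central_shift_def TE_simps zA wA r_distr Dual_add
          del: Int_iff cong: restrict_cong)
  qed (use z w dz dw in \<open>auto intro: derivation_central_shift T.derivation_add\<close>)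
  then show "shift_class (z \<oplus>\<^bsub>center A\<^esub> w) = shift_class z \<oplus>\<^bsub>HH1 TE\<^esub> shift_class w"
    by (simp add: shift_class_def T.dclass_add[OF dz dw])
qed

text \<open>Kept as a hypothesis until the coefficients of paths provide the functionals.\<close>

definition dual_separates :: bool where
  "dual_separates \<longleftrightarrow> (\<forall>a\<in>carrier A. (\<forall>f\<in>Dual. f a = 0) \<longrightarrow> a = \<zero>)"

text \<open>At the unit, an inner derivation gives \<open>f y - f y = 0\<close> on
  \<open>DA\<close>, while the shift by \<open>z\<close> gives \<open>f z\<close>. As the
  functionals separate points, \<open>z\<close> vanishes.\<close>

lemma shift_class_eq_zero:
  assumes sep: "dual_separates"
    and z: "z \<in> carrier (center A)" and zero: "shift_class z = \<zero>\<^bsub>HH1 TE\<^esub>"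
  shows "z = \<zero>"
proof -
  have zA: "z \<in> carrier A" using z by (simp add: center_iff)
  have "T.inner (central_shift z)"
    using zero T.dclass_eq_zero_iff[OF derivation_central_shift[OF z]] by (simp add: shift_class_def)
  then obtain y where y: "y \<in> carrier A"
    and f: "\<And>f x. f \<in> Dual \<Longrightarrow> x \<in> carrier A \<Longrightarrow> snd (central_shift z (\<zero>, f)) x = f (y \<otimes> x) - f (x \<otimes> y)"
    by (rule inner_TE) blast
  have "f z = 0" if "f \<in> Dual" for f
    using f[OF that one_closed] zA y by (simp add: central_shift_def)
  then show ?thesis
    using sep zA unfolding dual_separates_def by (metis (no_types, lifting))
qed

lemma zero_center: "\<zero>\<^bsub>center A\<^esub> = \<zero>"
  by (simp add: center_def)

lemma inj_shift_class:
  assumes sep: "dual_separates"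
  shows "inj_on shift_class (carrier (center A))"
proof (rule inj_onI)
  interpret Z: kspace "center A" by (rule kspace_center)
  interpret H: kspace "HH1 TE" by (rule T.kspace_HH1)
  fix z w assume zw: "z \<in> carrier (center A)" "w \<in> carrier (center A)" "shift_class z = shift_class w"
  have "shift_class (z \<ominus>\<^bsub>center A\<^esub> w) = \<zero>\<^bsub>HH1 TE\<^esub>"
    using zw klin_closed[OF klin_shift_class]
    by (simp add: klin_minus[OF kspace_center T.kspace_HH1 klin_shift_class])
  then have "z \<ominus>\<^bsub>center A\<^esub> w = \<zero>\<^bsub>center A\<^esub>"
    using shift_class_eq_zero[OF sep Z.minus_closed[OF zw(1,2)]] by (simp add: zero_center)
  then show "z = w"
    using zw by simp
qed

lemma HH1_trivial_iff: "carrier (HH1 A) = {\<zero>\<^bsub>HH1 A\<^esub>} \<longleftrightarrow> (\<forall>D. derivation D \<longrightarrow> inner D)"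
proof -
  interpret H: kspace "HH1 A" by (rule kspace_HH1)
  show ?thesis
    using dclass_closed dclass_eq_zero_iff by (auto elim!: HH1_dclass)
qed

text \<open>Subtracting the shift in the class of the lifted derivation leaves an inner derivation.
  The shift is zero on the copy of \<open>A\<close>, so the component there shows that
  \<open>D\<close> itself is inner.\<close>

lemma HH1_trivial_if_shift_class_surj:
  assumes surj: "carrier (HH1 TE) \<subseteq> shift_class ` carrier (center A)"
  shows "carrier (HH1 A) = {\<zero>\<^bsub>HH1 A\<^esub>}"
  unfolding HH1_trivial_iff
proof (intro allI impI)
  interpret H: kspace "HH1 TE" by (rule T.kspace_HH1)
  fix D assume D: "derivation D"
  note dD = derivation_derivation_lift[OF D]
  obtain z where z: "z \<in> carrier (center A)" and eq: "T.dclass (derivation_lift D) = shift_class z"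
    using surj T.dclass_closed[OF dD] by blast
  then have zA: "z \<in> carrier A" by (simp add: center_iff)
  note dz = derivation_central_shift[OF z]
  let ?E = "\<lambda>v. derivation_lift D v \<oplus>\<^bsub>TE\<^esub> (- 1) \<odot>\<^bsub>TE\<^esub> central_shift z v"
  have dE: "T.derivation ?E"
    by (intro T.derivation_add T.derivation_scale dD dz)
  have "T.dclass ?E = shift_class z \<oplus>\<^bsub>HH1 TE\<^esub> (- 1) \<odot>\<^bsub>HH1 TE\<^esub> shift_class z"
    using T.dclass_add[OF dD T.derivation_scale[OF dz, of "- 1"]] T.dclass_scale[OF dz, of "- 1"] eq
    by (simp add: shift_class_def)
  then have "T.dclass ?E = \<zero>\<^bsub>HH1 TE\<^esub>"
    using klin_closed[OF klin_shift_class z] by (simp add: H.minus_one_scale H.r_neg)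
  then have "T.inner ?E"
    using T.dclass_eq_zero_iff[OF dE] by simp
  then obtain y where y: "y \<in> carrier A"
    and inn: "\<And>a. a \<in> carrier A \<Longrightarrow> fst (?E (a, \<lambda>x\<in>carrier A. 0)) = a \<otimes> y \<ominus> y \<otimes> a"
    by (rule inner_TE) blast
  show "inner D"
    using inn derivation_closed[OF D]
    by (intro innerI[OF y]) (simp add: derivation_lift_def central_shift_def TE_simps scale_zero_right)
qed

text \<open>The given isomorphism \<open>\<phi>\<close> need not be related to
  \<open>shift_class\<close>. Following \<open>shift_class\<close> by the inverse of
  \<open>\<phi>\<close> gives an injective endomorphism of the finite-dimensional center, which is
  therefore surjective.\<close>

theorem HH1_trivial_if_center_iso:
  assumes sep: "dual_separates"
    and fd: "fin_dim"
    and \<phi>: "\<phi> \<in> module_hom class_ring (center A) (HH1 TE)"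
    and bij: "bij_betw \<phi> (carrier (center A)) (carrier (HH1 TE))"
  shows "carrier (HH1 A) = {\<zero>\<^bsub>HH1 A\<^esub>}"
proof (rule HH1_trivial_if_shift_class_surj)
  interpret Z: kspace "center A" by (rule kspace_center)
  interpret H: kspace "HH1 TE" by (rule T.kspace_HH1)
  let ?Z = "carrier (center A)"
  have sub: "submodule class_ring ?Z A"
    by (rule subspaceI) (auto simp: center_iff l_distr r_distr scale_mult_left scale_mult_right)
  then have fdZ: "Z.fin_dim"
    using fin_dim_subspace[OF fd sub] by (simp add: center_def)
  define \<chi> where "\<chi> = inv_into ?Z \<phi>"
  have \<chi>: "\<chi> X \<in> ?Z" "\<phi> (\<chi> X) = X" if "X \<in> carrier (HH1 TE)" for X
    using that bij by (auto simp: \<chi>_def bij_betw_def f_inv_into_f intro: inv_into_into)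
  have \<chi>_eqI: "\<chi> X = z" if "z \<in> ?Z" "\<phi> z = X" for X z
    using that bij by (auto simp: \<chi>_def bij_betw_def)
  have lin: "\<chi> \<in> module_hom class_ring (HH1 TE) (center A)"
    by (rule klinI) (auto intro!: \<chi>_eqI simp: \<chi> klin_add[OF \<phi>] klin_scale[OF \<phi>])
  note endo = klin_compose[OF klin_shift_class lin]
  have cl: "shift_class z \<in> carrier (HH1 TE)" if "z \<in> ?Z" for z
    using klin_closed[OF klin_shift_class that] .
  have "inj_on (\<lambda>z. \<chi> (shift_class z)) ?Z"
    using inj_onD[OF inj_shift_class[OF sep]] cl \<chi>(2) by (intro inj_onI) metis
  then have surj: "(\<lambda>z. \<chi> (shift_class z)) ` ?Z = ?Z"
    by (rule Z.inj_endomorphism_surj[OF fdZ endo])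
  show "carrier (HH1 TE) \<subseteq> shift_class ` ?Z"
  proof
    fix X assume X: "X \<in> carrier (HH1 TE)"
    then obtain z where z: "z \<in> ?Z" "\<chi> X = \<chi> (shift_class z)"
      using surj \<chi>(1)[OF X] by (metis (no_types, lifting) imageE)
    then have "X = shift_class z"
      using \<chi>(2)[OF X] \<chi>(2)[OF cl[OF z(1)]] by metis
    with z(1) show "X \<in> shift_class ` ?Z" by blast
  qed
qed

theorem center_iso_if_dim_one:
  assumes sep: "dual_separates"
    and one: "\<one> \<noteq> \<zero>"
    and dim: "vectorspace.fin_dim class_ring (HH1 TE) \<and> vectorspace.dim class_ring (HH1 TE) = 1"
  shows "shift_class \<in> module_hom class_ring (center A) (HH1 TE)
    \<and> bij_betw shift_class (carrier (center A)) (carrier (HH1 TE))"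
proof (intro conjI klin_shift_class bij_betw_imageI inj_shift_class[OF sep])
  interpret Z: kspace "center A" by (rule kspace_center)
  interpret H: kspace "HH1 TE" by (rule T.kspace_HH1)
  obtain b where b: "b \<in> carrier (HH1 TE)" "b \<noteq> \<zero>\<^bsub>HH1 TE\<^esub>"
    and gen: "\<And>X. X \<in> carrier (HH1 TE) \<Longrightarrow> \<exists>c. X = c \<odot>\<^bsub>HH1 TE\<^esub> b"
    using dim H.dim_one_iff by blast
  have oneZ: "\<one> \<in> carrier (center A)"
    by (simp add: center_iff)
  have cl: "shift_class \<one> \<in> carrier (HH1 TE)"
    by (rule klin_closed[OF klin_shift_class oneZ])
  obtain c where c: "shift_class \<one> = c \<odot>\<^bsub>HH1 TE\<^esub> b"
    using gen[OF cl] by blast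
  \<comment> \<open>The class of the unit is not zero, so it spans the line and can replace
    \<open>b\<close>.\<close>
  have "c \<noteq> 0"
    using c b one shift_class_eq_zero[OF sep oneZ] H.scale_zero_left by force
  show "shift_class ` carrier (center A) = carrier (HH1 TE)"
  proof (intro equalityI subsetI)
    fix X assume "X \<in> carrier (HH1 TE)"
    then obtain d where d: "X = d \<odot>\<^bsub>HH1 TE\<^esub> b"
      using gen by blast
    have "X = (d / c) \<odot>\<^bsub>HH1 TE\<^esub> shift_class \<one>"
      using \<open>c \<noteq> 0\<close> b by (simp add: c d H.scale_scale)
    also have "\<dots> = shift_class ((d / c) \<odot>\<^bsub>center A\<^esub> \<one>)"
      by (rule klin_scale[OF klin_shift_class oneZ, symmetric])
    finally show "X \<in> shift_class ` carrier (center A)"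
      using oneZ by blast
  qed (use klin_closed[OF klin_shift_class] in auto)
qed

end


section \<open>Path algebras\<close>

text \<open>A quotient algebra shares its ring fields with the ring \<open>V Quot W\<close>, but is
  a different record.\<close>

lemma ring_cong:
  assumes "ring R" and eq: "carrier S = carrier R" "mult S = mult R" "one S = one R"
    "zero S = zero R" "add S = add R"
  shows "ring S"
proof -
  interpret ring R by fact
  show ?thesis
  proof (rule ringI)
    show "abelian_group S"
      by (rule abelian_groupI) (auto simp: eq a_ac intro: l_neg bexI[of _ "\<ominus>\<^bsub>R\<^esub> _"])
    show "Group.monoid S"
      by (rule monoidI) (auto simp: eq m_assoc)
  qed (auto simp: eq l_distr r_distr)
qed

context fin_digraph
begin

abbreviation PA :: "('k::field, ('a, 'b) qpath \<Rightarrow>\<^sub>0 'k) module" where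
  "PA \<equiv> path_algebra G"

abbreviation triv :: "'a \<Rightarrow> ('a, 'b) qpath" where
  "triv v \<equiv> (v, [], v)"

lemma PA_simps:
  "carrier PA = {w. Poly_Mapping.keys w \<subseteq> qpaths G}"
  "\<zero>\<^bsub>PA\<^esub> = 0"
  "w \<oplus>\<^bsub>PA\<^esub> w' = w + w'"
  "c \<odot>\<^bsub>PA\<^esub> w = Poly_Mapping.map ((*) c) w"
  "\<one>\<^bsub>PA\<^esub> = (\<Sum>v\<in>verts G. Poly_Mapping.single (triv v) 1)"
  by (simp_all add: path_algebra_def)

lemma triv_in_qpaths: "v \<in> verts G \<Longrightarrow> triv v \<in> qpaths G"
  by (simp add: qpaths_def awalk_Nil_iff)

lemma arc_in_qpaths: "e \<in> arcs G \<Longrightarrow> (tail G e, [e], head G e) \<in> qpaths G"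
  by (simp add: qpaths_def awalk_def)

lemma qsource_in_verts: "p \<in> qpaths G \<Longrightarrow> qsource p \<in> verts G"
  by (auto simp: qpaths_def dest: awalk_hd_in_verts)

lemma qtarget_in_verts: "p \<in> qpaths G \<Longrightarrow> qtarget p \<in> verts G"
  by (auto simp: qpaths_def dest: awalk_last_in_verts)

lemma qcomp_in_qpaths:
  "p \<in> qpaths G \<Longrightarrow> q \<in> qpaths G \<Longrightarrow> qtarget p = qsource q \<Longrightarrow> qcomp p q \<in> qpaths G"
  by (auto simp: qpaths_def)

lemma qsource_qcomp [simp]: "qsource (qcomp p q) = qsource p"
  and qtarget_qcomp [simp]: "qtarget (qcomp p q) = qtarget q"
  by (cases p; cases q; simp)+

lemma qcomp_assoc: "qcomp (qcomp p q) r = qcomp p (qcomp q r)"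
  by (cases p; cases q; cases r; simp)

lemma qcomp_triv_left [simp]: "qcomp (triv (qsource p)) p = p"
  and qcomp_triv_right [simp]: "qcomp p (triv (qtarget p)) = p"
  by (cases p; simp)+

abbreviation pmul :: "(('a, 'b) qpath \<Rightarrow>\<^sub>0 'k::field) \<Rightarrow> (('a, 'b) qpath \<Rightarrow>\<^sub>0 'k) \<Rightarrow> (('a, 'b) qpath \<Rightarrow>\<^sub>0 'k)" where
  "pmul \<equiv> mult PA"

lemma pmul_superset:
  assumes "finite K" "finite L" "Poly_Mapping.keys x \<subseteq> K" "Poly_Mapping.keys y \<subseteq> L"
  shows "pmul x y = (\<Sum>p\<in>K. \<Sum>q\<in>L. if qtarget p = qsource q
    then Poly_Mapping.single (qcomp p q) (Poly_Mapping.lookup x p * Poly_Mapping.lookup y q) else 0)"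
proof -
  have "pmul x y = (\<Sum>p\<in>Poly_Mapping.keys x. \<Sum>q\<in>Poly_Mapping.keys y. if qtarget p = qsource q
    then Poly_Mapping.single (qcomp p q) (Poly_Mapping.lookup x p * Poly_Mapping.lookup y q) else 0)"
    by (simp add: path_algebra_def)
  also have "\<dots> = (\<Sum>p\<in>Poly_Mapping.keys x. \<Sum>q\<in>L. if qtarget p = qsource q
    then Poly_Mapping.single (qcomp p q) (Poly_Mapping.lookup x p * Poly_Mapping.lookup y q) else 0)"
    using assms by (intro sum.cong refl sum.mono_neutral_left) (auto simp: in_keys_iff)
  also have "\<dots> = (\<Sum>p\<in>K. \<Sum>q\<in>L. if qtarget p = qsource q
    then Poly_Mapping.single (qcomp p q) (Poly_Mapping.lookup x p * Poly_Mapping.lookup y q) else 0)"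
    using assms by (intro sum.mono_neutral_left) (auto simp: in_keys_iff intro!: sum.neutral)
  finally show ?thesis .
qed

lemma pmul_single:
  "pmul (Poly_Mapping.single p c) (Poly_Mapping.single q d)
    = (if qtarget p = qsource q then Poly_Mapping.single (qcomp p q) (c * d) else 0)"
  by (subst pmul_superset[of "{p}" "{q}"]) auto

lemma pmul_add_left: "pmul (x + x') y = pmul x y + pmul x' y"
proof -
  let ?K = "Poly_Mapping.keys x \<union> Poly_Mapping.keys x'" and ?L = "Poly_Mapping.keys y"
  show ?thesis
    using keys_add[of x x']
    by (simp add: pmul_superset[of ?K ?L] lookup_add distrib_right single_add
        flip: sum.distrib if_distrib cong: if_cong)
      (intro sum.cong refl; simp)
qed

lemma pmul_add_right: "pmul x (y + y') = pmul x y + pmul x y'"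
proof -
  let ?K = "Poly_Mapping.keys x" and ?L = "Poly_Mapping.keys y \<union> Poly_Mapping.keys y'"
  show ?thesis
    using keys_add[of y y']
    by (simp add: pmul_superset[of ?K ?L] lookup_add distrib_left single_add
        flip: sum.distrib if_distrib cong: if_cong)
      (intro sum.cong refl; simp)
qed

lemma pmul_scale_left: "pmul (Poly_Mapping.map ((*) c) x) y = Poly_Mapping.map ((*) c) (pmul x y)"
  using keys_map_scale_subset[of c x]
  by (simp add: pmul_superset[of "Poly_Mapping.keys x" "Poly_Mapping.keys y"] mult.assoc map_scale_sum
      if_distrib[of "Poly_Mapping.map ((*) c)"] cong: if_cong)

lemma pmul_scale_right: "pmul x (Poly_Mapping.map ((*) c) y) = Poly_Mapping.map ((*) c) (pmul x y)"
  using keys_map_scale_subset[of c y]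
  by (simp add: pmul_superset[of "Poly_Mapping.keys x" "Poly_Mapping.keys y"] mult.left_commute map_scale_sum
      if_distrib[of "Poly_Mapping.map ((*) c)"] cong: if_cong)

lemma pmul_zero_left [simp]: "pmul 0 y = 0"
  and pmul_zero_right [simp]: "pmul x 0 = 0"
  by (simp_all add: path_algebra_def)

lemma pmul_sum_left: "pmul (sum f I) y = (\<Sum>i\<in>I. pmul (f i) y)"
  by (induction I rule: infinite_finite_induct) (simp_all add: pmul_add_left)

lemma pmul_sum_right: "pmul x (sum f I) = (\<Sum>i\<in>I. pmul x (f i))"
  by (induction I rule: infinite_finite_induct) (simp_all add: pmul_add_right)

text \<open>Serves both to show that the path algebra is closed under products and to show that the
  span of the vanishing paths is an ideal.\<close>

lemma pmul_keys:
  assumes x: "Poly_Mapping.keys x \<subseteq> X" and y: "Poly_Mapping.keys y \<subseteq> Y"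
    and comp: "\<And>p q. p \<in> X \<Longrightarrow> q \<in> Y \<Longrightarrow> qtarget p = qsource q \<Longrightarrow> qcomp p q \<in> W"
  shows "Poly_Mapping.keys (pmul x y) \<subseteq> W"
  using x
proof (induction x rule: free_space_induct)
  case (single p c)
  show ?case
    using y
  proof (induction y rule: free_space_induct)
    case (single q d)
    then show ?case
      using \<open>p \<in> X\<close> comp by (simp add: pmul_single)
  qed (simp_all add: pmul_add_right keys_add_subsetI)
qed (simp_all add: pmul_add_left keys_add_subsetI)

lemma pmul_assoc: "pmul (pmul x y) z = pmul x (pmul y z)"
proof -
  have "Poly_Mapping.keys x \<subseteq> UNIV" by simp
  then show ?thesis
  proof (induction x rule: free_space_induct)
    case (single p c)
    have "Poly_Mapping.keys y \<subseteq> UNIV" by simp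
    then show ?case
    proof (induction y rule: free_space_induct)
      case (single q d)
      have "Poly_Mapping.keys z \<subseteq> UNIV" by simp
      then show ?case
      proof (induction z rule: free_space_induct)
        case (single r e)
        then show ?case
          by (simp add: pmul_single qcomp_assoc mult.assoc)
      qed (simp_all add: pmul_add_right)
    qed (simp_all add: pmul_add_right pmul_add_left)
  qed (simp_all add: pmul_add_left)
qed

lemma pmul_one:
  assumes "Poly_Mapping.keys x \<subseteq> qpaths G"
  shows "pmul \<one>\<^bsub>PA\<^esub> x = x" "pmul x \<one>\<^bsub>PA\<^esub> = x"
proof -
  show "pmul \<one>\<^bsub>PA\<^esub> x = x"
    using assms
  proof (induction x rule: free_space_induct)
    case (single p c)
    have "pmul \<one>\<^bsub>PA\<^esub> (Poly_Mapping.single p c)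
        = (\<Sum>v\<in>verts G. if v = qsource p then Poly_Mapping.single p c else 0)"
      unfolding PA_simps pmul_sum_left
      by (intro sum.cong refl) (auto simp: pmul_single)
    then show ?case
      using single qsource_in_verts by (simp add: sum.delta)
  qed (simp_all add: pmul_add_right)
  show "pmul x \<one>\<^bsub>PA\<^esub> = x"
    using assms
  proof (induction x rule: free_space_induct)
    case (single p c)
    have "pmul (Poly_Mapping.single p c) \<one>\<^bsub>PA\<^esub>
        = (\<Sum>v\<in>verts G. if v = qtarget p then Poly_Mapping.single p c else 0)"
      unfolding PA_simps pmul_sum_right
      by (intro sum.cong refl) (auto simp: pmul_single)
    then show ?case
      using single qtarget_in_verts by (simp add: sum.delta)
  qed (simp_all add: pmul_add_left)
qed

lemma kalgebra_PA: "kalgebra (PA :: ('k::field, ('a, 'b) qpath \<Rightarrow>\<^sub>0 'k) module)"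
proof -
  let ?P = "PA :: ('k::field, ('a, 'b) qpath \<Rightarrow>\<^sub>0 'k) module"
  have ks: "kspace ?P"
    by (rule kspace_cong[OF kspace_free_space[of "qpaths G"]]) (simp_all add: path_algebra_def)
  then interpret kspace ?P .
  have one: "\<one>\<^bsub>?P\<^esub> \<in> carrier ?P"
    using triv_in_qpaths by (simp add: PA_simps) (rule order.trans[OF keys_sum], auto split: if_splits)
  have "ring ?P"
  proof (rule ringI)
    show "abelian_group ?P"
      by (rule abelian_group_axioms)
    show "Group.monoid ?P"
    proof (rule monoidI)
      show "pmul x y \<in> carrier ?P" if "x \<in> carrier ?P" "y \<in> carrier ?P" for x y
        using that qcomp_in_qpaths by (simp add: PA_simps pmul_keys[of _ "qpaths G" _ "qpaths G"])
    qed (use one in \<open>auto simp: pmul_assoc pmul_one PA_simps(1)\<close>)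
  qed (auto simp: PA_simps(3) pmul_add_left pmul_add_right)
  then show ?thesis
    by (intro kalgebra.intro ks kalgebra_axioms.intro) (simp_all add: PA_simps(4) pmul_scale_left pmul_scale_right)
qed

end


section \<open>Monomial algebras\<close>

text \<open>
  An algebra with the multiplication rule of a monomial algebra: \<open>P\<close> is the set of paths that are
  not zero in \<open>A\<close>, \<open>\<pi>\<close> sends a path to its class and \<open>coef p\<close> is the coefficient of \<open>p\<close>.
\<close>

locale path_basis = kalgebra A + Q: fin_digraph Q
  for A :: "('k::field, 'a, 'z) module_scheme" (structure)
    and Q :: "('v, 'e) pre_digraph" +
  fixes P :: "('v, 'e) qpath set"
    and \<pi> :: "('v, 'e) qpath \<Rightarrow> 'a"
    and coef :: "('v, 'e) qpath \<Rightarrow> 'a \<Rightarrow> 'k"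
  assumes P_qpaths: "P \<subseteq> qpaths Q"
    and path_closed: "p \<in> qpaths Q \<Longrightarrow> \<pi> p \<in> carrier A"
    and path_zero: "p \<in> qpaths Q \<Longrightarrow> p \<notin> P \<Longrightarrow> \<pi> p = \<zero>"
    and path_mult: "p \<in> qpaths Q \<Longrightarrow> q \<in> qpaths Q
      \<Longrightarrow> \<pi> p \<otimes> \<pi> q = (if qtarget p = qsource q then \<pi> (qcomp p q) else \<zero>)"
    and one_eq: "\<one> = (\<Oplus>v\<in>verts Q. \<pi> (v, [], v))"
    and coef_linear: "p \<in> P \<Longrightarrow> coef p \<in> module_hom class_ring A ground_space"
    and coef_path: "p \<in> P \<Longrightarrow> q \<in> P \<Longrightarrow> coef p (\<pi> q) = (if p = q then 1 else 0)"
    and coef_eqI: "a \<in> carrier A \<Longrightarrow> (\<And>p. p \<in> P \<Longrightarrow> coef p a = 0) \<Longrightarrow> a = \<zero>"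
    and triv_P: "v \<in> verts Q \<Longrightarrow> (v, [], v) \<in> P"
    and arc_P: "e \<in> arcs Q \<Longrightarrow> (tail Q e, [e], head Q e) \<in> P"
begin

lemma coef_sum:
  assumes "p \<in> P" "f \<in> I \<rightarrow> carrier A"
  shows "coef p (\<Oplus>i\<in>I. f i) = (\<Sum>i\<in>I. coef p (f i))"
  using klin_finsum[OF kspace_axioms kspace_ground coef_linear[OF assms(1)] assms(2)]
  by (simp add: finsum_ground_space)

text \<open>The coefficients are functionals dual to the classes of the paths in \<open>P\<close>,
  so these classes are distinct and linearly independent.\<close>

lemma finite_P:
  assumes "fin_dim"
  shows "finite P"
proof -
  have "\<not> lin_dep (\<pi> ` P)"
  proof
    assume "lin_dep (\<pi> ` P)"
    then obtain S a v where S: "finite S" "S \<subseteq> \<pi> ` P" "lincomb a S = \<zero>" "v \<in> S" "a v \<noteq> 0"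
      unfolding lin_dep_def by auto
    then obtain p where p: "p \<in> P" "v = \<pi> p" by blast
    have SA: "S \<subseteq> carrier A"
      using S(2) path_closed P_qpaths by blast
    have delta: "coef p u = (if u = v then 1 else 0)" if u: "u \<in> S" for u
    proof -
      obtain q where q: "q \<in> P" "u = \<pi> q" using u S(2) by blast
      then show ?thesis
        using coef_path[OF p(1) q(1)] coef_path[OF p(1) p(1)] p by (cases "p = q") auto
    qed
    have "coef p (lincomb a S) = (\<Sum>u\<in>S. coef p (a u \<odot> u))"
      unfolding lincomb_def using SA by (intro coef_sum[OF p(1)]) auto
    also have "\<dots> = (\<Sum>u\<in>S. if u = v then a u else 0)"
      using SA by (intro sum.cong refl) (auto simp: klin_scale[OF coef_linear[OF p(1)]] delta)
    also have "\<dots> = a v"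
      using S by simp
    finally show False
      using S klin_zero[OF kspace_axioms kspace_ground coef_linear[OF p(1)]] by simp
  qed
  then have "finite (\<pi> ` P)"
    by (rule fin_dim_li_fin[OF assms]) (use path_closed P_qpaths in auto)
  moreover have "inj_on \<pi> P"
  proof (rule inj_onI)
    fix p q assume "p \<in> P" "q \<in> P" "\<pi> p = \<pi> q"
    then show "p = q"
      using coef_path[of p p] coef_path[of p q] by (simp split: if_splits)
  qed
  ultimately show ?thesis
    by (rule finite_imageD)
qed

end

locale monomial_data = fin_digraph G for G :: "('a, 'b) pre_digraph" +
  fixes Z :: "('a, 'b) qpath set"
  assumes Z: "monomial_relations G Z"
begin

text \<open>The paths that vanish in the quotient: those that contain a relation.\<close>

definition bad :: "('a, 'b) qpath set" where
  "bad = {p \<in> qpaths G. \<exists>z\<in>Z. subpath G z p}"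

lemma Z_qpaths: "Z \<subseteq> qpaths G"
  using Z by (simp add: monomial_relations_def)

lemma badE:
  assumes "p \<in> bad"
  obtains r z s where "r \<in> qpaths G" "z \<in> Z" "s \<in> qpaths G" "qtarget r = qsource z"
    "qtarget z = qsource s" "p = qcomp (qcomp r z) s"
  using assms by (auto simp: bad_def subpath_def)

lemma badI:
  assumes "r \<in> qpaths G" "z \<in> Z" "s \<in> qpaths G" "qtarget r = qsource z" "qtarget z = qsource s"
  shows "qcomp (qcomp r z) s \<in> bad"
  using assms Z_qpaths by (auto simp: bad_def subpath_def intro!: qcomp_in_qpaths)

lemma Z_bad: "Z \<subseteq> bad"
proof
  fix z assume z: "z \<in> Z"
  then have "z \<in> qpaths G" using Z_qpaths by blast
  then show "z \<in> bad"
    using badI[of "triv (qsource z)" z "triv (qtarget z)"] z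
    by (simp add: triv_in_qpaths qsource_in_verts qtarget_in_verts)
qed

lemma bad_qcomp_left:
  assumes "p \<in> bad" "q \<in> qpaths G" "qtarget q = qsource p"
  shows "qcomp q p \<in> bad"
  using assms(1)
proof (rule badE)
  fix r z s assume h: "r \<in> qpaths G" "z \<in> Z" "s \<in> qpaths G" "qtarget r = qsource z"
    "qtarget z = qsource s" "p = qcomp (qcomp r z) s"
  then have "qcomp q p = qcomp (qcomp (qcomp q r) z) s"
    by (simp add: qcomp_assoc)
  then show ?thesis
    using badI[of "qcomp q r" z s] h assms by (simp add: qcomp_in_qpaths)
qed

lemma bad_qcomp_right:
  assumes "p \<in> bad" "q \<in> qpaths G" "qtarget p = qsource q"
  shows "qcomp p q \<in> bad"
  using assms(1)
proof (rule badE)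
  fix r z s assume h: "r \<in> qpaths G" "z \<in> Z" "s \<in> qpaths G" "qtarget r = qsource z"
    "qtarget z = qsource s" "p = qcomp (qcomp r z) s"
  then have "qcomp p q = qcomp (qcomp r z) (qcomp s q)"
    by (simp add: qcomp_assoc)
  then show ?thesis
    using badI[of r z "qcomp s q"] h assms by (simp add: qcomp_in_qpaths)
qed

text \<open>Hence vertices and arrows survive in the quotient.\<close>

lemma bad_length: "p \<in> bad \<Longrightarrow> 2 \<le> qlength p"
proof (erule badE)
  fix r z s assume "z \<in> Z" "p = qcomp (qcomp r z) s"
  then show "2 \<le> qlength p"
    using Z by (cases r; cases z; cases s) (fastforce simp: monomial_relations_def)
qed

definition rel_ideal :: "(('a, 'b) qpath \<Rightarrow>\<^sub>0 'k::field) set" where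
  "rel_ideal = Idl\<^bsub>PA\<^esub> ((\<lambda>p. Poly_Mapping.single p 1) ` Z)"

text \<open>The span of the bad paths is an ideal that contains the relations, so it contains the
  generated ideal. Conversely a bad path is a product \<open>r z s\<close> with a relation
  \<open>z\<close>.\<close>

lemma rel_ideal_eq: "(rel_ideal :: (('a, 'b) qpath \<Rightarrow>\<^sub>0 'k::field) set) = {w. Poly_Mapping.keys w \<subseteq> bad}"
  and ideal_rel_ideal: "ideal (rel_ideal :: (('a, 'b) qpath \<Rightarrow>\<^sub>0 'k::field) set) PA"
proof -
  interpret PA: kalgebra "PA :: ('k::field, ('a, 'b) qpath \<Rightarrow>\<^sub>0 'k) module"
    by (rule kalgebra_PA)
  let ?I = "{w :: ('a, 'b) qpath \<Rightarrow>\<^sub>0 'k. Poly_Mapping.keys w \<subseteq> bad}"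
  let ?S = "(\<lambda>p. Poly_Mapping.single p (1::'k)) ` Z"
  have bad_paths: "bad \<subseteq> qpaths G"
    by (auto simp: bad_def)
  have S: "?S \<subseteq> carrier PA"
    using Z_qpaths by (auto simp: PA_simps)
  have neg: "\<ominus>\<^bsub>PA\<^esub> x = - x" if "x \<in> carrier PA" for x :: "('a, 'b) qpath \<Rightarrow>\<^sub>0 'k"
    by (rule PA.minus_equality) (use that in \<open>auto simp: PA_simps\<close>)
  have "ideal ?I PA"
  proof (rule idealI)
    show "ring (PA :: ('k, ('a, 'b) qpath \<Rightarrow>\<^sub>0 'k) module)" ..
    show "subgroup ?I (add_monoid PA)"
    proof (rule group.subgroupI)
      show "group (add_monoid (PA :: ('k, ('a, 'b) qpath \<Rightarrow>\<^sub>0 'k) module))"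
        by (rule PA.a_group)
      show "inv\<^bsub>add_monoid PA\<^esub> x \<in> ?I" if "x \<in> ?I" for x
        using that neg[of x] bad_paths by (auto simp: a_inv_def PA_simps)
      show "?I \<noteq> {}"
        by (auto intro!: exI[of _ 0])
    qed (use bad_paths in \<open>auto simp: PA_simps keys_add_subsetI intro: subsetD[OF keys_add_subsetI]\<close>)
    fix a x assume ax: "a \<in> ?I" "x \<in> carrier (PA :: ('k, ('a, 'b) qpath \<Rightarrow>\<^sub>0 'k) module)"
    have "Poly_Mapping.keys (pmul x a) \<subseteq> bad"
      by (rule pmul_keys[of x "qpaths G" a bad]) (use ax bad_qcomp_left in \<open>simp_all add: PA_simps\<close>)
    then show "x \<otimes>\<^bsub>PA\<^esub> a \<in> ?I" by simp
    have "Poly_Mapping.keys (pmul a x) \<subseteq> bad"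
      by (rule pmul_keys[of a bad x "qpaths G"]) (use ax bad_qcomp_right in \<open>simp_all add: PA_simps\<close>)
    then show "a \<otimes>\<^bsub>PA\<^esub> x \<in> ?I" by simp
  qed
  then have 1: "rel_ideal \<subseteq> ?I"
    unfolding rel_ideal_def using Z_bad by (intro PA.genideal_minimal) auto
  interpret J: ideal "rel_ideal :: (('a, 'b) qpath \<Rightarrow>\<^sub>0 'k) set" PA
    unfolding rel_ideal_def by (rule PA.genideal_ideal[OF S])
  have 2: "w \<in> rel_ideal" if "Poly_Mapping.keys w \<subseteq> bad" for w :: "('a, 'b) qpath \<Rightarrow>\<^sub>0 'k"
    using that
  proof (induction w rule: free_space_induct)
    case zero
    show ?case using J.zero_closed by (simp add: PA_simps)
  next
    case (single p c)
    then obtain r z s where h: "r \<in> qpaths G" "z \<in> Z" "s \<in> qpaths G" "qtarget r = qsource z"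
      "qtarget z = qsource s" "p = qcomp (qcomp r z) s"
      by (rule badE)
    have "Poly_Mapping.single z (1::'k) \<in> rel_ideal"
      unfolding rel_ideal_def
      by (rule subsetD[OF PA.genideal_self[OF S]], rule imageI, rule h)
    then have "pmul (pmul (Poly_Mapping.single r c) (Poly_Mapping.single z 1)) (Poly_Mapping.single s 1) \<in> rel_ideal"
      using h Z_qpaths by (intro J.I_r_closed J.I_l_closed) (simp_all add: PA_simps)
    then show ?case
      using h by (simp add: pmul_single)
  next
    case (add w w')
    then show ?case using J.a_closed[of w w'] by (simp add: PA_simps)
  qed
  show "rel_ideal = ?I"
    by (rule equalityI[OF 1]) (simp add: subset_iff 2)
  show "ideal (rel_ideal :: (('a, 'b) qpath \<Rightarrow>\<^sub>0 'k) set) PA" ..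
qed

abbreviation MA :: "('k::field, (('a, 'b) qpath \<Rightarrow>\<^sub>0 'k) set) module" where
  "MA \<equiv> monomial_algebra G Z"

lemma MA_eq: "MA = quot_space PA rel_ideal"
  by (simp add: monomial_algebra_def rel_ideal_def)

definition pclass :: "('a, 'b) qpath \<Rightarrow> (('a, 'b) qpath \<Rightarrow>\<^sub>0 'k::field) set" where
  "pclass p = rel_ideal +>\<^bsub>PA\<^esub> Poly_Mapping.single p 1"

text \<open>Well defined for paths that are not bad: two representatives differ by a combination of
  bad paths.\<close>

definition pcoef :: "('a, 'b) qpath \<Rightarrow> (('a, 'b) qpath \<Rightarrow>\<^sub>0 'k::field) set \<Rightarrow> 'k" where
  "pcoef p C = the_elem ((\<lambda>w. Poly_Mapping.lookup w p) ` C)"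

text \<open>A coset determines the coefficients of its representatives at the paths that are not
  bad, and if they all vanish, the representative lies in the ideal. So these paths represent a
  basis.\<close>

theorem path_basis_MA:
  "path_basis (MA :: ('k::field, (('a, 'b) qpath \<Rightarrow>\<^sub>0 'k) set) module) G (qpaths G - bad) pclass pcoef"
proof -
  let ?PA = "PA :: ('k, ('a, 'b) qpath \<Rightarrow>\<^sub>0 'k) module"
  let ?MA = "MA :: ('k, (('a, 'b) qpath \<Rightarrow>\<^sub>0 'k) set) module"
  let ?J = "rel_ideal :: (('a, 'b) qpath \<Rightarrow>\<^sub>0 'k) set"
  interpret PA: kalgebra ?PA
    by (rule kalgebra_PA)
  interpret J: ideal ?J ?PA
    by (rule ideal_rel_ideal)
  have sub: "submodule class_ring ?J ?PA"
    by (rule PA.subspaceI)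
      (auto simp: rel_ideal_eq PA_simps bad_def keys_add_subsetI
        dest: subsetD[OF keys_map_scale_subset] subsetD[OF keys_add])
  interpret Q: kquot ?PA ?J
    by (intro kquot.intro kquot_axioms.intro sub PA.kspace_axioms)
  have mult: "(?J +>\<^bsub>PA\<^esub> x) \<otimes>\<^bsub>?MA\<^esub> (?J +>\<^bsub>PA\<^esub> y) = ?J +>\<^bsub>PA\<^esub> (pmul x y)"
    if "x \<in> carrier PA" "y \<in> carrier PA" for x y
    unfolding MA_eq quot_space_simps using J.rcoset_mult_add[OF that] by (simp add: FactRing_def)
  have one: "\<one>\<^bsub>?MA\<^esub> = ?J +>\<^bsub>PA\<^esub> \<one>\<^bsub>?PA\<^esub>"
    unfolding MA_eq quot_space_simps by (simp add: FactRing_def)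
  have ks: "kspace ?MA"
    unfolding MA_eq by (rule Q.kspace_quot)
  then interpret M: kspace ?MA .
  have single: "Poly_Mapping.single p c \<in> carrier ?PA" if "p \<in> qpaths G" for p c
    using that by (simp add: PA_simps)
  have lookup: "pcoef p (?J +>\<^bsub>PA\<^esub> w) = Poly_Mapping.lookup w p" if "p \<notin> bad" "w \<in> carrier PA" for p w
  proof -
    have "(\<lambda>w. Poly_Mapping.lookup w p) ` (?J +>\<^bsub>PA\<^esub> w) = {Poly_Mapping.lookup w p}"
    proof (rule Q.image_coset[OF _ that(2)])
      fix y z assume yz: "y \<in> carrier ?PA" "z \<in> carrier ?PA" and J: "y \<ominus>\<^bsub>PA\<^esub> z \<in> ?J"
      have "z \<oplus>\<^bsub>PA\<^esub> (y \<ominus>\<^bsub>PA\<^esub> z) = y"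
        using yz PA.plus_minus_cancel PA.a_comm by simp
      then have "y = z + (y \<ominus>\<^bsub>PA\<^esub> z)"
        by (simp add: PA_simps)
      moreover have "Poly_Mapping.lookup (y \<ominus>\<^bsub>PA\<^esub> z) p = 0"
        using J that(1) by (auto simp: rel_ideal_eq in_keys_iff)
      ultimately show "Poly_Mapping.lookup y p = Poly_Mapping.lookup z p"
        by (metis add.right_neutral lookup_add)
    qed
    then show ?thesis by (simp add: pcoef_def)
  qed
  have MAE: "\<exists>w\<in>carrier PA. C = ?J +>\<^bsub>PA\<^esub> w" if "C \<in> carrier ?MA" for C
    using that unfolding MA_eq by (auto elim: Q.quotE)
  have add: "(?J +>\<^bsub>PA\<^esub> x) \<oplus>\<^bsub>?MA\<^esub> (?J +>\<^bsub>PA\<^esub> y) = ?J +>\<^bsub>PA\<^esub> (x + y)"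
    if "x \<in> carrier PA" "y \<in> carrier PA" for x y
    unfolding MA_eq using Q.add_quot[OF that] by (simp add: PA_simps)
  have scale: "c \<odot>\<^bsub>?MA\<^esub> (?J +>\<^bsub>PA\<^esub> x) = ?J +>\<^bsub>PA\<^esub> (c \<odot>\<^bsub>PA\<^esub> x)" if "x \<in> carrier PA" for c x
    unfolding MA_eq using Q.smult_quot[OF that] .
  have "ring (?PA Quot ?J)"
    by (rule J.quotient_is_ring)
  then have "ring ?MA"
    unfolding MA_eq by (rule ring_cong) (simp_all only: quot_space_simps)
  moreover have "kalgebra_axioms ?MA"
  proof
    fix C D c assume C: "C \<in> carrier ?MA" and D: "D \<in> carrier ?MA"
    obtain x where x: "x \<in> carrier ?PA" "C = ?J +>\<^bsub>PA\<^esub> x"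
      using MAE[OF C] by (rule bexE)
    obtain y where y: "y \<in> carrier ?PA" "D = ?J +>\<^bsub>PA\<^esub> y"
      using MAE[OF D] by (rule bexE)
    note xy = x(1) y(1) x(2) y(2)
    show "c \<odot>\<^bsub>?MA\<^esub> C \<otimes>\<^bsub>?MA\<^esub> D = c \<odot>\<^bsub>?MA\<^esub> (C \<otimes>\<^bsub>?MA\<^esub> D)"
      using xy by (simp add: scale mult PA.scale_mult_left)
    show "C \<otimes>\<^bsub>?MA\<^esub> (c \<odot>\<^bsub>?MA\<^esub> D) = c \<odot>\<^bsub>?MA\<^esub> (C \<otimes>\<^bsub>?MA\<^esub> D)"
      using xy by (simp add: scale mult PA.scale_mult_right)
  qed
  ultimately have alg: "kalgebra ?MA"
    by (intro kalgebra.intro ks)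
  have zero: "\<zero>\<^bsub>?MA\<^esub> = ?J"
    unfolding MA_eq by (rule Q.zero_quot)
  have coset_zero: "?J +>\<^bsub>PA\<^esub> w = \<zero>\<^bsub>?MA\<^esub> \<longleftrightarrow> w \<in> ?J" if "w \<in> carrier PA" for w
    unfolding MA_eq by (rule Q.coset_eq_zero_iff[OF that])
  have cl: "pclass p \<in> carrier ?MA" if "p \<in> qpaths G" for p
    unfolding MA_eq pclass_def by (rule Q.coset_in_quot[OF single[OF that]])
  have "path_basis_axioms ?MA G (qpaths G - bad) pclass pcoef"
  proof
    show "pclass p = \<zero>\<^bsub>?MA\<^esub>" if "p \<in> qpaths G" "p \<notin> qpaths G - bad" for p
      unfolding pclass_def coset_zero[OF single[OF that(1)]] using that by (simp add: rel_ideal_eq)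
    show "pclass p \<otimes>\<^bsub>?MA\<^esub> pclass q = (if qtarget p = qsource q then pclass (qcomp p q) else \<zero>\<^bsub>?MA\<^esub>)"
      if "p \<in> qpaths G" "q \<in> qpaths G" for p q
      unfolding pclass_def mult[OF single[OF that(1)] single[OF that(2)]] pmul_single
      using Q.zero_quot' by (simp add: MA_eq PA_simps)
    have lin: "(\<lambda>w. ?J +>\<^bsub>PA\<^esub> w) \<in> module_hom class_ring ?PA ?MA"
      unfolding MA_eq by (rule Q.klin_coset)
    have "(\<lambda>v. Poly_Mapping.single (triv v) 1) \<in> verts G \<rightarrow> carrier ?PA"
      using single triv_in_qpaths by auto
    note sum = klin_finsum[OF PA.kspace_axioms ks lin this]
    have "(\<Oplus>\<^bsub>?PA\<^esub>v\<in>V. Poly_Mapping.single (triv v) 1) = (\<Sum>v\<in>V. Poly_Mapping.single (triv v) 1)"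
      if "V \<subseteq> verts G" for V
      using that finite_subset[OF that finite_verts]
      by (induction V rule: infinite_finite_induct)
        (auto simp: PA.finsum_insert single triv_in_qpaths PA_simps(2,3) subset_iff)
    then show "\<one>\<^bsub>?MA\<^esub> = (\<Oplus>\<^bsub>?MA\<^esub>v\<in>verts G. pclass (triv v))"
      unfolding one pclass_def using sum by (simp add: PA_simps)
    fix p assume p: "p \<in> qpaths G - bad"
    show "pcoef p \<in> module_hom class_ring ?MA ground_space"
    proof (rule klinI)
      fix C D c assume C: "C \<in> carrier ?MA"
      show "pcoef p (c \<odot>\<^bsub>?MA\<^esub> C) = c \<odot>\<^bsub>ground_space\<^esub> pcoef p C"
      proof -
        obtain x where x: "x \<in> carrier ?PA" "C = ?J +>\<^bsub>PA\<^esub> x"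
          using MAE[OF C] by (rule bexE)
        then show ?thesis
          using p lookup[OF _ PA.scale_closed[OF x(1)], of p c] by (simp add: scale lookup) (simp add: PA_simps)
      qed
      assume D: "D \<in> carrier ?MA"
      show "pcoef p (C \<oplus>\<^bsub>?MA\<^esub> D) = pcoef p C \<oplus>\<^bsub>ground_space\<^esub> pcoef p D"
      proof -
        obtain x where x: "x \<in> carrier ?PA" "C = ?J +>\<^bsub>PA\<^esub> x"
          using MAE[OF C] by (rule bexE)
        obtain y where y: "y \<in> carrier ?PA" "D = ?J +>\<^bsub>PA\<^esub> y"
          using MAE[OF D] by (rule bexE)
        have "x + y \<in> carrier ?PA"
          using x y by (simp add: PA_simps keys_add_subsetI)
        then show ?thesis
          using p x y by (simp add: add lookup lookup_add)
      qed
    qed simp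
    show "pcoef p (pclass q) = (if p = q then 1 else (0::'k))" if "q \<in> qpaths G - bad" for q
      unfolding pclass_def using p that lookup[OF _ single[of q 1], of p]
      by (auto simp: lookup_single when_def)
  next
    show "C = \<zero>\<^bsub>?MA\<^esub>" if C: "C \<in> carrier ?MA" and 0: "\<And>p. p \<in> qpaths G - bad \<Longrightarrow> pcoef p C = 0" for C
    proof -
      obtain w where w: "w \<in> carrier ?PA" "C = ?J +>\<^bsub>PA\<^esub> w"
        using MAE[OF C] by (rule bexE)
      have "Poly_Mapping.keys w \<subseteq> bad"
      proof
        fix p assume p: "p \<in> Poly_Mapping.keys w"
        then have "p \<in> qpaths G"
          using w by (auto simp: PA_simps)
        then show "p \<in> bad"
          using 0[of p] lookup[OF _ w(1), of p] p w(2) by (auto simp: in_keys_iff)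
      qed
      then show ?thesis
        unfolding w(2) coset_zero[OF w(1)] by (simp add: rel_ideal_eq)
    qed
    show "triv v \<in> qpaths G - bad" if "v \<in> verts G" for v
      using that triv_in_qpaths bad_length[of "triv v"] by auto
    show "(tail G e, [e], head G e) \<in> qpaths G - bad" if "e \<in> arcs G" for e
      using that arc_in_qpaths bad_length[of "(tail G e, [e], head G e)"] by auto
  qed (use cl in auto)
  then show ?thesis
    by (intro path_basis.intro alg fin_digraph_axioms)
qed

end


section \<open>Potentials on trees\<close>

text \<open>Applied to a walk with \<open>f\<close> the head, to cut out a closed piece, and with
  \<open>f\<close> the edge, to find an edge traversed twice.\<close>

lemma not_distinct_map_decomp:
  assumes "\<not> distinct (map f p)"
  obtains p1 a p2 b p3 where "p = p1 @ a # p2 @ b # p3" "f a = f b"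
proof -
  have "\<exists>p1 a p2 b p3. p = p1 @ a # p2 @ b # p3 \<and> f a = f b"
    using assms
  proof (induction p)
    case (Cons a p)
    show ?case
    proof (cases "distinct (map f p)")
      case True
      with Cons.prems obtain b where "b \<in> set p" "f a = f b"
        by auto
      then show ?thesis
        by (metis append_Nil split_list)
    next
      case False
      then show ?thesis
        using Cons.IH by (metis append_Cons)
    qed
  qed simp
  with that show ?thesis by blast
qed

context wf_digraph
begin

abbreviation UG :: "('a, 'b \<times> bool) pre_digraph" where
  "UG \<equiv> underlying_graph G"

lemma UG_simps [simp]:
  "verts UG = verts G" "arcs UG = arcs G \<times> UNIV"
  "tail UG (e, b) = (if b then head G e else tail G e)"
  "head UG (e, b) = (if b then tail G e else head G e)"
  by (simp_all add: underlying_graph_def)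

lemma wf_UG: "wf_digraph UG"
  by unfold_locales (auto simp: underlying_graph_def split: if_splits)

interpretation UG: wf_digraph UG
  by (rule wf_UG)

text \<open>Summing this along an undirected walk integrates \<open>c\<close>. The values lie in any
  abelian group, so that arrows can be counted in the integers as well as weighted in the ground
  field.\<close>

definition signed :: "('b \<Rightarrow> 'g::ab_group_add) \<Rightarrow> 'b \<times> bool \<Rightarrow> 'g" where
  "signed c = (\<lambda>(e, b). if b then - c e else c e)"

lemma signed_sum_potential:
  assumes "\<And>e. e \<in> arcs G \<Longrightarrow> c e = x (head G e) - x (tail G e)" and "UG.awalk u p v"
  shows "sum_list (map (signed c) p) = x v - x u"
  using assms(2)
proof (induction p arbitrary: u)
  case (Cons a p)
  then have "UG.awalk (head UG a) p v" "a \<in> arcs UG" "tail UG a = u"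
    by (simp_all add: UG.awalk_Cons_iff)
  with Cons.IH[of "head UG a"] show ?case
    using assms(1) by (cases a) (auto simp: signed_def split: if_splits)
qed (simp add: UG.awalk_Nil_iff)

text \<open>Translates the distinctness of vertices in the notion of a cycle into distinctness of
  the heads of its edges.\<close>

lemma UG_awalk_verts: "UG.cas u p v \<Longrightarrow> UG.awalk_verts u p = u # map (head UG) p"
  by (induction p arbitrary: u) auto

text \<open>Induction on the length. A repeated head splits the walk into two shorter closed walks.
  Without it, a repeated edge is traversed in opposite directions, and its two contributions cancel.
  If neither occurs, a nonempty walk would be a forbidden cycle.\<close>

lemma closed_walk_signed_sum:
  assumes acyclic: "\<not> (\<exists>p. UG.cycle p \<and> distinct (map fst p))"
    and "UG.awalk u p u"
  shows "sum_list (map (signed c) p) = 0"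
  using assms(2)
proof (induction "length p" arbitrary: p u rule: less_induct)
  case less
  show ?case
  proof (cases "distinct (map (head UG) p)")
    case False
    then obtain p1 a p2 b p3 where p: "p = p1 @ a # p2 @ b # p3" and ab: "head UG a = head UG b"
      by (rule not_distinct_map_decomp)
    define m where "m = head UG a"
    have w: "UG.awalk u (p1 @ [a]) m" "UG.awalk m (p2 @ [b]) m" "UG.awalk m p3 u"
      using less.prems ab
      by (auto simp: p m_def UG.awalk_append_iff UG.awalk_Cons_iff UG.awalk_Nil_iff)
    have "sum_list (map (signed c) ((p1 @ [a]) @ p3)) = 0"
      by (rule less.hyps[OF _ UG.awalk_appendI[OF w(1,3)]]) (simp add: p)
    moreover have "sum_list (map (signed c) (p2 @ [b])) = 0"
      by (rule less.hyps[OF _ w(2)]) (simp add: p)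
    moreover have "sum_list (map (signed c) p) = sum_list (map (signed c) ((p1 @ [a]) @ p3))
        + sum_list (map (signed c) (p2 @ [b]))"
      by (simp add: p algebra_simps)
    ultimately show ?thesis
      by simp
  next
    case heads: True
    show ?thesis
    proof (cases "distinct (map fst p)")
      case False
      then obtain p1 a p2 b p3 where p: "p = p1 @ a # p2 @ b # p3" and ab: "fst a = fst b"
        by (rule not_distinct_map_decomp)
      \<comment> \<open>Two traversals in the same direction would have the same head.\<close>
      have "a \<noteq> b"
        using heads by (auto simp: p)
      with ab obtain e s where s: "a = (e, s)" "b = (e, \<not> s)"
        by (cases a; cases b) auto
      \<comment> \<open>Without the two opposite traversals, \<open>p2\<close> is closed at the far
        end of the edge and \<open>p1 @ p3\<close> is a closed walk at \<open>u\<close>.\<close>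
      have w: "UG.awalk u p1 (tail UG a)" "UG.awalk (head UG a) p2 (head UG a)" "UG.awalk (tail UG a) p3 u"
        using less.prems
        by (auto simp: p s UG.awalk_append_iff UG.awalk_Cons_iff split: if_splits)
      have "sum_list (map (signed c) (p1 @ p3)) = 0"
        by (rule less.hyps[OF _ UG.awalk_appendI[OF w(1,3)]]) (simp add: p)
      moreover have "sum_list (map (signed c) p2) = 0"
        by (rule less.hyps[OF _ w(2)]) (simp add: p)
      moreover have "signed c a + signed c b = 0"
        by (simp add: s signed_def)
      moreover have "sum_list (map (signed c) p) = sum_list (map (signed c) (p1 @ p3))
          + sum_list (map (signed c) p2) + (signed c a + signed c b)"
        by (simp add: p algebra_simps)
      ultimately show ?thesis
        by simp
    next
      case True
      have "p = []"
      proof (rule ccontr)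
        assume "p \<noteq> []"
        then have "UG.cycle p"
          unfolding UG.cycle_def using less.prems heads UG_awalk_verts[of u p u]
          by (auto simp: UG.awalk_def)
        with True acyclic show False by blast
      qed
      then show ?thesis by simp
    qed
  qed
qed

text \<open>The arc relation of \<open>UG\<close> is already the symmetric closure of that of
  \<open>G\<close>.\<close>

lemma connected_UG:
  assumes "Digraph_Component.connected G"
  shows "Digraph_Component.connected UG"
proof -
  have "(u, v) \<in> arcs_ends UG \<longleftrightarrow> (u, v) \<in> (arcs_ends G)\<^sup>s" for u v
  proof -
    have "(u, v) \<in> arcs_ends UG \<longleftrightarrow> (\<exists>e\<in>arcs G. \<exists>b. u = tail UG (e, b) \<and> v = head UG (e, b))"
      by (auto simp: arcs_ends_conv image_def simp del: UG_simps(3,4))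
    then show ?thesis
      by (auto simp: ex_bool_eq symcl_def arcs_ends_conv)
  qed
  then have "arcs_ends UG = (arcs_ends G)\<^sup>s" by auto
  then have "(arcs_ends UG)\<^sup>s = (arcs_ends G)\<^sup>s"
    by (auto simp: symcl_def)
  then show ?thesis
    using assms by (simp add: connected_conv)
qed

lemma connected_UG_awalk:
  assumes "Digraph_Component.connected G" "u \<in> verts G" "v \<in> verts G"
  shows "\<exists>p. UG.awalk u p v"
proof -
  have "(u, v) \<in> rtrancl_on (verts G) ((arcs_ends G)\<^sup>s)"
    using assms by (simp add: connected_conv)
  then show ?thesis
  proof (induction rule: rtrancl_on_induct)
    case base
    then show ?case
      using assms(2) by (intro exI[of _ "[]"]) (simp add: UG.awalk_Nil_iff)
  next
    case (step y z)
    then obtain p where p: "UG.awalk u p y" by blast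
    from step obtain e where e: "e \<in> arcs G" "tail G e = y \<and> head G e = z \<or> head G e = y \<and> tail G e = z"
      by (auto simp: arcs_ends_conv symcl_def)
    then have "UG.awalk y [(e, False)] z \<or> UG.awalk y [(e, True)] z"
      by (auto simp: UG.awalk_Cons_iff UG.awalk_Nil_iff)
    then show ?case
      using UG.awalk_appendI[OF p] by (elim disjE) (rule exI, assumption)+
  qed
qed

text \<open>The potential at a vertex is the integral of \<open>c\<close> along some walk from a
  root; in the absence of cycles the choice of the walk does not matter.\<close>

lemma tree_potential:
  fixes c :: "'b \<Rightarrow> 'g::ab_group_add"
  assumes conn: "Digraph_Component.connected G" and tree: "underlying_tree G"
  shows "\<exists>x. \<forall>e\<in>arcs G. c e = x (head G e) - x (tail G e)"
proof -
  have acyclic: "\<not> (\<exists>p. UG.cycle p \<and> distinct (map fst p))"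
    using tree by (simp add: underlying_tree_def)
  obtain r where r: "r \<in> verts G"
    using conn by (auto simp: connected_conv)
  define W where "W v = (SOME p. UG.awalk r p v)" for v
  have W: "UG.awalk r (W v) v" if "v \<in> verts G" for v
    unfolding W_def by (rule someI_ex) (rule connected_UG_awalk[OF conn r that])
  define x where "x v = sum_list (map (signed c) (W v))" for v
  have "c e = x (head G e) - x (tail G e)" if e: "e \<in> arcs G" for e
  proof -
    have t: "tail G e \<in> verts G" and h: "head G e \<in> verts G"
      using e by auto
    \<comment> \<open>Returning to the root by the same walk \<open>p\<close> closes both the chosen
      walk to the head and the one to the tail followed by \<open>e\<close>.\<close>
    obtain p where p: "UG.awalk (head G e) p r"
      using connected_UG_awalk[OF conn h r] by blast
    have e': "UG.awalk (tail G e) [(e, False)] (head G e)"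
      using e by (simp add: UG.awalk_Cons_iff UG.awalk_Nil_iff)
    have "sum_list (map (signed c) (W (head G e) @ p)) = 0"
      by (rule closed_walk_signed_sum[OF acyclic UG.awalk_appendI[OF W[OF h] p]])
    moreover have "sum_list (map (signed c) (W (tail G e) @ [(e, False)] @ p)) = 0"
      by (rule closed_walk_signed_sum[OF acyclic
            UG.awalk_appendI[OF W[OF t] UG.awalk_appendI[OF e' p]]])
    ultimately have 1: "x (head G e) + sum_list (map (signed c) p) = 0"
      and 2: "x (tail G e) + (c e + sum_list (map (signed c) p)) = 0"
      by (simp_all add: x_def signed_def)
    have "sum_list (map (signed c) p) = - x (head G e)"
      using 1 by (simp add: add_eq_0_iff)
    then show ?thesis
      using 2 by (simp add: algebra_simps)
  qed
  then show ?thesis by blast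
qed

section \<open>Directed walks in a tree\<close>

lemma walk_sum_potential:
  assumes "\<And>e. e \<in> arcs G \<Longrightarrow> c e = x (head G e) - x (tail G e)" and "awalk u p v"
  shows "sum_list (map c p) = x v - (x u :: 'g::ab_group_add)"
  using assms(2)
  by (induction p arbitrary: u) (auto simp: awalk_Cons_iff awalk_Nil_iff assms(1))

text \<open>A potential for the constant 1 over the integers measures the length of directed walks,
  so a closed one has length zero.\<close>

lemma tree_closed_walk:
  assumes "Digraph_Component.connected G" "underlying_tree G" "awalk u p u"
  shows "p = []"
proof -
  obtain x :: "'a \<Rightarrow> int" where x: "\<And>e. e \<in> arcs G \<Longrightarrow> 1 = x (head G e) - x (tail G e)"
    using tree_potential[OF assms(1,2), of "\<lambda>_. 1"] by blast
  have "sum_list (map (\<lambda>_. 1) p) = (0::int)"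
    using walk_sum_potential[of "\<lambda>_. 1" x, OF x assms(3)] by simp
  then show ?thesis
    by (simp add: sum_list_triv)
qed

text \<open>A potential for the indicator of the first arrow \<open>e\<close> of one walk counts the
  occurrences of \<open>e\<close>, so \<open>e\<close> occurs in the other walk as well. What
  precedes \<open>e\<close> there is a closed walk, hence empty, and both walks start with
  \<open>e\<close>.\<close>

lemma tree_walk_unique:
  assumes T: "Digraph_Component.connected G" "underlying_tree G"
    and "awalk u p v" "awalk u q v"
  shows "p = q"
  using assms(3,4)
proof (induction p arbitrary: u q)
  case Nil
  then show ?case
    using tree_closed_walk[OF T] by (auto simp: awalk_Nil_iff)
next
  case (Cons e p)
  obtain x :: "'a \<Rightarrow> int" where x: "\<And>e'. e' \<in> arcs G \<Longrightarrow> of_bool (e' = e) = x (head G e') - x (tail G e')"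
    using tree_potential[OF T, of "\<lambda>e'. of_bool (e' = e)"] by blast
  have "sum_list (map (\<lambda>e'. of_bool (e' = e)) q) = (sum_list (map (\<lambda>e'. of_bool (e' = e)) (e # p)) :: int)"
    using walk_sum_potential[of "\<lambda>e'. of_bool (e' = e)" x, OF x] Cons.prems by metis
  moreover have "0 \<le> (sum_list (map (\<lambda>e'. of_bool (e' = e)) p) :: int)"
    by (rule sum_list_nonneg) auto
  moreover have "sum_list (map (\<lambda>e'. of_bool (e' = e)) q) = (0::int)" if "e \<notin> set q"
    using that by (induction q) auto
  ultimately have "e \<in> set q"
    by auto
  then obtain q1 q2 where q: "q = q1 @ e # q2"
    by (meson split_list)
  then have "awalk u q1 u"
    using Cons.prems by (auto simp: awalk_append_iff awalk_Cons_iff)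
  then have "q1 = []"
    by (rule tree_closed_walk[OF T])
  then show ?case
    using Cons q by (auto simp: awalk_Cons_iff)
qed

text \<open>The indicator of a single arc suffices. It would distinguish two parallel arcs, although
  a potential cannot; and its integral along a cycle through this arc is 1 or -1, nonzero in every
  field.\<close>

lemma underlying_treeI:
  assumes conn: "Digraph_Component.connected G"
    and pot: "\<And>c :: 'b \<Rightarrow> 'k::field. \<exists>x. \<forall>e\<in>arcs G. c e = x (head G e) - x (tail G e)"
  shows "nomulti_digraph G" "underlying_tree G"
proof -
  show "nomulti_digraph G"
  proof
    fix e f assume ef: "e \<in> arcs G" "f \<in> arcs G" "arc_to_ends G e = arc_to_ends G f"
    obtain x :: "'a \<Rightarrow> 'k" where x: "\<forall>e'\<in>arcs G. of_bool (e' = e) = x (head G e') - x (tail G e')"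
      using pot[of "\<lambda>e'. of_bool (e' = e)"] by blast
    have "of_bool (f = e) = (1::'k)"
      using x[rule_format, OF ef(1)] x[rule_format, OF ef(2)] ef(3) by (simp add: arc_to_ends_def)
    then show "e = f"
      by (cases "f = e") auto
  qed
  show "underlying_tree G"
    unfolding underlying_tree_def
  proof (intro conjI connected_UG[OF conn] notI)
    assume "\<exists>p. UG.cycle p \<and> distinct (map fst p)"
    then obtain p u where p: "UG.awalk u p u" "p \<noteq> []" "distinct (map fst p)"
      by (auto simp: UG.cycle_def)
    then obtain e b q where q: "p = (e, b) # q"
      by (metis neq_Nil_conv surj_pair)
    obtain x :: "'a \<Rightarrow> 'k" where x: "\<forall>e'\<in>arcs G. of_bool (e' = e) = x (head G e') - x (tail G e')"
      using pot[of "\<lambda>e'. of_bool (e' = e)"] by blast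
    let ?c = "\<lambda>e'. of_bool (e' = e) :: 'k"
    have "sum_list (map (signed ?c) p) = 0"
      using signed_sum_potential[of ?c x, OF _ p(1)] x by simp
    moreover have "sum_list (map (signed ?c) q) = 0"
    proof -
      have "e \<notin> set (map fst q)"
        using p(3) by (simp add: q)
      then show ?thesis
        by (induction q) (auto simp: signed_def)
    qed
    ultimately show False
      by (simp add: q signed_def split: if_splits)
  qed
qed

end


section \<open>Derivations of monomial algebras\<close>

context kalgebra
begin

text \<open>The separability of the algebra spanned by orthogonal idempotents, with \<open>s\<close>
  the sum of all \<open>e v \<otimes> D (e v)\<close>: multiplying the Leibniz rule for
  \<open>e v \<otimes> e i\<close> by \<open>e v\<close> from the left and summing over
  \<open>v\<close> gives \<open>e i \<otimes> D (e i) = s \<otimes> e i \<oplus> D (e i)\<close>,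
  and the left-hand side is \<open>e i \<otimes> s\<close>.\<close>

lemma derivation_idempotents:
  assumes D: "derivation D" and fin: "finite V" and cl: "\<And>v. v \<in> V \<Longrightarrow> e v \<in> carrier A"
    and orth: "\<And>v w. v \<in> V \<Longrightarrow> w \<in> V \<Longrightarrow> e v \<otimes> e w = (if v = w then e v else \<zero>)"
    and one: "\<one> = (\<Oplus>v\<in>V. e v)"
  obtains s where "s \<in> carrier A" "\<And>v. v \<in> V \<Longrightarrow> D (e v) = e v \<otimes> s \<ominus> s \<otimes> e v"
proof -
  note Dcl = derivation_closed[OF D]
  define s where "s = (\<Oplus>v\<in>V. e v \<otimes> D (e v))"
  have s: "s \<in> carrier A"
    unfolding s_def using cl Dcl by (intro finsum_closed) auto
  have "D (e i) = e i \<otimes> s \<ominus> s \<otimes> e i" if i: "i \<in> V" for i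
  proof -
    have single: "(\<Oplus>v\<in>V. if i = v then f v else \<zero>) = f i" if "f \<in> V \<rightarrow> carrier A" for f
      using add.finprod_singleton[OF i fin that] .
    have "e i \<otimes> s = (\<Oplus>v\<in>V. if i = v then e v \<otimes> D (e v) else \<zero>)"
      unfolding s_def using cl Dcl i fin orth
      by (subst finsum_rdistr) (auto intro!: finsum_cong' simp: m_assoc[symmetric] orth)
    then have 1: "e i \<otimes> s = e i \<otimes> D (e i)"
      using single[of "\<lambda>v. e v \<otimes> D (e v)"] cl Dcl by auto
    have eq: "e v \<otimes> D (e v) \<otimes> e i = (if i = v then e v \<otimes> D (e v) else \<zero>) \<ominus> e v \<otimes> D (e i)" if v: "v \<in> V" for v
    proof -
      have "e v \<otimes> D (e v \<otimes> e i) = e v \<otimes> D (e v) \<otimes> e i \<oplus> e v \<otimes> D (e i)"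
      proof -
        have "e v \<otimes> (e v \<otimes> D (e i)) = e v \<otimes> D (e i)"
          using cl[OF v] cl[OF i] Dcl orth[OF v v] by (simp add: m_assoc[symmetric])
        then show ?thesis
          using cl[OF v] cl[OF i] Dcl by (simp add: derivation_mult[OF D] r_distr m_assoc)
      qed
      moreover have "e v \<otimes> D (e v \<otimes> e i) = (if i = v then e v \<otimes> D (e v) else \<zero>)"
        using orth[OF v i] cl[OF v] klin_zero[OF kspace_axioms kspace_axioms derivation_linear[OF D]] by auto
      ultimately have "(if i = v then e v \<otimes> D (e v) else \<zero>) = e v \<otimes> D (e i) \<oplus> e v \<otimes> D (e v) \<otimes> e i"
        using cl[OF v] cl[OF i] Dcl by (simp add: a_comm)
      then show ?thesis
        using cl[OF v] cl[OF i] Dcl by (simp add: add_diff_cancel_left)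
    qed
    have "s \<otimes> e i = (\<Oplus>v\<in>V. e v \<otimes> D (e v) \<otimes> e i)"
      unfolding s_def using cl Dcl i fin by (subst finsum_ldistr) auto
    also have "\<dots> = (\<Oplus>v\<in>V. (if i = v then e v \<otimes> D (e v) else \<zero>) \<oplus> (\<ominus> (e v \<otimes> D (e i))))"
      using cl Dcl i by (intro finsum_cong') (auto simp: eq a_minus_def)
    also have "\<dots> = (\<Oplus>v\<in>V. if i = v then e v \<otimes> D (e v) else \<zero>) \<oplus> (\<Oplus>v\<in>V. \<ominus> (e v \<otimes> D (e i)))"
      using cl Dcl i by (intro finsum_addf) auto
    also have "(\<Oplus>v\<in>V. if i = v then e v \<otimes> D (e v) else \<zero>) = e i \<otimes> D (e i)"
      using single[of "\<lambda>v. e v \<otimes> D (e v)"] cl Dcl by auto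
    also have "(\<Oplus>v\<in>V. \<ominus> (e v \<otimes> D (e i))) = (\<Oplus>v\<in>V. e v \<otimes> (\<ominus> D (e i)))"
      using cl Dcl i by (intro finsum_cong') (auto simp: r_minus)
    also have "\<dots> = \<one> \<otimes> (\<ominus> D (e i))"
      unfolding one using cl Dcl i fin by (subst finsum_ldistr) auto
    finally have "s \<otimes> e i = e i \<otimes> s \<ominus> D (e i)"
      using Dcl[OF cl[OF i]] 1 by (simp add: a_minus_def)
    then have "s \<otimes> e i \<oplus> D (e i) = e i \<otimes> s"
      using cl[OF i] s Dcl[OF cl[OF i]] by (simp add: plus_minus_cancel)
    then show ?thesis
      using cl[OF i] s Dcl[OF cl[OF i]] add_diff_cancel_left[of "s \<otimes> e i" "D (e i)"] by simp
  qed
  with s show ?thesis by (rule that)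
qed

lemma derivation_minus_inner:
  assumes "derivation D" "s \<in> carrier A"
  shows "derivation (\<lambda>a. D a \<ominus> (a \<otimes> s \<ominus> s \<otimes> a))"
proof -
  have d: "derivation (\<lambda>a. D a \<oplus> (- 1) \<odot> (a \<otimes> s \<ominus> s \<otimes> a))"
    by (intro derivation_add derivation_scale derivation_inner assms)
  have eq: "D a \<oplus> (- 1) \<odot> (a \<otimes> s \<ominus> s \<otimes> a) = D a \<ominus> (a \<otimes> s \<ominus> s \<otimes> a)" if "a \<in> carrier A" for a
    using that assms by (simp add: a_minus_def[of A "D a"] minus_one_scale)
  show ?thesis
    unfolding derivation_def
  proof (intro conjI ballI)
    show "(\<lambda>a. D a \<ominus> (a \<otimes> s \<ominus> s \<otimes> a)) \<in> module_hom class_ring A A"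
      by (rule klin_cong[OF kspace_axioms derivation_linear[OF d]]) (simp add: eq)
    fix a b assume "a \<in> carrier A" "b \<in> carrier A"
    then show "D (a \<otimes> b) \<ominus> (a \<otimes> b \<otimes> s \<ominus> s \<otimes> (a \<otimes> b))
        = (D a \<ominus> (a \<otimes> s \<ominus> s \<otimes> a)) \<otimes> b \<oplus> a \<otimes> (D b \<ominus> (b \<otimes> s \<ominus> s \<otimes> b))"
      using derivation_mult[OF d, of a b] by (simp add: eq)
  qed
qed

end

context path_basis
begin

lemma coef_zero: "p \<in> P \<Longrightarrow> coef p \<zero> = 0"
  using klin_zero[OF kspace_axioms kspace_ground coef_linear] by simp

lemma coef_scale: "p \<in> P \<Longrightarrow> a \<in> carrier A \<Longrightarrow> coef p (c \<odot> a) = c * coef p a"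
  using klin_scale[OF coef_linear] by simp

lemma coef_add: "p \<in> P \<Longrightarrow> a \<in> carrier A \<Longrightarrow> b \<in> carrier A \<Longrightarrow> coef p (a \<oplus> b) = coef p a + coef p b"
  using klin_add[OF coef_linear] by simp

lemma coef_diff: "p \<in> P \<Longrightarrow> a \<in> carrier A \<Longrightarrow> b \<in> carrier A \<Longrightarrow> coef p (a \<ominus> b) = coef p a - coef p b"
  by (simp add: a_minus_def coef_add coef_scale flip: minus_one_scale)

lemma P_closed: "p \<in> P \<Longrightarrow> \<pi> p \<in> carrier A"
  using P_qpaths path_closed by blast

lemma coef_qpath: "p \<in> P \<Longrightarrow> q \<in> qpaths Q \<Longrightarrow> coef p (\<pi> q) = of_bool (p = q)"
  using coef_path[of p q] path_zero[of q] coef_zero[of p] by (cases "q \<in> P") auto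

lemma expand:
  assumes "finite P" and a: "a \<in> carrier A"
  shows "a = (\<Oplus>p\<in>P. coef p a \<odot> \<pi> p)"
proof -
  let ?b = "\<Oplus>p\<in>P. coef p a \<odot> \<pi> p"
  have b: "?b \<in> carrier A"
    using P_closed by (intro finsum_closed) auto
  have "coef q (a \<ominus> ?b) = 0" if q: "q \<in> P" for q
  proof -
    have "coef q ?b = (\<Sum>p\<in>P. coef p a * of_bool (q = p))"
      using P_closed P_qpaths q by (subst coef_sum) (auto simp: coef_scale coef_qpath subset_iff intro!: sum.cong)
    also have "\<dots> = coef q a"
      using assms(1) q by (simp add: of_bool_def if_distrib[of "(*) _"] sum.delta cong: if_cong)
    finally show ?thesis
      using q a b by (simp add: coef_diff)
  qed
  then have "a \<ominus> ?b = \<zero>"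
    using a b by (intro coef_eqI) auto
  then show ?thesis
    using a b by simp
qed

lemma linear_eqI:
  assumes fin: "finite P" and V: "kspace V" and f: "f \<in> module_hom class_ring A V" and g: "g \<in> module_hom class_ring A V"
    and eq: "\<And>p. p \<in> P \<Longrightarrow> f (\<pi> p) = g (\<pi> p)" and a: "a \<in> carrier A"
  shows "f a = g a"
proof -
  interpret V: kspace V by fact
  have "(\<lambda>p. coef p a \<odot> \<pi> p) \<in> P \<rightarrow> carrier A"
    using P_closed by auto
  note sum = klin_finsum[OF kspace_axioms V _ this]
  have "f (\<Oplus>p\<in>P. coef p a \<odot> \<pi> p) = g (\<Oplus>p\<in>P. coef p a \<odot> \<pi> p)"
    unfolding sum[OF f] sum[OF g]
    using klin_closed[OF g] P_closed
    by (intro V.finsum_cong') (auto simp: klin_scale[OF f] klin_scale[OF g] eq)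
  then show ?thesis
    using expand[OF fin a] by simp
qed

lemma bilinear_eqI:
  assumes fin: "finite P" and V: "kspace V"
    and lin: "\<And>b. b \<in> carrier A \<Longrightarrow> (\<lambda>a. F a b) \<in> module_hom class_ring A V"
      "\<And>a. a \<in> carrier A \<Longrightarrow> F a \<in> module_hom class_ring A V"
      "\<And>b. b \<in> carrier A \<Longrightarrow> (\<lambda>a. H a b) \<in> module_hom class_ring A V"
      "\<And>a. a \<in> carrier A \<Longrightarrow> H a \<in> module_hom class_ring A V"
    and eq: "\<And>p q. p \<in> P \<Longrightarrow> q \<in> P \<Longrightarrow> F (\<pi> p) (\<pi> q) = H (\<pi> p) (\<pi> q)"
    and ab: "a \<in> carrier A" "b \<in> carrier A"
  shows "F a b = H a b"
proof (rule linear_eqI[OF fin V lin(1)[OF ab(2)] lin(3)[OF ab(2)] _ ab(1)])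
  fix p assume p: "p \<in> P"
  show "F (\<pi> p) b = H (\<pi> p) b"
    by (rule linear_eqI[OF fin V lin(2)[OF P_closed[OF p]] lin(4)[OF P_closed[OF p]] eq[OF p] ab(2)])
qed

section \<open>Derivations given by weights of arrows\<close>

definition weight :: "('e \<Rightarrow> 'k) \<Rightarrow> ('v, 'e) qpath \<Rightarrow> 'k" where
  "weight c p = sum_list (map c (fst (snd p)))"

lemma weight_qcomp: "weight c (qcomp p q) = weight c p + weight c q"
  by (cases p; cases q; simp add: weight_def)

text \<open>The Euler derivation of the grading in which the arrow \<open>e\<close> has degree
  \<open>c e\<close>. Monomial relations are homogeneous for every choice of degrees, so the Leibniz
  rule holds in the quotient.\<close>

definition weight_derivation :: "('e \<Rightarrow> 'k) \<Rightarrow> 'a \<Rightarrow> 'a" where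
  "weight_derivation c a = (\<Oplus>p\<in>P. (weight c p * coef p a) \<odot> \<pi> p)"

lemma klin_weight_derivation: "weight_derivation c \<in> module_hom class_ring A A"
proof (rule klinI)
  have cl: "(\<lambda>p. d p \<odot> \<pi> p) \<in> P \<rightarrow> carrier A" for d
    using P_closed by auto
  fix a b :: 'a and d :: 'k assume a: "a \<in> carrier A"
  show "weight_derivation c a \<in> carrier A"
    unfolding weight_derivation_def by (rule finsum_closed[OF cl])
  show "weight_derivation c (d \<odot> a) = d \<odot> weight_derivation c a"
    unfolding weight_derivation_def scale_finsum[OF cl]
    using a P_closed by (intro finsum_cong') (auto simp: coef_scale scale_scale mult.left_commute)
  assume b: "b \<in> carrier A"
  show "weight_derivation c (a \<oplus> b) = weight_derivation c a \<oplus> weight_derivation c b"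
    unfolding weight_derivation_def finsum_addf[OF cl cl, symmetric]
    using a b P_closed by (intro finsum_cong') (auto simp: coef_add distrib_left scale_left_distrib)
qed

lemma weight_derivation_path:
  assumes fin: "finite P" and q: "q \<in> qpaths Q"
  shows "weight_derivation c (\<pi> q) = weight c q \<odot> \<pi> q"
proof (cases "q \<in> P")
  case True
  have "weight_derivation c (\<pi> q) = (\<Oplus>p\<in>P. if q = p then weight c p \<odot> \<pi> p else \<zero>)"
    unfolding weight_derivation_def using q P_closed
    by (intro finsum_cong') (auto simp: coef_qpath scale_zero_left)
  also have "\<dots> = weight c q \<odot> \<pi> q"
    using P_closed by (intro add.finprod_singleton[OF True fin]) auto
  finally show ?thesis .
next
  case False
  then show ?thesis
    using path_zero[OF q] klin_zero[OF kspace_axioms kspace_axioms klin_weight_derivation]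
    by (simp add: scale_zero_right)
qed

lemma derivation_weight_derivation:
  assumes fin: "finite P"
  shows "derivation (weight_derivation c)"
  unfolding derivation_def
proof (intro conjI ballI klin_weight_derivation)
  note lin = klin_weight_derivation[of c]
  fix a b assume ab: "a \<in> carrier A" "b \<in> carrier A"
  show "weight_derivation c (a \<otimes> b) = weight_derivation c a \<otimes> b \<oplus> a \<otimes> weight_derivation c b"
  proof (rule bilinear_eqI[OF fin kspace_axioms _ _ _ _ _ ab])
    fix p q assume "p \<in> P" "q \<in> P"
    then have pq: "p \<in> qpaths Q" "q \<in> qpaths Q" and cl: "\<pi> p \<in> carrier A" "\<pi> q \<in> carrier A"
      using P_qpaths P_closed by blast+
    show "weight_derivation c (\<pi> p \<otimes> \<pi> q) = weight_derivation c (\<pi> p) \<otimes> \<pi> q \<oplus> \<pi> p \<otimes> weight_derivation c (\<pi> q)"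
    proof (cases "qtarget p = qsource q")
      case True
      have comp: "qcomp p q \<in> qpaths Q"
        using Q.qcomp_in_qpaths pq True by blast
      show ?thesis
        using pq cl True comp path_closed[OF comp] path_mult[OF pq]
        by (simp add: weight_derivation_path[OF fin] weight_qcomp scale_mult_left scale_mult_right
            scale_left_distrib)
    next
      case False
      then show ?thesis
        using pq cl path_mult[OF pq] klin_zero[OF kspace_axioms kspace_axioms lin]
        by (simp add: weight_derivation_path[OF fin] scale_mult_left scale_mult_right scale_zero_right)
    qed
  qed (auto intro!: klin_plus klin_compose[OF klin_lmult lin] klin_compose[OF klin_rmult lin]
      klin_compose[OF lin klin_lmult] klin_compose[OF lin klin_rmult] klin_lmult klin_rmult
      kspace_axioms klin_closed[OF lin])
qed

text \<open>A product \<open>p q\<close> of paths equals \<open>p\<close> only if \<open>q\<close>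
  is the trivial path at the target of \<open>p\<close>.\<close>

lemma coef_mult_left:
  assumes fin: "finite P" and p: "p \<in> P" and a: "a \<in> carrier A"
  shows "coef p (\<pi> p \<otimes> a) = coef (qtarget p, [], qtarget p) a"
proof -
  have pQ: "p \<in> qpaths Q" using p P_qpaths by blast
  have t: "(qtarget p, [], qtarget p) \<in> P"
    by (rule triv_P[OF Q.qtarget_in_verts[OF pQ]])
  have f: "(\<lambda>a. coef p (\<pi> p \<otimes> a)) \<in> module_hom class_ring A ground_space"
    by (rule klin_compose[OF klin_lmult[OF P_closed[OF p]] coef_linear[OF p]])
  show ?thesis
  proof (rule linear_eqI[OF fin kspace_ground f coef_linear[OF t] _ a])
  fix q assume q: "q \<in> P"
  then have qQ: "q \<in> qpaths Q" using P_qpaths by blast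
  show "coef p (\<pi> p \<otimes> \<pi> q) = coef (qtarget p, [], qtarget p) (\<pi> q)"
  proof (cases "qtarget p = qsource q")
    case True
    then have "p = qcomp p q \<longleftrightarrow> (qtarget p, [], qtarget p) = q"
      by (cases p; cases q) auto
    then show ?thesis
      using True path_mult[OF pQ qQ] coef_qpath[OF p Q.qcomp_in_qpaths[OF pQ qQ True]] coef_qpath[OF t qQ] by simp
  next
    case False
    then have "(qtarget p, [], qtarget p) \<noteq> q" by auto
    then show ?thesis
      using False path_mult[OF pQ qQ] coef_qpath[OF t qQ] coef_zero[OF p] by simp
  qed
  qed
qed

lemma coef_mult_right:
  assumes fin: "finite P" and p: "p \<in> P" and a: "a \<in> carrier A"
  shows "coef p (a \<otimes> \<pi> p) = coef (qsource p, [], qsource p) a"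
proof -
  have pQ: "p \<in> qpaths Q" using p P_qpaths by blast
  have t: "(qsource p, [], qsource p) \<in> P"
    by (rule triv_P[OF Q.qsource_in_verts[OF pQ]])
  have f: "(\<lambda>a. coef p (a \<otimes> \<pi> p)) \<in> module_hom class_ring A ground_space"
    by (rule klin_compose[OF klin_rmult[OF P_closed[OF p]] coef_linear[OF p]])
  show ?thesis
  proof (rule linear_eqI[OF fin kspace_ground f coef_linear[OF t] _ a])
  fix q assume q: "q \<in> P"
  then have qQ: "q \<in> qpaths Q" using P_qpaths by blast
  show "coef p (\<pi> q \<otimes> \<pi> p) = coef (qsource p, [], qsource p) (\<pi> q)"
  proof (cases "qtarget q = qsource p")
    case True
    then have "p = qcomp q p \<longleftrightarrow> (qsource p, [], qsource p) = q"
      by (cases p; cases q) auto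
    then show ?thesis
      using True path_mult[OF qQ pQ] coef_qpath[OF p Q.qcomp_in_qpaths[OF qQ pQ True]] coef_qpath[OF t qQ] by simp
  next
    case False
    then have "(qsource p, [], qsource p) \<noteq> q" by auto
    then show ?thesis
      using False path_mult[OF qQ pQ] coef_qpath[OF t qQ] coef_zero[OF p] by simp
  qed
  qed
qed

theorem tree_if_HH1_trivial:
  assumes fin: "finite P" and conn: "Digraph_Component.connected Q"
    and HH1: "carrier (HH1 A) = {\<zero>\<^bsub>HH1 A\<^esub>}"
  shows "nomulti_digraph Q \<and> underlying_tree Q"
proof -
  have pot: "\<exists>x. \<forall>e\<in>arcs Q. c e = x (head Q e) - x (tail Q e)" for c :: "'e \<Rightarrow> 'k"
  proof -
    have "inner (weight_derivation c)"
      using HH1 derivation_weight_derivation[OF fin] unfolding HH1_trivial_iff by blast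
    then obtain X where X: "X \<in> carrier A"
      and eq: "\<And>a. a \<in> carrier A \<Longrightarrow> weight_derivation c a = a \<otimes> X \<ominus> X \<otimes> a"
      by (auto simp: inner_def)
    \<comment> \<open>The potential is read off from the coefficients of \<open>X\<close> at the
      trivial paths: the coefficient of the arrow \<open>e\<close> in \<open>e X - X e\<close> is
      the difference of those at its head and at its tail.\<close>
    show ?thesis
    proof (intro exI[of _ "\<lambda>v. coef (v, [], v) X"] ballI)
      fix e assume e: "e \<in> arcs Q"
      let ?p = "(tail Q e, [e], head Q e)"
      have p: "?p \<in> P" "?p \<in> qpaths Q" "\<pi> ?p \<in> carrier A"
        using arc_P[OF e] P_qpaths P_closed by auto
      have "c e = coef ?p (weight_derivation c (\<pi> ?p))"
        using p coef_scale[OF p(1) p(3)] coef_qpath[OF p(1,2)]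
        by (simp add: weight_derivation_path[OF fin] weight_def)
      also have "\<dots> = coef ?p (\<pi> ?p \<otimes> X \<oplus> (- 1) \<odot> (X \<otimes> \<pi> ?p))"
        using p X by (simp add: eq a_minus_def minus_one_scale)
      also have "\<dots> = coef (head Q e, [], head Q e) X - coef (tail Q e, [], tail Q e) X"
        using p X coef_mult_left[OF fin p(1) X] coef_mult_right[OF fin p(1) X]
        by (simp add: coef_add coef_scale)
      finally show "c e = coef (head Q e, [], head Q e) X - coef (tail Q e, [], tail Q e) X" .
    qed
  qed
  show ?thesis
    by (intro conjI Q.underlying_treeI[OF conn pot])
qed

end


section \<open>Derivations of the trivial extension of a tree algebra\<close>

context kalgebra
begin

lemma dclass_minus_inner:
  assumes D: "derivation D" and s: "s \<in> carrier A"
  shows "dclass (\<lambda>a. D a \<ominus> (a \<otimes> s \<ominus> s \<otimes> a)) = dclass D"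
proof -
  interpret H: kspace "HH1 A" by (rule kspace_HH1)
  let ?I = "\<lambda>a. a \<otimes> s \<ominus> s \<otimes> a"
  note dI = derivation_inner[OF s]
  have "dclass (\<lambda>a. D a \<ominus> ?I a) = dclass (\<lambda>a. D a \<oplus> (- 1) \<odot> ?I a)"
    using s derivation_closed[OF D]
    by (intro dclass_cong derivation_minus_inner derivation_add derivation_scale D dI)
      (simp_all add: a_minus_def[of A "D _"] minus_one_scale)
  also have "\<dots> = dclass D \<oplus>\<^bsub>HH1 A\<^esub> (- 1) \<odot>\<^bsub>HH1 A\<^esub> dclass ?I"
    by (simp add: dclass_add[OF D derivation_scale[OF dI]] dclass_scale[OF dI])
  also have "dclass ?I = \<zero>\<^bsub>HH1 A\<^esub>"
    using dclass_eq_zero_iff[OF dI] s by (auto simp: inner_def)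
  finally show ?thesis
    using dclass_closed[OF D] by (simp add: H.scale_zero_right)
qed

text \<open>The two embeddings \<open>incl\<close> and \<open>kap\<close> exhibit \<open>A\<close>
  as a subalgebra and \<open>DA\<close> as an ideal of square zero.\<close>

definition incl :: "'a \<Rightarrow> 'a \<times> ('a \<Rightarrow> 'k)" where
  "incl a = (a, \<lambda>x\<in>carrier A. 0)"

definition kap :: "('a \<Rightarrow> 'k) \<Rightarrow> 'a \<times> ('a \<Rightarrow> 'k)" where
  "kap f = (\<zero>, f)"

lemma incl_closed: "a \<in> carrier A \<Longrightarrow> incl a \<in> carrier TE"
  using Dual_zero_fun by (simp add: incl_def TE_simps(1) del: Int_iff)

lemma kap_closed: "f \<in> Dual \<Longrightarrow> kap f \<in> carrier TE"
  by (simp add: kap_def TE_simps(1) del: Int_iff)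

lemma klin_incl: "incl \<in> module_hom class_ring A TE"
  by (rule klinI) (simp_all add: incl_closed, simp_all add: incl_def TE_simps cong: restrict_cong)

lemma incl_mult: "a \<in> carrier A \<Longrightarrow> b \<in> carrier A \<Longrightarrow> incl a \<otimes>\<^bsub>TE\<^esub> incl b = incl (a \<otimes> b)"
  unfolding incl_def by (simp add: TE_mult Dual_zero_fun del: Int_iff cong: restrict_cong)

lemma incl_kap:
  "a \<in> carrier A \<Longrightarrow> f \<in> Dual \<Longrightarrow> incl a \<otimes>\<^bsub>TE\<^esub> kap f = kap (\<lambda>x\<in>carrier A. f (x \<otimes> a))"
  unfolding incl_def kap_def by (simp add: TE_mult Dual_zero_fun del: Int_iff cong: restrict_cong)

lemma kap_incl:
  "a \<in> carrier A \<Longrightarrow> f \<in> Dual \<Longrightarrow> kap f \<otimes>\<^bsub>TE\<^esub> incl a = kap (\<lambda>x\<in>carrier A. f (a \<otimes> x))"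
  unfolding incl_def kap_def by (simp add: TE_mult Dual_zero_fun del: Int_iff cong: restrict_cong)

lemma kap_kap: "f \<in> Dual \<Longrightarrow> g \<in> Dual \<Longrightarrow> kap f \<otimes>\<^bsub>TE\<^esub> kap g = \<zero>\<^bsub>TE\<^esub>"
  unfolding kap_def by (simp add: TE_mult TE_simps Dual_zero del: Int_iff cong: restrict_cong)

lemma kap_scale: "c \<odot>\<^bsub>TE\<^esub> kap f = kap (\<lambda>x\<in>carrier A. c * f x)"
  by (simp add: kap_def TE_simps scale_zero_right)

lemma incl_plus_kap:
  assumes "a \<in> carrier A" "f \<in> Dual"
  shows "(a, f) = incl a \<oplus>\<^bsub>TE\<^esub> kap f"
  using assms by (auto simp: incl_def kap_def TE_simps intro!: extensionalityI[of _ "carrier A"])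

lemma finsum_kap:
  assumes "finite S" "\<And>p. p \<in> S \<Longrightarrow> g p \<in> Dual"
  shows "(\<Oplus>\<^bsub>TE\<^esub>p\<in>S. c p \<odot>\<^bsub>TE\<^esub> kap (g p)) = kap (\<lambda>x\<in>carrier A. \<Sum>p\<in>S. c p * g p x)"
proof -
  interpret T: kspace TE by (rule kspace_TE)
  show ?thesis
    using assms
  proof (induction S)
    case empty
    show ?case by (simp add: kap_def TE_simps restrict_def)
  next
    case (insert q S)
    have cl: "c p \<odot>\<^bsub>TE\<^esub> kap (g p) \<in> carrier TE" if "p \<in> insert q S" for p
      by (rule T.scale_closed[OF kap_closed[OF insert.prems[OF that]]])
    have "(\<Oplus>\<^bsub>TE\<^esub>p\<in>insert q S. c p \<odot>\<^bsub>TE\<^esub> kap (g p))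
        = c q \<odot>\<^bsub>TE\<^esub> kap (g q) \<oplus>\<^bsub>TE\<^esub> (\<Oplus>\<^bsub>TE\<^esub>p\<in>S. c p \<odot>\<^bsub>TE\<^esub> kap (g p))"
      using insert.hyps cl by (intro T.finsum_insert) auto
    also have "(\<Oplus>\<^bsub>TE\<^esub>p\<in>S. c p \<odot>\<^bsub>TE\<^esub> kap (g p)) = kap (\<lambda>x\<in>carrier A. \<Sum>p\<in>S. c p * g p x)"
      using insert by blast
    finally show ?case
      using insert.hyps by (simp add: kap_def TE_simps scale_zero_right restrict_def fun_eq_iff)
  qed
qed

end

context path_basis
begin

text \<open>The basis of \<open>DA\<close> dual to the paths, restricted because elements of
  \<open>Dual\<close> are extensional.\<close>

abbreviation \<rho> :: "('v, 'e) qpath \<Rightarrow> 'a \<Rightarrow> 'k" where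
  "\<rho> p \<equiv> restrict (coef p) (carrier A)"

lemma \<rho>_Dual: "p \<in> P \<Longrightarrow> \<rho> p \<in> Dual"
  by (rule DualI) (simp_all add: coef_add coef_scale)

lemma dual_separates: "dual_separates"
  unfolding dual_separates_def
proof (intro ballI impI)
  fix a assume a: "a \<in> carrier A" and 0: "\<forall>f\<in>Dual. f a = 0"
  show "a = \<zero>"
  proof (rule coef_eqI[OF a])
    fix p assume "p \<in> P"
    then have "\<rho> p a = 0"
      by (rule bspec[OF 0 \<rho>_Dual])
    then show "coef p a = 0"
      using a by simp
  qed
qed

lemma one_neq_zero:
  assumes "Digraph_Component.connected Q"
  shows "\<one> \<noteq> \<zero>"
proof
  assume 0: "\<one> = \<zero>"
  obtain r where r: "r \<in> verts Q"
    using assms by (auto simp: connected_conv)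
  let ?t = "(r, [], r)"
  have t: "?t \<in> P" and cl: "\<pi> ?t \<in> carrier A"
    using triv_P[OF r] P_closed by simp_all
  have "\<pi> ?t = \<zero>"
    using r_one[OF cl] r_null[OF cl] unfolding 0 by simp
  then show False
    using coef_path[OF t t] coef_zero[OF t] by simp
qed

end

locale tree_path_basis = path_basis A Q P \<pi> coef
  for A :: "('k::field, 'a, 'z) module_scheme" (structure)
    and Q :: "('v, 'e) pre_digraph" and P \<pi> coef +
  assumes finP: "finite P" and conn: "Digraph_Component.connected Q" and tree: "underlying_tree Q"
    and nontriv: "(2::'k) \<noteq> 0 \<or> arcs Q \<noteq> {}"
begin

interpretation T: kalgebra TE
  by (rule kalgebra_TE)

abbreviation tr :: "'v \<Rightarrow> ('v, 'e) qpath" where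
  "tr v \<equiv> (v, [], v)"

abbreviation ev :: "'v \<Rightarrow> 'a \<times> ('a \<Rightarrow> 'k)" where
  "ev v \<equiv> incl (\<pi> (tr v))"

lemma P_in_qpaths: "p \<in> P \<Longrightarrow> p \<in> qpaths Q"
  using P_qpaths by blast

lemma source_vert: "p \<in> P \<Longrightarrow> qsource p \<in> verts Q"
  and target_vert: "p \<in> P \<Longrightarrow> qtarget p \<in> verts Q"
  using Q.qsource_in_verts Q.qtarget_in_verts P_in_qpaths by blast+

lemma tr_closed: "v \<in> verts Q \<Longrightarrow> \<pi> (tr v) \<in> carrier A"
  by (rule P_closed[OF triv_P])

lemma ev_closed: "v \<in> verts Q \<Longrightarrow> ev v \<in> carrier TE"
  by (rule incl_closed[OF tr_closed])

section \<open>Corners of the trivial extension of a tree algebra\<close>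

lemma path_unique:
  assumes "p \<in> P" "q \<in> P" "qsource p = qsource q" "qtarget p = qtarget q"
  shows "p = q"
proof -
  obtain u xs v where p: "p = (u, xs, v)" by (cases p)
  obtain ys where q: "q = (u, ys, v)" using assms p by (cases q) auto
  have "Q.awalk u xs v" "Q.awalk u ys v"
    using P_in_qpaths[OF assms(1)] P_in_qpaths[OF assms(2)] by (simp_all add: p q qpaths_def)
  then have "xs = ys"
    by (rule Q.tree_walk_unique[OF conn tree])
  then show ?thesis by (simp add: p q)
qed

text \<open>The composite of \<open>p\<close> and \<open>q\<close> is a closed walk, hence empty. So
  between distinct vertices \<open>A\<close> and \<open>DA\<close> never contribute to the same
  corner.\<close>

lemma no_return:
  assumes "p \<in> P" "q \<in> P" "qsource q = qtarget p" "qtarget q = qsource p"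
  shows "p = tr (qsource p)"
proof -
  obtain u xs v where p: "p = (u, xs, v)" by (cases p)
  obtain ys where q: "q = (v, ys, u)" using assms p by (cases q) auto
  have "Q.awalk u xs v" "Q.awalk v ys u"
    using P_in_qpaths[OF assms(1)] P_in_qpaths[OF assms(2)] by (simp_all add: p q qpaths_def)
  then have "Q.awalk u (xs @ ys) u"
    by (rule Q.awalk_appendI)
  then have "xs = []"
    using Q.tree_closed_walk[OF conn tree] by blast
  then show ?thesis
    using \<open>Q.awalk u xs v\<close> by (simp add: p Q.awalk_Nil_iff)
qed

lemma corner_path:
  assumes "i \<in> verts Q" "j \<in> verts Q" "q \<in> qpaths Q"
  shows "\<pi> (tr i) \<otimes> \<pi> q \<otimes> \<pi> (tr j) = (if qsource q = i \<and> qtarget q = j then \<pi> q else \<zero>)"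
proof -
  have ij: "tr i \<in> qpaths Q" "tr j \<in> qpaths Q"
    using assms Q.triv_in_qpaths by auto
  have "\<pi> (tr i) \<otimes> \<pi> q = (if qsource q = i then \<pi> q else \<zero>)"
    using path_mult[OF ij(1) assms(3)] by auto
  moreover have "\<pi> q \<otimes> \<pi> (tr j) = (if qtarget q = j then \<pi> q else \<zero>)"
    using path_mult[OF assms(3) ij(2)] by auto
  ultimately show ?thesis
    using path_closed[OF ij(2)] by auto
qed

lemma coef_corner:
  assumes ij: "i \<in> verts Q" "j \<in> verts Q" and p: "p \<in> P" and a: "a \<in> carrier A"
  shows "coef p (\<pi> (tr i) \<otimes> a \<otimes> \<pi> (tr j)) = (if qsource p = i \<and> qtarget p = j then coef p a else 0)"
proof -
  let ?b = "if qsource p = i \<and> qtarget p = j then 1 else 0 :: 'k"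
  have f: "(\<lambda>a. coef p (\<pi> (tr i) \<otimes> a \<otimes> \<pi> (tr j))) \<in> module_hom class_ring A ground_space"
    using tr_closed ij p
    by (intro klin_compose[OF klin_compose[OF klin_lmult klin_rmult] coef_linear])
  have g: "(\<lambda>a. ?b \<odot>\<^bsub>ground_space\<^esub> coef p a) \<in> module_hom class_ring A ground_space"
    by (intro klin_smult kspace_axioms kspace_ground coef_linear p)
  have "coef p (\<pi> (tr i) \<otimes> a \<otimes> \<pi> (tr j)) = ?b \<odot>\<^bsub>ground_space\<^esub> coef p a"
  proof (rule linear_eqI[OF finP kspace_ground f g _ a])
    fix q assume q: "q \<in> P"
    show "coef p (\<pi> (tr i) \<otimes> \<pi> q \<otimes> \<pi> (tr j)) = ?b \<odot>\<^bsub>ground_space\<^esub> coef p (\<pi> q)"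
      using corner_path[OF ij P_in_qpaths[OF q]] coef_path[OF p q] coef_zero[OF p] by (cases "p = q") auto
  qed
  then show ?thesis by auto
qed

lemma corner_TE:
  assumes "i \<in> verts Q" "j \<in> verts Q" "a \<in> carrier A" "f \<in> Dual"
  shows "ev i \<otimes>\<^bsub>TE\<^esub> (a, f) \<otimes>\<^bsub>TE\<^esub> ev j
    = (\<pi> (tr i) \<otimes> a \<otimes> \<pi> (tr j), \<lambda>x\<in>carrier A. f (\<pi> (tr j) \<otimes> x \<otimes> \<pi> (tr i)))"
  unfolding incl_def using assms tr_closed[of i] tr_closed[of j]
  by (simp add: TE_mult Dual_mult Dual_zero_fun Dual_compose[OF assms(4) klin_rmult] del: Int_iff
      cong: restrict_cong)

text \<open>The corner from \<open>i\<close> to \<open>j\<close> is spanned by the paths from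
  \<open>i\<close> to \<open>j\<close> and by the duals of the paths from \<open>j\<close> to
  \<open>i\<close>, as dualising reverses the ends.\<close>

lemma corner_components:
  assumes ij: "i \<in> verts Q" "j \<in> verts Q" and u: "u \<in> carrier TE"
    and eq: "u = ev i \<otimes>\<^bsub>TE\<^esub> u \<otimes>\<^bsub>TE\<^esub> ev j" and p: "p \<in> P"
  shows "coef p (fst u) \<noteq> 0 \<Longrightarrow> qsource p = i \<and> qtarget p = j"
    and "snd u (\<pi> p) \<noteq> 0 \<Longrightarrow> qsource p = j \<and> qtarget p = i"
proof -
  obtain a f where a: "a \<in> carrier A" and f: "f \<in> Dual" and u: "u = (a, f)"
    using u by (rule TE_E)
  have eqs: "a = \<pi> (tr i) \<otimes> a \<otimes> \<pi> (tr j)" "f = (\<lambda>x\<in>carrier A. f (\<pi> (tr j) \<otimes> x \<otimes> \<pi> (tr i)))"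
    using eq unfolding u corner_TE[OF ij a f] by simp_all
  show "qsource p = i \<and> qtarget p = j" if nz: "coef p (fst u) \<noteq> 0"
    using nz coef_corner[OF ij p a] eqs(1) by (cases "qsource p = i \<and> qtarget p = j") (auto simp: u)
  show "qsource p = j \<and> qtarget p = i" if nz: "snd u (\<pi> p) \<noteq> 0"
  proof -
    have "f (\<pi> p) = f (\<pi> (tr j) \<otimes> \<pi> p \<otimes> \<pi> (tr i))"
      using fun_cong[OF eqs(2), of "\<pi> p"] P_closed[OF p] by simp
    then show ?thesis
      using nz corner_path[OF ij(2,1) P_in_qpaths[OF p]] Dual_zero[OF f]
      by (cases "qsource p = j \<and> qtarget p = i") (auto simp: u)
  qed
qed

lemma A_eqI:
  assumes "a \<in> carrier A" "b \<in> carrier A" "\<And>p. p \<in> P \<Longrightarrow> coef p a = coef p b"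
  shows "a = b"
proof -
  have "a \<ominus> b = \<zero>"
    using assms by (intro coef_eqI) (auto simp: coef_diff)
  then show ?thesis using assms by simp
qed

lemma Dual_eqI:
  assumes "f \<in> Dual" "g \<in> Dual" "\<And>p. p \<in> P \<Longrightarrow> f (\<pi> p) = g (\<pi> p)"
  shows "f = g"
  by (rule Dual_ext[OF assms(1,2)], rule linear_eqI[OF finP kspace_ground]) (use assms in auto)

text \<open>A derivation that kills the vertices commutes with multiplication by them from either
  side.\<close>

lemma derivation_corner:
  assumes D: "T.derivation D" and 0: "\<And>v. v \<in> verts Q \<Longrightarrow> D (ev v) = \<zero>\<^bsub>TE\<^esub>"
    and ij: "i \<in> verts Q" "j \<in> verts Q" and u: "u \<in> carrier TE" "u = ev i \<otimes>\<^bsub>TE\<^esub> u \<otimes>\<^bsub>TE\<^esub> ev j"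
  shows "D u = ev i \<otimes>\<^bsub>TE\<^esub> D u \<otimes>\<^bsub>TE\<^esub> ev j"
proof -
  have "D u = D (ev i \<otimes>\<^bsub>TE\<^esub> u \<otimes>\<^bsub>TE\<^esub> ev j)"
    using u(2) by simp
  also have "\<dots> = ev i \<otimes>\<^bsub>TE\<^esub> D u \<otimes>\<^bsub>TE\<^esub> ev j"
    using u(1) ij ev_closed T.derivation_closed[OF D]
    by (simp add: T.derivation_mult[OF D] 0)
  finally show ?thesis .
qed

lemma one_TE: "\<one>\<^bsub>TE\<^esub> = (\<Oplus>\<^bsub>TE\<^esub>v\<in>verts Q. ev v)"
proof -
  have "\<one>\<^bsub>TE\<^esub> = incl (\<Oplus>v\<in>verts Q. \<pi> (tr v))"
    by (simp add: TE_simps incl_def flip: one_eq)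
  also have "\<dots> = (\<Oplus>\<^bsub>TE\<^esub>v\<in>verts Q. ev v)"
    by (rule klin_finsum[OF kspace_axioms kspace_TE klin_incl]) (use tr_closed in auto)
  finally show ?thesis .
qed

lemma ev_orthogonal:
  assumes "v \<in> verts Q" "w \<in> verts Q"
  shows "ev v \<otimes>\<^bsub>TE\<^esub> ev w = (if v = w then ev v else \<zero>\<^bsub>TE\<^esub>)"
  using path_mult[of "tr v" "tr w"] Q.triv_in_qpaths assms tr_closed
  by (auto simp: incl_mult klin_zero[OF kspace_axioms kspace_TE klin_incl])

section \<open>Derivations restricted to the copy of the algebra\<close>

definition diag :: "('v \<Rightarrow> 'k) \<Rightarrow> 'a" where
  "diag x = (\<Oplus>v\<in>verts Q. x v \<odot> \<pi> (tr v))"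

lemma diag_closed: "diag x \<in> carrier A"
  unfolding diag_def using tr_closed by (intro finsum_closed) auto

lemma diag_mult:
  assumes p: "p \<in> P"
  shows "\<pi> p \<otimes> diag x = x (qtarget p) \<odot> \<pi> p" "diag x \<otimes> \<pi> p = x (qsource p) \<odot> \<pi> p"
proof -
  have pQ: "p \<in> qpaths Q" and cl: "\<pi> p \<in> carrier A"
    using p P_in_qpaths P_closed by auto
  have "\<pi> p \<otimes> diag x = (\<Oplus>v\<in>verts Q. \<pi> p \<otimes> (x v \<odot> \<pi> (tr v)))"
    unfolding diag_def using cl tr_closed by (intro finsum_rdistr) auto
  also have "\<dots> = (\<Oplus>v\<in>verts Q. if qtarget p = v then x v \<odot> \<pi> p else \<zero>)"
    using cl tr_closed Q.triv_in_qpaths path_mult[OF pQ]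
    by (intro finsum_cong') (auto simp: scale_mult_right scale_zero_right)
  also have "\<dots> = x (qtarget p) \<odot> \<pi> p"
    using cl target_vert[OF p] by (intro add.finprod_singleton) auto
  finally show "\<pi> p \<otimes> diag x = x (qtarget p) \<odot> \<pi> p" .
  have "diag x \<otimes> \<pi> p = (\<Oplus>v\<in>verts Q. (x v \<odot> \<pi> (tr v)) \<otimes> \<pi> p)"
    unfolding diag_def using cl tr_closed by (intro finsum_ldistr) auto
  also have "\<dots> = (\<Oplus>v\<in>verts Q. if qsource p = v then x v \<odot> \<pi> p else \<zero>)"
    using cl tr_closed Q.triv_in_qpaths path_mult[OF _ pQ]
    by (intro finsum_cong') (auto simp: scale_mult_left scale_zero_right)
  also have "\<dots> = x (qsource p) \<odot> \<pi> p"
    using cl source_vert[OF p] by (intro add.finprod_singleton) auto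
  finally show "diag x \<otimes> \<pi> p = x (qsource p) \<odot> \<pi> p" .
qed

text \<open>The inner derivation of a diagonal element multiplies each path by the increment of the
  potential \<open>x\<close>; this is how a potential removes weights on arrows.\<close>

lemma incl_commutator_diag:
  assumes p: "p \<in> P"
  shows "incl (\<pi> p) \<otimes>\<^bsub>TE\<^esub> incl (diag x) \<ominus>\<^bsub>TE\<^esub> incl (diag x) \<otimes>\<^bsub>TE\<^esub> incl (\<pi> p)
    = (x (qtarget p) - x (qsource p)) \<odot>\<^bsub>TE\<^esub> incl (\<pi> p)"
  using P_closed[OF p] diag_closed incl_closed[OF P_closed[OF p]]
  by (simp add: incl_mult diag_mult[OF p] klin_scale[OF klin_incl] T.scale_diff_left)

lemma incl_corner: "p \<in> P \<Longrightarrow> incl (\<pi> p) = ev (qsource p) \<otimes>\<^bsub>TE\<^esub> incl (\<pi> p) \<otimes>\<^bsub>TE\<^esub> ev (qtarget p)"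
  using P_closed tr_closed source_vert target_vert corner_path[OF source_vert target_vert P_in_qpaths, of p p p]
  by (simp add: incl_mult)

text \<open>The value lies in the same corner as \<open>p\<close>. By \<open>path_unique\<close> the
  part of this corner in \<open>A\<close> is the line of \<open>p\<close>, and by
  \<open>no_return\<close> the part in \<open>DA\<close> is zero.\<close>

lemma derivation_arc:
  assumes D: "T.derivation D" and 0: "\<And>v. v \<in> verts Q \<Longrightarrow> D (ev v) = \<zero>\<^bsub>TE\<^esub>"
    and p: "p \<in> P" and ne: "qsource p \<noteq> qtarget p"
  shows "D (incl (\<pi> p)) = coef p (fst (D (incl (\<pi> p)))) \<odot>\<^bsub>TE\<^esub> incl (\<pi> p)"
proof -
  let ?u = "D (incl (\<pi> p))"
  have u: "?u \<in> carrier TE"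
    using T.derivation_closed[OF D] incl_closed P_closed[OF p] by blast
  have "?u = ev (qsource p) \<otimes>\<^bsub>TE\<^esub> ?u \<otimes>\<^bsub>TE\<^esub> ev (qtarget p)"
    by (rule derivation_corner[OF D])
      (use 0 source_vert[OF p] target_vert[OF p] incl_closed[OF P_closed[OF p]] incl_corner[OF p] in simp_all)
  note corner = corner_components[OF source_vert[OF p] target_vert[OF p] u this]
  obtain a f where a: "a \<in> carrier A" and f: "f \<in> Dual" and af: "?u = (a, f)"
    using u by (rule TE_E)
  have "a = coef p a \<odot> \<pi> p"
  proof (rule A_eqI[OF a])
    fix q assume q: "q \<in> P"
    have "coef q a = 0" if "q \<noteq> p"
    proof (rule ccontr)
      assume "coef q a \<noteq> 0"
      then have "qsource q = qsource p \<and> qtarget q = qtarget p"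
        by (intro corner(1)[OF q]) (simp add: af)
      then show False
        using path_unique[OF p q] that by simp
    qed
    then show "coef q a = coef q (coef p a \<odot> \<pi> p)"
      using p q P_closed[OF p] by (cases "q = p") (auto simp: coef_scale coef_path)
  qed (use P_closed[OF p] in auto)
  moreover have "f = (\<lambda>x\<in>carrier A. 0)"
  proof (rule Dual_eqI[OF f Dual_zero_fun])
    fix q assume q: "q \<in> P"
    have "p = tr (qsource p)" if nz: "f (\<pi> q) \<noteq> 0"
    proof -
      have "qsource q = qtarget p \<and> qtarget q = qsource p"
        by (rule corner(2)[OF q]) (simp add: af nz)
      then show ?thesis
        by (intro no_return[OF p q]) auto
    qed
    moreover have "p \<noteq> tr (qsource p)"
      using ne by (metis qtarget.simps)
    ultimately show "f (\<pi> q) = (\<lambda>x\<in>carrier A. 0) (\<pi> q)"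
      using P_closed[OF q] by auto
  qed
  ultimately show ?thesis
    using klin_scale[OF klin_incl P_closed[OF p], of "coef p a"] by (simp add: af) (simp add: incl_def)
qed

lemma arc_ends_neq:
  assumes e: "e \<in> arcs Q"
  shows "tail Q e \<noteq> head Q e"
proof
  assume "tail Q e = head Q e"
  then have "Q.awalk (tail Q e) [e] (tail Q e)"
    using e by (simp add: Q.awalk_Cons_iff Q.awalk_Nil_iff)
  then show False
    using Q.tree_closed_walk[OF conn tree] by blast
qed

lemma derivation_incl_inner:
  assumes D: "T.derivation D"
  obtains s where "s \<in> carrier TE"
    "\<And>a. a \<in> carrier A \<Longrightarrow> D (incl a) = incl a \<otimes>\<^bsub>TE\<^esub> s \<ominus>\<^bsub>TE\<^esub> s \<otimes>\<^bsub>TE\<^esub> incl a"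
proof -
  obtain s where s: "s \<in> carrier TE"
    and Ds: "\<And>v. v \<in> verts Q \<Longrightarrow> D (ev v) = ev v \<otimes>\<^bsub>TE\<^esub> s \<ominus>\<^bsub>TE\<^esub> s \<otimes>\<^bsub>TE\<^esub> ev v"
    using T.derivation_idempotents[OF D Q.finite_verts ev_closed ev_orthogonal one_TE] by blast
  define D1 where "D1 = (\<lambda>u. D u \<ominus>\<^bsub>TE\<^esub> (u \<otimes>\<^bsub>TE\<^esub> s \<ominus>\<^bsub>TE\<^esub> s \<otimes>\<^bsub>TE\<^esub> u))"
  have D1: "T.derivation D1"
    unfolding D1_def by (rule T.derivation_minus_inner[OF D s])
  have D1_ev: "D1 (ev v) = \<zero>\<^bsub>TE\<^esub>" if "v \<in> verts Q" for v
    using Ds[OF that] ev_closed[OF that] s by (simp add: D1_def)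
  \<comment> \<open>The scalar by which \<open>D1\<close> multiplies the arrow \<open>e\<close>; the
    inner derivation of the diagonal element of a potential for \<open>c\<close> has the same
    effect.\<close>
  define c where "c e = coef (tail Q e, [e], head Q e) (fst (D1 (incl (\<pi> (tail Q e, [e], head Q e)))))" for e
  obtain x where x: "\<forall>e\<in>arcs Q. c e = x (head Q e) - x (tail Q e)"
    using Q.tree_potential[OF conn tree, of c] by blast
  define X where "X = incl (diag x)"
  have X: "X \<in> carrier TE"
    unfolding X_def by (rule incl_closed[OF diag_closed])
  define D2 where "D2 = (\<lambda>u. D1 u \<ominus>\<^bsub>TE\<^esub> (u \<otimes>\<^bsub>TE\<^esub> X \<ominus>\<^bsub>TE\<^esub> X \<otimes>\<^bsub>TE\<^esub> u))"
  have D2: "T.derivation D2"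
    unfolding D2_def by (rule T.derivation_minus_inner[OF D1 X])
  have D2_ev: "D2 (ev v) = \<zero>\<^bsub>TE\<^esub>" if v: "v \<in> verts Q" for v
  proof -
    have comm: "ev v \<otimes>\<^bsub>TE\<^esub> X \<ominus>\<^bsub>TE\<^esub> X \<otimes>\<^bsub>TE\<^esub> ev v = \<zero>\<^bsub>TE\<^esub>"
      using incl_commutator_diag[OF triv_P[OF v], of x] ev_closed[OF v] by (simp add: X_def T.scale_zero_left)
    show ?thesis
      unfolding D2_def D1_ev[OF v] comm by simp
  qed
  have D2_arc: "D2 (incl (\<pi> (tail Q e, [e], head Q e))) = \<zero>\<^bsub>TE\<^esub>" if e: "e \<in> arcs Q" for e
  proof -
    let ?p = "(tail Q e, [e], head Q e)"
    have "D1 (incl (\<pi> ?p)) = c e \<odot>\<^bsub>TE\<^esub> incl (\<pi> ?p)"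
      using derivation_arc[OF D1 D1_ev arc_P[OF e]] arc_ends_neq[OF e] by (simp add: c_def)
    then show ?thesis
      using incl_commutator_diag[OF arc_P[OF e], of x] incl_closed[OF P_closed[OF arc_P[OF e]]] x e
      by (simp add: D2_def X_def)
  qed
  \<comment> \<open>Vertices and arrows generate the algebra, and a derivation that kills them kills
    all paths.\<close>
  have D2_path: "D2 (incl (\<pi> (u, es, v))) = \<zero>\<^bsub>TE\<^esub>" if "Q.awalk u es v" for u es v
    using that
  proof (induction es arbitrary: u)
    case Nil
    then show ?case using D2_ev by (auto simp: Q.awalk_Nil_iff)
  next
    case (Cons e es)
    then have e: "e \<in> arcs Q" "tail Q e = u" and es: "Q.awalk (head Q e) es v"
      by (simp_all add: Q.awalk_Cons_iff)
    let ?p = "(tail Q e, [e], head Q e)" and ?q = "(head Q e, es, v)"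
    have pq: "?p \<in> qpaths Q" "?q \<in> qpaths Q"
      using Q.arc_in_qpaths[OF e(1)] es by (auto simp: qpaths_def)
    have "incl (\<pi> (u, e # es, v)) = incl (\<pi> ?p) \<otimes>\<^bsub>TE\<^esub> incl (\<pi> ?q)"
      using path_mult[OF pq] path_closed[OF pq(1)] path_closed[OF pq(2)] e(2) by (simp add: incl_mult)
    then show ?case
      using D2_arc[OF e(1)] Cons.IH[OF es] incl_closed[OF path_closed[OF pq(1)]] incl_closed[OF path_closed[OF pq(2)]]
      by (simp add: T.derivation_mult[OF D2])
  qed
  have D2_incl: "D2 (incl a) = \<zero>\<^bsub>TE\<^esub>" if "a \<in> carrier A" for a
  proof (rule linear_eqI[OF finP kspace_TE klin_compose[OF klin_incl T.derivation_linear[OF D2]] _ _ that])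
    show "(\<lambda>_. \<zero>\<^bsub>TE\<^esub>) \<in> module_hom class_ring A TE"
      by (rule klinI) (auto simp: T.scale_zero_right)
    show "D2 (incl (\<pi> p)) = \<zero>\<^bsub>TE\<^esub>" if "p \<in> P" for p
      using D2_path P_in_qpaths[OF that] by (cases p) (auto simp: qpaths_def)
  qed
  show ?thesis
  proof (rule that[of "s \<oplus>\<^bsub>TE\<^esub> X"])
    show "s \<oplus>\<^bsub>TE\<^esub> X \<in> carrier TE"
      using s X by simp
    fix a assume "a \<in> carrier A"
    then have u: "incl a \<in> carrier TE" and Du: "D (incl a) \<in> carrier TE"
      using incl_closed T.derivation_closed[OF D] by auto
    let ?u = "incl a" and ?i = "incl a \<otimes>\<^bsub>TE\<^esub> s \<ominus>\<^bsub>TE\<^esub> s \<otimes>\<^bsub>TE\<^esub> incl a"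
    let ?j = "incl a \<otimes>\<^bsub>TE\<^esub> X \<ominus>\<^bsub>TE\<^esub> X \<otimes>\<^bsub>TE\<^esub> incl a"
    have "D ?u \<ominus>\<^bsub>TE\<^esub> ?i \<ominus>\<^bsub>TE\<^esub> ?j = \<zero>\<^bsub>TE\<^esub>"
      using D2_incl[OF \<open>a \<in> carrier A\<close>] by (simp only: D2_def D1_def)
    then have "D ?u = ?i \<oplus>\<^bsub>TE\<^esub> ?j"
      by (subst (asm) T.diff_eq_iff_add) (use u s X Du in auto)
    then show "D ?u = ?u \<otimes>\<^bsub>TE\<^esub> (s \<oplus>\<^bsub>TE\<^esub> X) \<ominus>\<^bsub>TE\<^esub> (s \<oplus>\<^bsub>TE\<^esub> X) \<otimes>\<^bsub>TE\<^esub> ?u"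
      using u s X by (simp add: T.l_distr T.r_distr T.diff_diff_eq_iff)
  qed
qed

text \<open>The products of a path with its dual are the duals of its end vertices. These equations
  link the scalars of a derivation at a path and at its ends.\<close>

lemma incl_kap_\<rho>:
  assumes p: "p \<in> P"
  shows "incl (\<pi> p) \<otimes>\<^bsub>TE\<^esub> kap (\<rho> p) = kap (\<rho> (tr (qsource p)))"
    and "kap (\<rho> p) \<otimes>\<^bsub>TE\<^esub> incl (\<pi> p) = kap (\<rho> (tr (qtarget p)))"
  using coef_mult_right[OF finP p] coef_mult_left[OF finP p] P_closed[OF p]
  by (simp_all add: incl_kap kap_incl \<rho>_Dual[OF p] del: Int_iff cong: restrict_cong)

lemma kap_corner:
  assumes p: "p \<in> P"
  shows "kap (\<rho> p) = ev (qtarget p) \<otimes>\<^bsub>TE\<^esub> kap (\<rho> p) \<otimes>\<^bsub>TE\<^esub> ev (qsource p)"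
proof -
  have "(\<lambda>x\<in>carrier A. \<rho> p (\<pi> (tr (qsource p)) \<otimes> x \<otimes> \<pi> (tr (qtarget p)))) = \<rho> p"
    using coef_corner[OF source_vert[OF p] target_vert[OF p] p] tr_closed source_vert[OF p] target_vert[OF p]
    by (intro restrict_ext) simp
  then show ?thesis
    unfolding kap_def using corner_TE[OF target_vert[OF p] source_vert[OF p] zero_closed \<rho>_Dual[OF p]]
      tr_closed source_vert[OF p] target_vert[OF p] by simp
qed

text \<open>As \<open>D\<close> kills \<open>A\<close>, the Leibniz rule makes it commute with both
  actions of \<open>A\<close>. So it preserves the corners, and the products of paths with their
  duals force the same scalar on the whole dual basis.\<close>

lemma derivation_zero_on_incl:
  assumes D: "T.derivation D" and D0: "\<And>a. a \<in> carrier A \<Longrightarrow> D (incl a) = \<zero>\<^bsub>TE\<^esub>"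
  shows "\<exists>d. \<forall>u\<in>carrier TE. D u = d \<odot>\<^bsub>TE\<^esub> central_shift \<one> u"
proof -
  define M where "M p = D (kap (\<rho> p))" for p
  note lin = T.derivation_linear[OF D] and Dcl = T.derivation_closed[OF D]
  have kapcl: "kap (\<rho> p) \<in> carrier TE" if "p \<in> P" for p
    by (rule kap_closed[OF \<rho>_Dual[OF that]])
  have Mcl: "M p \<in> carrier TE" if "p \<in> P" for p
    unfolding M_def by (rule Dcl[OF kapcl[OF that]])
  have inclcl: "incl (\<pi> p) \<in> carrier TE" if "p \<in> P" for p
    by (rule incl_closed[OF P_closed[OF that]])
  have Mcorner: "M p = ev (qtarget p) \<otimes>\<^bsub>TE\<^esub> M p \<otimes>\<^bsub>TE\<^esub> ev (qsource p)" if p: "p \<in> P" for p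
    unfolding M_def
    by (rule derivation_corner[OF D])
      (use D0[OF tr_closed] source_vert[OF p] target_vert[OF p] kapcl[OF p] kap_corner[OF p] in simp_all)
  note comp = corner_components[OF target_vert source_vert Mcl Mcorner]
  define \<delta> where "\<delta> p = snd (M p) (\<pi> p)" for p
  have M_snd: "snd (M p) = (\<lambda>x\<in>carrier A. \<delta> p * \<rho> p x)" if p: "p \<in> P" for p
  proof -
    obtain a f where af: "a \<in> carrier A" "f \<in> Dual" "M p = (a, f)"
      using Mcl[OF p] by (rule TE_E)
    have "f = (\<lambda>x\<in>carrier A. \<delta> p * \<rho> p x)"
    proof (rule Dual_eqI[OF af(2) Dual_smult[OF \<rho>_Dual[OF p]]])
      fix q assume q: "q \<in> P"
      have "f (\<pi> q) = 0" if "q \<noteq> p"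
      proof (rule ccontr)
        assume "f (\<pi> q) \<noteq> 0"
        then have "qsource q = qsource p \<and> qtarget q = qtarget p"
          by (intro comp(2)[OF p p p p q]) (simp add: af)
        then show False
          using path_unique[OF p q] that by simp
      qed
      then show "f (\<pi> q) = (\<lambda>x\<in>carrier A. \<delta> p * \<rho> p x) (\<pi> q)"
        using P_closed[OF q] coef_path[OF p q] by (cases "q = p") (auto simp: \<delta>_def af)
    qed
    then show ?thesis by (simp add: af)
  qed
  \<comment> \<open>The part of \<open>M p\<close> in \<open>A\<close> is supported on paths
    opposite to \<open>p\<close>; by \<open>no_return\<close> such a pair consists of one and the
    same trivial path.\<close>
  have M_fst: "coef q (fst (M p)) = 0" if p: "p \<in> P" and q: "q \<in> P" and ne: "q \<noteq> p \<or> qsource p \<noteq> qtarget p" for p q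
  proof (rule ccontr)
    assume "coef q (fst (M p)) \<noteq> 0"
    then have pq: "qsource q = qtarget p \<and> qtarget q = qsource p"
      by (rule comp(1)[OF p p p p q])
    then have "p = tr (qsource p)" "q = tr (qsource q)"
      using no_return[OF p q] no_return[OF q p] by auto
    then show False
      using ne pq by (metis qtarget.simps)
  qed
  have M_scale: "M p = \<delta> p \<odot>\<^bsub>TE\<^esub> kap (\<rho> p)" if p: "p \<in> P" and fst: "\<And>q. q \<in> P \<Longrightarrow> coef q (fst (M p)) = 0" for p
  proof -
    obtain a f where af: "a \<in> carrier A" "f \<in> Dual" "M p = (a, f)"
      using Mcl[OF p] by (rule TE_E)
    have "a = \<zero>"
      using fst by (intro coef_eqI af) (simp add: af)
    then show ?thesis
      using M_snd[OF p] by (simp add: kap_scale) (simp add: af kap_def)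
  qed
  have nontrivial: "M p = \<delta> p \<odot>\<^bsub>TE\<^esub> kap (\<rho> p)
      \<and> M (tr (qsource p)) = \<delta> p \<odot>\<^bsub>TE\<^esub> kap (\<rho> (tr (qsource p)))
      \<and> M (tr (qtarget p)) = \<delta> p \<odot>\<^bsub>TE\<^esub> kap (\<rho> (tr (qtarget p)))"
    if p: "p \<in> P" and ne: "qsource p \<noteq> qtarget p" for p
  proof (intro conjI)
    show Mp: "M p = \<delta> p \<odot>\<^bsub>TE\<^esub> kap (\<rho> p)"
      using M_fst[OF p] ne by (intro M_scale[OF p]) blast
    \<comment> \<open>The Leibniz rule for the product in \<open>incl_kap_\<rho>\<close>: as
      \<open>D\<close> kills the factor from \<open>A\<close>, the dual of the source inherits the
      scalar of \<open>p\<close>.\<close>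
    have "M (tr (qsource p)) = incl (\<pi> p) \<otimes>\<^bsub>TE\<^esub> M p"
      unfolding M_def incl_kap_\<rho>(1)[OF p, symmetric]
      using Dcl kapcl[OF p] inclcl[OF p] D0[OF P_closed[OF p]] by (simp add: T.derivation_mult[OF D])
    then show "M (tr (qsource p)) = \<delta> p \<odot>\<^bsub>TE\<^esub> kap (\<rho> (tr (qsource p)))"
      using kapcl[OF p] inclcl[OF p] by (simp add: Mp T.scale_mult_right incl_kap_\<rho>(1)[OF p])
    have "M (tr (qtarget p)) = M p \<otimes>\<^bsub>TE\<^esub> incl (\<pi> p)"
      unfolding M_def incl_kap_\<rho>(2)[OF p, symmetric]
      using Dcl kapcl[OF p] inclcl[OF p] D0[OF P_closed[OF p]] by (simp add: T.derivation_mult[OF D])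
    then show "M (tr (qtarget p)) = \<delta> p \<odot>\<^bsub>TE\<^esub> kap (\<rho> (tr (qtarget p)))"
      using kapcl[OF p] inclcl[OF p] by (simp add: Mp T.scale_mult_left incl_kap_\<rho>(2)[OF p])
  qed
  have \<delta>_eq: "\<delta> q = c" if "q \<in> P" "M q = c \<odot>\<^bsub>TE\<^esub> kap (\<rho> q)" for q c
    using that P_closed[of q] coef_path[of q q] by (simp add: \<delta>_def kap_scale) (simp add: kap_def)
  have \<delta>_ends: "\<delta> (tr (qsource p)) = \<delta> p" "\<delta> (tr (qtarget p)) = \<delta> p"
    if p: "p \<in> P" and ne: "qsource p \<noteq> qtarget p" for p
    using \<delta>_eq[OF triv_P] nontrivial[OF p ne] source_vert[OF p] target_vert[OF p] by blast+
  obtain r where r: "r \<in> verts Q"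
    using conn by (auto simp: connected_conv)
  have const: "\<delta> (tr v) = \<delta> (tr r)" if v: "v \<in> verts Q" for v
  proof -
    obtain w where w: "pre_digraph.awalk (underlying_graph Q) r w v"
      using Q.connected_UG_awalk[OF conn r v] by blast
    \<comment> \<open>On the vertices \<open>\<delta>\<close> is a potential of the zero weight
      function, hence constant along undirected walks.\<close>
    have "0 = \<delta> (tr (head Q e)) - \<delta> (tr (tail Q e))" if e: "e \<in> arcs Q" for e
      using \<delta>_ends[OF arc_P[OF e]] arc_ends_neq[OF e] by simp
    then have "sum_list (map (Q.signed (\<lambda>_. 0)) w) = \<delta> (tr v) - \<delta> (tr r)"
      by (rule Q.signed_sum_potential[OF _ w])
    moreover have "sum_list (map (Q.signed (\<lambda>_. 0)) w) = 0 - (0 :: 'k)"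
      by (rule Q.signed_sum_potential[OF _ w]) simp
    ultimately show ?thesis by simp
  qed
  have trivial: "M (tr v) = \<delta> (tr v) \<odot>\<^bsub>TE\<^esub> kap (\<rho> (tr v))" if v: "v \<in> verts Q" for v
  proof (cases "arcs Q = {}")
    case False
    then obtain e where e: "e \<in> arcs Q" by blast
    \<comment> \<open>If there is an arrow at all, connectedness makes every vertex an end of some
      arrow, and \<open>nontrivial\<close> applies to that arrow.\<close>
    have "\<exists>e\<in>arcs Q. v = tail Q e \<or> v = head Q e"
    proof -
      obtain w where w: "pre_digraph.awalk (underlying_graph Q) v w (tail Q e)"
        using Q.connected_UG_awalk[OF conn v, of "tail Q e"] e by auto
      show ?thesis
      proof (cases w)
        case Nil
        then show ?thesis
          using w e by (auto simp: wf_digraph.awalk_Nil_iff[OF Q.wf_UG])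
      next
        case (Cons x w')
        then show ?thesis
          using w by (cases x) (auto simp: wf_digraph.awalk_Cons_iff[OF Q.wf_UG])
      qed
    qed
    then obtain e' where e': "e' \<in> arcs Q" "v = tail Q e' \<or> v = head Q e'" by blast
    then obtain p where p: "p \<in> P" "qsource p \<noteq> qtarget p" "v = qsource p \<or> v = qtarget p"
      using arc_P[OF e'(1)] arc_ends_neq[OF e'(1)] by fastforce
    then show ?thesis
      using nontrivial[OF p(1,2)] \<delta>_ends[OF p(1,2)] by auto
  next
    case True
    \<comment> \<open>On the dual numbers \<open>k[x]\<close>, the derivation \<open>x \<mapsto> 1\<close> exists only in characteristic 2.\<close>
    then have two: "(2::'k) \<noteq> 0"
      using nontriv by simp
    let ?p = "tr v"
    have p: "?p \<in> P" by (rule triv_P[OF v])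
    obtain a f where af: "a \<in> carrier A" "f \<in> Dual" "M ?p = (a, f)"
      using Mcl[OF p] by (rule TE_E)
    have "\<zero>\<^bsub>TE\<^esub> = D (kap (\<rho> ?p) \<otimes>\<^bsub>TE\<^esub> kap (\<rho> ?p))"
      using kap_kap[OF \<rho>_Dual[OF p] \<rho>_Dual[OF p]] klin_zero[OF kspace_TE kspace_TE lin] by simp
    also have "\<dots> = M ?p \<otimes>\<^bsub>TE\<^esub> kap (\<rho> ?p) \<oplus>\<^bsub>TE\<^esub> kap (\<rho> ?p) \<otimes>\<^bsub>TE\<^esub> M ?p"
      using kapcl[OF p] by (simp add: T.derivation_mult[OF D] M_def)
    finally have eq: "M ?p \<otimes>\<^bsub>TE\<^esub> kap (\<rho> ?p) \<oplus>\<^bsub>TE\<^esub> kap (\<rho> ?p) \<otimes>\<^bsub>TE\<^esub> M ?p = \<zero>\<^bsub>TE\<^esub>"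
      by (rule sym)
    \<comment> \<open>Evaluated at the vertex, the derivative of the vanishing square is twice the
      coefficient of the vertex in \<open>a\<close>.\<close>
    have "snd (M ?p \<otimes>\<^bsub>TE\<^esub> kap (\<rho> ?p) \<oplus>\<^bsub>TE\<^esub> kap (\<rho> ?p) \<otimes>\<^bsub>TE\<^esub> M ?p) (\<pi> ?p) = 0"
      unfolding eq using P_closed[OF p] by (simp add: TE_simps)
    then have sum0: "\<rho> ?p (\<pi> ?p \<otimes> a) + \<rho> ?p (a \<otimes> \<pi> ?p) = 0"
      using af \<rho>_Dual[OF p] P_closed[OF p]
      by (simp add: kap_def TE_mult TE_simps(4) Dual_zero del: Int_iff)
    have "coef ?p (\<pi> ?p \<otimes> a) = coef ?p a" "coef ?p (a \<otimes> \<pi> ?p) = coef ?p a"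
      using coef_mult_left[OF finP p af(1)] coef_mult_right[OF finP p af(1)] by simp_all
    with sum0 have "coef ?p a + coef ?p a = 0"
      using af(1) P_closed[OF p] by simp
    then have "2 * coef ?p a = 0"
      unfolding mult_2 .
    then have "coef ?p a = 0"
      using two unfolding mult_eq_0_iff by blast
    then have 0: "coef q (fst (M ?p)) = 0" if q: "q \<in> P" for q
    proof (cases "q = ?p")
      case True
      then show ?thesis
        using \<open>coef ?p a = 0\<close> by (simp only: af(3) fst_conv)
    next
      case False
      then show ?thesis
        using M_fst[OF p q] by blast
    qed
    show ?thesis
      by (rule M_scale[OF p 0])
  qed
  define d where "d = \<delta> (tr r)"
  have Md: "M p = d \<odot>\<^bsub>TE\<^esub> kap (\<rho> p)" if p: "p \<in> P" for p
  proof (cases "qsource p = qtarget p")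
    case True
    then have "p = tr (qsource p)"
      by (intro no_return[OF p p]) auto
    then show ?thesis
      using trivial[OF source_vert[OF p]] const[OF source_vert[OF p]] by (simp add: d_def)
  next
    case False
    then show ?thesis
      using nontrivial[OF p False] \<delta>_ends(1)[OF p False] const[OF source_vert[OF p]] by (simp add: d_def)
  qed
  show ?thesis
  proof (intro exI[of _ d] ballI)
    fix u assume "u \<in> carrier TE"
    then obtain a f where a: "a \<in> carrier A" and f: "f \<in> Dual" and u: "u = (a, f)"
      by (rule TE_E)
    have f_eq: "f = (\<lambda>x\<in>carrier A. \<Sum>p\<in>P. f (\<pi> p) * \<rho> p x)"
    proof (rule extensionalityI[of f "carrier A"])
      fix x assume x: "x \<in> carrier A"
      have "f x = f (\<Oplus>p\<in>P. coef p x \<odot> \<pi> p)"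
        using expand[OF finP x] by simp
      also have "\<dots> = (\<Sum>p\<in>P. f (coef p x \<odot> \<pi> p))"
        using klin_finsum[OF kspace_axioms kspace_ground, of f "\<lambda>p. coef p x \<odot> \<pi> p" P] f P_closed
        by (simp add: finsum_ground_space Pi_iff)
      also have "\<dots> = (\<Sum>p\<in>P. f (\<pi> p) * \<rho> p x)"
        using P_closed x by (intro sum.cong refl) (simp add: Dual_scale[OF f] mult.commute)
      finally show "f x = (\<lambda>x\<in>carrier A. \<Sum>p\<in>P. f (\<pi> p) * \<rho> p x) x"
        using x by simp
    qed (use f in auto)
    have kf: "kap f = (\<Oplus>\<^bsub>TE\<^esub>p\<in>P. f (\<pi> p) \<odot>\<^bsub>TE\<^esub> kap (\<rho> p))"
      by (rule trans[OF arg_cong[OF f_eq, of kap] finsum_kap[OF finP \<rho>_Dual, symmetric]])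
    have cl: "(\<lambda>p. f (\<pi> p) \<odot>\<^bsub>TE\<^esub> kap (\<rho> p)) \<in> P \<rightarrow> carrier TE"
      using kapcl T.scale_closed by (intro Pi_I) blast
    have "D u = D (kap f)"
      using a f by (simp add: u incl_plus_kap klin_add[OF lin] incl_closed kap_closed D0 Dcl del: Int_iff)
    also have "\<dots> = (\<Oplus>\<^bsub>TE\<^esub>p\<in>P. D (f (\<pi> p) \<odot>\<^bsub>TE\<^esub> kap (\<rho> p)))"
      unfolding kf by (rule klin_finsum[OF kspace_TE kspace_TE lin cl])
    also have "\<dots> = (\<Oplus>\<^bsub>TE\<^esub>p\<in>P. d \<odot>\<^bsub>TE\<^esub> (f (\<pi> p) \<odot>\<^bsub>TE\<^esub> kap (\<rho> p)))"
      using kapcl Md cl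
      by (intro T.finsum_cong') (simp_all add: Pi_iff klin_scale[OF lin] M_def[symmetric]
          T.scale_scale mult.commute del: Int_iff split_paired_All)
    also have "\<dots> = d \<odot>\<^bsub>TE\<^esub> kap f"
      unfolding kf by (rule T.scale_finsum[OF cl, symmetric])
    \<comment> \<open>The shift by the unit is the projection of the trivial extension onto
      \<open>DA\<close>.\<close>
    also have "kap f = central_shift \<one> u"
      using f by (auto simp: u central_shift_def kap_def intro!: extensionalityI[of _ "carrier A"])
    finally show "D u = d \<odot>\<^bsub>TE\<^esub> central_shift \<one> u" .
  qed
qed

text \<open>The generator is the class of the shift by the unit, the Euler derivation of the grading
  of \<open>TA\<close> with \<open>A\<close> in degree 0 and \<open>DA\<close> in degree 1. Its
  class is nonzero because the unit is nonzero.\<close>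

theorem HH1_TE_dim_one:
  "vectorspace.fin_dim class_ring (HH1 TE) \<and> vectorspace.dim class_ring (HH1 TE) = 1"
proof -
  interpret H: kspace "HH1 TE" by (rule T.kspace_HH1)
  have one: "\<one> \<in> carrier (center A)"
    by (simp add: center_iff)
  have nz: "shift_class \<one> \<noteq> \<zero>\<^bsub>HH1 TE\<^esub>"
    using shift_class_eq_zero[OF dual_separates one] one_neq_zero[OF conn] by blast
  note dE = derivation_central_shift[OF one]
  have "\<exists>c. X = c \<odot>\<^bsub>HH1 TE\<^esub> shift_class \<one>" if "X \<in> carrier (HH1 TE)" for X
  proof -
    obtain D where D: "T.derivation D" and X: "X = T.dclass D"
      using \<open>X \<in> _\<close> by (rule T.HH1_dclass)
    obtain s where s: "s \<in> carrier TE"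
      and Ds: "\<And>a. a \<in> carrier A \<Longrightarrow> D (incl a) = incl a \<otimes>\<^bsub>TE\<^esub> s \<ominus>\<^bsub>TE\<^esub> s \<otimes>\<^bsub>TE\<^esub> incl a"
      using derivation_incl_inner[OF D] by blast
    let ?E = "\<lambda>u. D u \<ominus>\<^bsub>TE\<^esub> (u \<otimes>\<^bsub>TE\<^esub> s \<ominus>\<^bsub>TE\<^esub> s \<otimes>\<^bsub>TE\<^esub> u)"
    have E: "T.derivation ?E"
      by (rule T.derivation_minus_inner[OF D s])
    have zero: "?E (incl a) = \<zero>\<^bsub>TE\<^esub>" if "a \<in> carrier A" for a
      using Ds[OF that] s incl_closed[OF that] T.derivation_closed[OF D] by simp
    obtain d where d: "\<forall>u\<in>carrier TE. ?E u = d \<odot>\<^bsub>TE\<^esub> central_shift \<one> u"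
      using derivation_zero_on_incl[OF E zero] ..
    have "X = T.dclass ?E"
      unfolding X by (rule T.dclass_minus_inner[OF D s, symmetric])
    also have "\<dots> = T.dclass (\<lambda>u. d \<odot>\<^bsub>TE\<^esub> central_shift \<one> u)"
      by (rule T.dclass_cong[OF E T.derivation_scale[OF dE] bspec[OF d]])
    also have "\<dots> = d \<odot>\<^bsub>HH1 TE\<^esub> shift_class \<one>"
      unfolding shift_class_def by (rule T.dclass_scale[OF dE])
    finally show ?thesis ..
  qed
  then show ?thesis
    unfolding H.dim_one_iff using nz klin_closed[OF klin_shift_class one] by blast
qed

end

theorem corollary4p13:
  fixes Q :: "('v, 'e) pre_digraph"
    and Z :: "('v, 'e) qpath set"
    and A :: "('k::field, (('v, 'e) qpath \<Rightarrow>\<^sub>0 'k) set) module"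
    and \<Lambda> :: "('k, (('v, 'e) qpath \<Rightarrow>\<^sub>0 'k) set \<times> ((('v, 'e) qpath \<Rightarrow>\<^sub>0 'k) set \<Rightarrow> 'k)) module"
  assumes "fin_digraph Q"
    and "Digraph_Component.connected Q"
    and "monomial_relations Q Z"
    and "A = monomial_algebra Q Z"
    and "vectorspace.fin_dim class_ring A"
    and "\<Lambda> = trivial_extension A"
    and not_point_in_char_2: "(2::'k) \<noteq> 0 \<or> arcs Q \<noteq> {}"
  shows "((\<exists>\<phi>. \<phi> \<in> module_hom class_ring (center A) (HH1 \<Lambda>) \<and>
              bij_betw \<phi> (carrier (center A)) (carrier (HH1 \<Lambda>)))
          \<longleftrightarrow> (vectorspace.fin_dim class_ring (HH1 \<Lambda>) \<and> vectorspace.dim class_ring (HH1 \<Lambda>) = 1))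
    \<and> ((vectorspace.fin_dim class_ring (HH1 \<Lambda>) \<and> vectorspace.dim class_ring (HH1 \<Lambda>) = 1)
          \<longleftrightarrow> carrier (HH1 A) = {\<zero>\<^bsub>HH1 A\<^esub>})
    \<and> (carrier (HH1 A) = {\<zero>\<^bsub>HH1 A\<^esub>}
          \<longleftrightarrow> (nomulti_digraph Q \<and> underlying_tree Q))"
proof -
  interpret fin_digraph Q by fact
  interpret monomial_data Q Z
    using assms(3) by unfold_locales
  \<comment> \<open>From here on the quotient is not inspected any more: \<open>A\<close> enters
    only through its basis of paths and its finite dimension.\<close>
  interpret path_basis A Q "qpaths Q - bad" pclass pcoef
    unfolding assms(4) by (rule path_basis_MA)
  have fin: "finite (qpaths Q - bad)"
    by (rule finite_P[OF assms(5)])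
  let ?iso = "\<exists>\<phi>. \<phi> \<in> module_hom class_ring (center A) (HH1 \<Lambda>)
    \<and> bij_betw \<phi> (carrier (center A)) (carrier (HH1 \<Lambda>))"
  let ?dim = "vectorspace.fin_dim class_ring (HH1 \<Lambda>) \<and> vectorspace.dim class_ring (HH1 \<Lambda>) = 1"
  let ?zero = "carrier (HH1 A) = {\<zero>\<^bsub>HH1 A\<^esub>}"
  let ?tree = "nomulti_digraph Q \<and> underlying_tree Q"
  have ?iso if dim: ?dim
    using center_iso_if_dim_one[OF dual_separates one_neq_zero[OF assms(2)]] dim
    unfolding assms(6) by blast
  moreover have ?zero if iso: ?iso
  proof -
    obtain \<phi> where "\<phi> \<in> module_hom class_ring (center A) (HH1 \<Lambda>)"
      "bij_betw \<phi> (carrier (center A)) (carrier (HH1 \<Lambda>))"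
      using iso by blast
    then show ?thesis
      unfolding assms(6) by (rule HH1_trivial_if_center_iso[OF dual_separates assms(5)])
  qed
  moreover have ?tree if zero: ?zero
    by (rule tree_if_HH1_trivial[OF fin assms(2) zero])
  moreover have ?dim if tree: ?tree
  proof -
    interpret tree_path_basis A Q "qpaths Q - bad" pclass pcoef
      using fin assms(2) tree not_point_in_char_2 by unfold_locales simp_all
    show ?thesis
      unfolding assms(6) by (rule HH1_TE_dim_one)
  qed
  ultimately show ?thesis by blast
qed

end
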